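(* Let $M^n$, $O^{n+1}$ be smooth manifolds and $T>0$. Let $g^O(\tau)$, $\tau\in(0,T]$, be a smooth family of Riemannian metrics on $O^{n+1}$ and $F_\tau:M^n\to O^{n+1}$, $\tau\in(0,T]$, a smooth family of immersions with $M_\tau=F_\tau(M^n)$, solving the mean curvature flow in a backwards Ricci flow background $$\frac{\partial}{\partial \tau}F_\tau=-H\nu,\qquad \frac{\partial}{\partial \tau}g^O=2\,\mathrm{Ric}_{g^O}.$$ Suppose that $g^O(\tau)$ has uniformly bounded curvature and that $M_\tau$ has uniformly bounded second fundamental form. For large $N>0$ let $\bar g=\bar g_N$ be the metric on $O^{n+1}\times(0,T]$ given by $$\bar g=g^O(\tau)+\left(N+R_{g^O}\right)d\tau^2,$$ let $\bar f(y,\tau)=-N\tau$, and let $\bar\Sigma=\{(x,\tau):x\in M_\tau,\ \tau\in(0,T]\}$ be the space-time track of $M_\tau$, viewed as an immersed hypersurface of $(O^{n+1}\times(0,T],\bar g)$. Then $\bar\Sigma$ is an approximate soliton of the mean curvature flow, i.e. the quantity $$\bar E_N=H^{\bar\Sigma}+\nu^{\bar\Sigma}\bar f$$ is such that $N|\bar E_N|$ is bounded uniformly locally on $\bar\Sigma$, independently of $N$. Here $H^{\bar\Sigma}$ and $\nu^{\bar\Sigma}$ are the mean curvature and the unit normal of $\bar\Sigma$ with respect to $\bar g$, and $\nu^{\bar\Sigma}\bar f$ is the derivative of $\bar f$ in direction $\nu^{\bar\Sigma}$.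
   Context: Conventions. $\nu$ is a smooth choice of unit normal on $M_\tau$ with respect to $g^O(\tau)$; the second fundamental form of $M_\tau$ is $h(X,Y)=-g^O({}^{g^O}\nabla_XY,\nu)$ for tangential $X,Y$, and $H$ is its trace with respect to the induced metric $g$ on $M_\tau$ (so that $\partial_\tau F_\tau=-H\nu$ is the usual mean curvature flow). $\mathrm{Ric}_{g^O}$ and $R_{g^O}$ are the Ricci tensor and scalar curvature of $g^O(\tau)$, with the usual sign (positive on round spheres). The parameter $N$ is always taken large enough that $\bar g_N$ is a Riemannian metric (possible because the curvature is uniformly bounded). The product $O^{n+1}\times(0,T]$ carries no mixed space-time components in $\bar g$. The track $\bar\Sigma$ is the immersion $F^{\bar\Sigma}:M^n\times(0,T]\to O^{n+1}\times(0,T]$, $F^{\bar\Sigma}(x,\tau)=(F_\tau(x),\tau)$. Its unit normal $\nu^{\bar\Sigma}$ is chosen on the same side as $\nu$, i.e. $\bar g(\nu^{\bar\Sigma},\nu)>0$; its second fundamental form is $h^{\bar\Sigma}(X,Y)=-\bar g(\bar\nabla_XY,\nu^{\bar\Sigma})$ with $\bar\nabla$ the Levi-Civita connection of $\bar g$, and $H^{\bar\Sigma}$ is the trace of $h^{\bar\Sigma}$ with respect to the metric induced by $\bar g$. "$N|\bar E_N|$ is bounded uniformly locally on $\bar\Sigma$, independently of $N$" means: there is $N_0>0$ such that for every compact $K\subset M^n\times(0,T]$ there is a constant $C$, not depending on $N$, with $N|\bar E_N|\le C$ on $K$ for all $N\ge N_0$ (functions on $\bar\Sigma$ being regarded as functions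 on $M^n\times(0,T]$). *)

theory Defs
  imports "HOL-Analysis.Analysis"
begin

section \<open>Smoothness\<close>

abbreviation deriv_within ::
  "'a::real_normed_vector set \<Rightarrow> ('a \<Rightarrow> 'b::real_normed_vector) \<Rightarrow> 'a \<Rightarrow> 'a \<Rightarrow> 'b" where
  "deriv_within S f x u \<equiv> frechet_derivative f (at x within S) u"

text \<open>All derivatives are taken within the set \<open>S\<close>.  Below, \<open>S\<close> is either open, or open relative to
  \<open>E \<times> {0<..T}\<close> for a Euclidean space \<open>E\<close>; in the second case the derivatives at time \<open>T\<close> are
  one-sided in time.  In both cases the derivative within \<open>S\<close> is unique where it exists.\<close>

primrec Ck_on ::
  "nat \<Rightarrow> 'a::real_normed_vector set \<Rightarrow> ('a \<Rightarrow> 'b::real_normed_vector) \<Rightarrow> bool" where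
  "Ck_on 0 S f \<longleftrightarrow> continuous_on S f"
| "Ck_on (Suc k) S f \<longleftrightarrow>
     (\<forall>x\<in>S. f differentiable (at x within S)) \<and> (\<forall>u. Ck_on k S (\<lambda>x. deriv_within S f x u))"

definition smooth_on ::
  "'a::real_normed_vector set \<Rightarrow> ('a \<Rightarrow> 'b::real_normed_vector) \<Rightarrow> bool" where
  "smooth_on S f \<longleftrightarrow> (\<forall>k. Ck_on k S f)"

section \<open>Manifolds\<close>

text \<open>An atlas is a family of charts (domain, coordinate map), indexed by a type; charts with empty
  domain are allowed, so the indexing is no restriction.\<close>

type_synonym ('i, 'm, 'e) atlas = "'i \<Rightarrow> 'm set \<times> ('m \<Rightarrow> 'e)"

definition cdom :: "('i, 'm, 'e) atlas \<Rightarrow> 'i \<Rightarrow> 'm set" where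
  "cdom A i = fst (A i)"

definition cmap :: "('i, 'm, 'e) atlas \<Rightarrow> 'i \<Rightarrow> 'm \<Rightarrow> 'e" where
  "cmap A i = snd (A i)"

definition cimg :: "('i, 'm, 'e) atlas \<Rightarrow> 'i \<Rightarrow> 'e set" where
  "cimg A i = cmap A i ` cdom A i"

definition cinv :: "('i, 'm, 'e) atlas \<Rightarrow> 'i \<Rightarrow> 'e \<Rightarrow> 'm" where
  "cinv A i = inv_into (cdom A i) (cmap A i)"

text \<open>The manifold is the whole type \<open>'m\<close>, of dimension \<open>DIM('e)\<close>.\<close>

definition smooth_atlas ::
  "('i, 'm::{t2_space, second_countable_topology}, 'e::euclidean_space) atlas \<Rightarrow> bool" where
  "smooth_atlas A \<longleftrightarrow>
     (\<Union>i. cdom A i) = UNIV \<and>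
     (\<forall>i. open (cdom A i) \<and> open (cimg A i) \<and>
          homeomorphism (cdom A i) (cimg A i) (cmap A i) (cinv A i)) \<and>
     (\<forall>i j. smooth_on (cmap A i ` (cdom A i \<inter> cdom A j)) (cmap A j \<circ> cinv A i))"

definition prod_atlas :: "real \<Rightarrow> ('i, 'm, 'e) atlas \<Rightarrow> ('i, 'm \<times> real, 'e \<times> real) atlas" where
  "prod_atlas T A i = (cdom A i \<times> {0<..T}, \<lambda>(p, \<tau>). (cmap A i p, \<tau>))"

text \<open>Quantities that do not depend on the chart are evaluated in an arbitrarily chosen one.\<close>

definition chart_at :: "('i, 'm, 'e) atlas \<Rightarrow> 'm \<Rightarrow> 'i" where
  "chart_at A p = (SOME i. p \<in> cdom A i)"

definition transition ::
  "('i, 'm, 'e::euclidean_space) atlas \<Rightarrow> 'i \<Rightarrow> 'i \<Rightarrow> 'm \<Rightarrow> 'e \<Rightarrow> 'e" where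
  "transition A i j p =
     deriv_within (cmap A i ` (cdom A i \<inter> cdom A j)) (cmap A j \<circ> cinv A i) (cmap A i p)"

text \<open>Tangent vectors are families of coordinate vectors, one for each chart at the base point, that
  transform by the derivatives of the coordinate changes.  The value \<open>0\<close> in the remaining charts is
  a convention that makes the family unique.\<close>

definition tangent_vector ::
  "('i, 'm, 'e::euclidean_space) atlas \<Rightarrow> 'm \<Rightarrow> ('i \<Rightarrow> 'e) \<Rightarrow> bool" where
  "tangent_vector A p v \<longleftrightarrow>
     (\<forall>i j. p \<in> cdom A i \<and> p \<in> cdom A j \<longrightarrow> v j = transition A i j p (v i)) \<and>
     (\<forall>i. p \<notin> cdom A i \<longrightarrow> v i = 0)"

text \<open>A metric is given by its components: \<open>G i x u v\<close> is the product of the vectors with coordinates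
  \<open>u\<close> and \<open>v\<close> in chart \<open>i\<close>, at the point with coordinates \<open>x \<in> cimg A i\<close>.\<close>

type_synonym ('i, 'e) metric = "'i \<Rightarrow> 'e \<Rightarrow> 'e \<Rightarrow> 'e \<Rightarrow> real"

definition riemannian_metric ::
  "('i, 'm, 'e::euclidean_space) atlas \<Rightarrow> ('i, 'e) metric \<Rightarrow> bool" where
  "riemannian_metric A G \<longleftrightarrow>
     (\<forall>i. \<forall>x\<in>cimg A i. bilinear (G i x) \<and> (\<forall>u v. G i x u v = G i x v u) \<and>
          (\<forall>u. u \<noteq> 0 \<longrightarrow> G i x u u > 0)) \<and>
     (\<forall>i u v. smooth_on (cimg A i) (\<lambda>x. G i x u v)) \<and>
     (\<forall>i j p u v. p \<in> cdom A i \<and> p \<in> cdom A j \<longrightarrow>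
        G j (cmap A j p) (transition A i j p u) (transition A i j p v) = G i (cmap A i p) u v)"

section \<open>Levi-Civita connection and curvature on a coordinate patch\<close>

definition sharp :: "('e \<Rightarrow> 'e \<Rightarrow> real) \<Rightarrow> ('e \<Rightarrow> real) \<Rightarrow> 'e" where
  "sharp g l = (THE w. \<forall>z. g w z = l z)"

definition metric_trace ::
  "('e::euclidean_space \<Rightarrow> 'e \<Rightarrow> real) \<Rightarrow> ('e \<Rightarrow> 'e \<Rightarrow> real) \<Rightarrow> real" where
  "metric_trace g b = (\<Sum>e\<in>Basis. sharp g (b e) \<bullet> e)"

text \<open>\<open>christoffel S G x u v\<close> is the covariant derivative in direction \<open>u\<close> of the field with constant
  coordinates \<open>v\<close>, given by the Koszul formula.\<close>

definition christoffel ::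
  "'e::euclidean_space set \<Rightarrow> ('e \<Rightarrow> 'e \<Rightarrow> 'e \<Rightarrow> real) \<Rightarrow> 'e \<Rightarrow> 'e \<Rightarrow> 'e \<Rightarrow> 'e" where
  "christoffel S G x u v = sharp (G x) (\<lambda>z.
     (deriv_within S (\<lambda>y. G y v z) x u + deriv_within S (\<lambda>y. G y u z) x v
       - deriv_within S (\<lambda>y. G y u v) x z) / 2)"

definition cov_deriv ::
  "'e::euclidean_space set \<Rightarrow> ('e \<Rightarrow> 'e \<Rightarrow> 'e \<Rightarrow> real) \<Rightarrow> ('e \<Rightarrow> 'e) \<Rightarrow> 'e \<Rightarrow> 'e \<Rightarrow> 'e" where
  "cov_deriv S G W x u = deriv_within S W x u + christoffel S G x u (W x)"

text \<open>\<open>R(u,v)w = \<nabla>\<^sub>u\<nabla>\<^sub>v w - \<nabla>\<^sub>v\<nabla>\<^sub>u w\<close> for fields \<open>u\<close>, \<open>v\<close>, \<open>w\<close> with constant coordinates, so that the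
  Ricci tensor, the trace of \<open>u \<mapsto> R(u,v)w\<close>, is positive on round spheres.\<close>

definition riemann ::
  "'e::euclidean_space set \<Rightarrow> ('e \<Rightarrow> 'e \<Rightarrow> 'e \<Rightarrow> real) \<Rightarrow> 'e \<Rightarrow> 'e \<Rightarrow> 'e \<Rightarrow> 'e \<Rightarrow> 'e" where
  "riemann S G x u v w =
     cov_deriv S G (\<lambda>y. christoffel S G y v w) x u - cov_deriv S G (\<lambda>y. christoffel S G y u w) x v"

definition ricci ::
  "'e::euclidean_space set \<Rightarrow> ('e \<Rightarrow> 'e \<Rightarrow> 'e \<Rightarrow> real) \<Rightarrow> 'e \<Rightarrow> 'e \<Rightarrow> 'e \<Rightarrow> real" where
  "ricci S G x v w = (\<Sum>e\<in>Basis. riemann S G x e v w \<bullet> e)"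

definition scalar_curvature ::
  "'e::euclidean_space set \<Rightarrow> ('e \<Rightarrow> 'e \<Rightarrow> 'e \<Rightarrow> real) \<Rightarrow> 'e \<Rightarrow> real" where
  "scalar_curvature S G x = metric_trace (G x) (ricci S G x)"

definition curvature_bounded_by ::
  "real \<Rightarrow> ('i, 'm, 'e::euclidean_space) atlas \<Rightarrow> ('i, 'e) metric \<Rightarrow> bool" where
  "curvature_bounded_by C A G \<longleftrightarrow>
     (\<forall>i. \<forall>x\<in>cimg A i. \<forall>u v w z.
        \<bar>G i x (riemann (cimg A i) (G i) x u v w) z\<bar>
          \<le> C * sqrt (G i x u u) * sqrt (G i x v v) * sqrt (G i x w w) * sqrt (G i x z z))"

section \<open>Immersions\<close>

definition rep_dom ::
  "('i, 'm, 'e) atlas \<Rightarrow> ('j, 'o, 'f) atlas \<Rightarrow> ('m \<Rightarrow> 'o) \<Rightarrow> 'i \<Rightarrow> 'j \<Rightarrow> 'e set" where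
  "rep_dom A B F i j = cmap A i ` (cdom A i \<inter> F -` cdom B j)"

definition rep ::
  "('i, 'm, 'e) atlas \<Rightarrow> ('j, 'o, 'f) atlas \<Rightarrow> ('m \<Rightarrow> 'o) \<Rightarrow> 'i \<Rightarrow> 'j \<Rightarrow> 'e \<Rightarrow> 'f" where
  "rep A B F i j = cmap B j \<circ> F \<circ> cinv A i"

definition smooth_map ::
  "('i, 'm::topological_space, 'e::euclidean_space) atlas \<Rightarrow>
   ('j, 'o::topological_space, 'f::euclidean_space) atlas \<Rightarrow> ('m \<Rightarrow> 'o) \<Rightarrow> bool" where
  "smooth_map A B F \<longleftrightarrow>
     continuous_on (\<Union>i. cdom A i) F \<and> (\<forall>i j. smooth_on (rep_dom A B F i j) (rep A B F i j))"

definition rep_deriv ::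
  "('i, 'm, 'e::euclidean_space) atlas \<Rightarrow> ('j, 'o, 'f::euclidean_space) atlas \<Rightarrow> ('m \<Rightarrow> 'o) \<Rightarrow>
   'i \<Rightarrow> 'j \<Rightarrow> 'e \<Rightarrow> 'e \<Rightarrow> 'f" where
  "rep_deriv A B F i j = deriv_within (rep_dom A B F i j) (rep A B F i j)"

definition smooth_immersion ::
  "('i, 'm::topological_space, 'e::euclidean_space) atlas \<Rightarrow>
   ('j, 'o::topological_space, 'f::euclidean_space) atlas \<Rightarrow> ('m \<Rightarrow> 'o) \<Rightarrow> bool" where
  "smooth_immersion A B F \<longleftrightarrow>
     smooth_map A B F \<and> (\<forall>i j. \<forall>x\<in>rep_dom A B F i j. inj (rep_deriv A B F i j x))"

text \<open>Smoothness of a vector field \<open>\<nu>\<close> along \<open>F\<close>, that is \<open>\<nu> p \<in> T\<^bsub>F p\<^esub>\<close>.\<close>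

definition smooth_field_along ::
  "('i, 'm, 'e::euclidean_space) atlas \<Rightarrow> ('j, 'o, 'f::euclidean_space) atlas \<Rightarrow> ('m \<Rightarrow> 'o) \<Rightarrow>
   ('m \<Rightarrow> 'j \<Rightarrow> 'f) \<Rightarrow> bool" where
  "smooth_field_along A B F \<nu> \<longleftrightarrow>
     (\<forall>i j. smooth_on (rep_dom A B F i j) (\<lambda>x. \<nu> (cinv A i x) j))"

definition unit_normal ::
  "('i, 'm, 'e::euclidean_space) atlas \<Rightarrow> ('j, 'o, 'f::euclidean_space) atlas \<Rightarrow> ('j, 'f) metric \<Rightarrow>
   ('m \<Rightarrow> 'o) \<Rightarrow> 'm \<Rightarrow> ('j \<Rightarrow> 'f) \<Rightarrow> bool" where
  "unit_normal A B G F p n \<longleftrightarrow>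
     tangent_vector B (F p) n \<and>
     (\<forall>i j. p \<in> cdom A i \<and> F p \<in> cdom B j \<longrightarrow>
        G j (cmap B j (F p)) (n j) (n j) = 1 \<and>
        (\<forall>u. G j (cmap B j (F p)) (rep_deriv A B F i j (cmap A i p) u) (n j) = 0))"

text \<open>Covariant derivative in direction \<open>u\<close> of the field \<open>W\<close> along \<open>F\<close>, everything in the charts
  \<open>i\<close>, \<open>j\<close>.\<close>

definition cov_deriv_along ::
  "('i, 'm, 'e::euclidean_space) atlas \<Rightarrow> ('j, 'o, 'f::euclidean_space) atlas \<Rightarrow> ('j, 'f) metric \<Rightarrow>
   ('m \<Rightarrow> 'o) \<Rightarrow> 'i \<Rightarrow> 'j \<Rightarrow> ('e \<Rightarrow> 'f) \<Rightarrow> 'e \<Rightarrow> 'e \<Rightarrow> 'f" where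
  "cov_deriv_along A B G F i j W x u =
     deriv_within (rep_dom A B F i j) W x u
     + christoffel (cimg B j) (G j) (rep A B F i j x) (rep_deriv A B F i j x u) (W x)"

text \<open>\<open>h(u,v) = -g(\<nabla>\<^sub>u (dF v), \<nu>)\<close> in the charts \<open>i\<close>, \<open>j\<close>, with \<open>v\<close> extended as a field with constant
  coordinates.\<close>

definition second_fundamental_form ::
  "('i, 'm, 'e::euclidean_space) atlas \<Rightarrow> ('j, 'o, 'f::euclidean_space) atlas \<Rightarrow> ('j, 'f) metric \<Rightarrow>
   ('m \<Rightarrow> 'o) \<Rightarrow> ('m \<Rightarrow> 'j \<Rightarrow> 'f) \<Rightarrow> 'i \<Rightarrow> 'j \<Rightarrow> 'm \<Rightarrow> 'e \<Rightarrow> 'e \<Rightarrow> real" where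
  "second_fundamental_form A B G F \<nu> i j p u v =
     - G j (cmap B j (F p))
         (cov_deriv_along A B G F i j (\<lambda>y. rep_deriv A B F i j y v) (cmap A i p) u) (\<nu> p j)"

definition induced_metric ::
  "('i, 'm, 'e::euclidean_space) atlas \<Rightarrow> ('j, 'o, 'f::euclidean_space) atlas \<Rightarrow> ('j, 'f) metric \<Rightarrow>
   ('m \<Rightarrow> 'o) \<Rightarrow> 'i \<Rightarrow> 'j \<Rightarrow> 'm \<Rightarrow> 'e \<Rightarrow> 'e \<Rightarrow> real" where
  "induced_metric A B G F i j p u v =
     G j (cmap B j (F p)) (rep_deriv A B F i j (cmap A i p) u) (rep_deriv A B F i j (cmap A i p) v)"

definition mean_curvature ::
  "('i, 'm, 'e::euclidean_space) atlas \<Rightarrow> ('j, 'o, 'f::euclidean_space) atlas \<Rightarrow> ('j, 'f) metric \<Rightarrow>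
   ('m \<Rightarrow> 'o) \<Rightarrow> ('m \<Rightarrow> 'j \<Rightarrow> 'f) \<Rightarrow> 'm \<Rightarrow> real" where
  "mean_curvature A B G F \<nu> p =
     (let i = chart_at A p; j = chart_at B (F p)
      in metric_trace (induced_metric A B G F i j p) (second_fundamental_form A B G F \<nu> i j p))"

definition sff_bounded_by ::
  "real \<Rightarrow> ('i, 'm, 'e::euclidean_space) atlas \<Rightarrow> ('j, 'o, 'f::euclidean_space) atlas \<Rightarrow>
   ('j, 'f) metric \<Rightarrow> ('m \<Rightarrow> 'o) \<Rightarrow> ('m \<Rightarrow> 'j \<Rightarrow> 'f) \<Rightarrow> bool" where
  "sff_bounded_by C A B G F \<nu> \<longleftrightarrow>
     (\<forall>i j p u v. p \<in> cdom A i \<and> F p \<in> cdom B j \<longrightarrow>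
        \<bar>second_fundamental_form A B G F \<nu> i j p u v\<bar>
          \<le> C * sqrt (induced_metric A B G F i j p u u) * sqrt (induced_metric A B G F i j p v v))"

definition directional_deriv ::
  "('j, 'o, 'f::euclidean_space) atlas \<Rightarrow> ('o \<Rightarrow> real) \<Rightarrow> 'o \<Rightarrow> ('j \<Rightarrow> 'f) \<Rightarrow> real" where
  "directional_deriv B f q w =
     (let j = chart_at B q in deriv_within (cimg B j) (f \<circ> cinv B j) (cmap B j q) (w j))"

section \<open>Mean curvature flow in a backwards Ricci flow background\<close>

definition smooth_metric_family ::
  "real \<Rightarrow> ('j, 'o, 'f::euclidean_space) atlas \<Rightarrow> (real \<Rightarrow> ('j, 'f) metric) \<Rightarrow> bool" where
  "smooth_metric_family T B g \<longleftrightarrow>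
     (\<forall>\<tau>\<in>{0<..T}. riemannian_metric B (g \<tau>)) \<and>
     (\<forall>j u v. smooth_on (cimg B j \<times> {0<..T}) (\<lambda>(y, \<tau>). g \<tau> j y u v))"

definition smooth_immersion_family ::
  "real \<Rightarrow> ('i, 'm::topological_space, 'e::euclidean_space) atlas \<Rightarrow>
   ('j, 'o::topological_space, 'f::euclidean_space) atlas \<Rightarrow> (real \<Rightarrow> 'm \<Rightarrow> 'o) \<Rightarrow> bool" where
  "smooth_immersion_family T A B F \<longleftrightarrow>
     (\<forall>\<tau>\<in>{0<..T}. smooth_immersion A B (F \<tau>)) \<and>
     smooth_map (prod_atlas T A) B (\<lambda>(x, \<tau>). F \<tau> x)"

definition smooth_unit_normal_family ::
  "real \<Rightarrow> ('i, 'm, 'e::euclidean_space) atlas \<Rightarrow> ('j, 'o, 'f::euclidean_space) atlas \<Rightarrow>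
   (real \<Rightarrow> ('j, 'f) metric) \<Rightarrow> (real \<Rightarrow> 'm \<Rightarrow> 'o) \<Rightarrow> (real \<Rightarrow> 'm \<Rightarrow> 'j \<Rightarrow> 'f) \<Rightarrow> bool" where
  "smooth_unit_normal_family T A B g F \<nu> \<longleftrightarrow>
     (\<forall>\<tau>\<in>{0<..T}. \<forall>x. unit_normal A B (g \<tau>) (F \<tau>) x (\<nu> \<tau> x)) \<and>
     smooth_field_along (prod_atlas T A) B (\<lambda>(x, \<tau>). F \<tau> x) (\<lambda>(x, \<tau>). \<nu> \<tau> x)"

definition mean_curvature_flow ::
  "real \<Rightarrow> ('i, 'm, 'e::euclidean_space) atlas \<Rightarrow> ('j, 'o, 'f::euclidean_space) atlas \<Rightarrow>
   (real \<Rightarrow> ('j, 'f) metric) \<Rightarrow> (real \<Rightarrow> 'm \<Rightarrow> 'o) \<Rightarrow> (real \<Rightarrow> 'm \<Rightarrow> 'j \<Rightarrow> 'f) \<Rightarrow> bool" where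
  "mean_curvature_flow T A B g F \<nu> \<longleftrightarrow>
     (\<forall>\<tau>\<in>{0<..T}. \<forall>x j. F \<tau> x \<in> cdom B j \<longrightarrow>
        ((\<lambda>s. cmap B j (F s x)) has_vector_derivative
           - mean_curvature A B (g \<tau>) (F \<tau>) (\<nu> \<tau>) x *\<^sub>R \<nu> \<tau> x j) (at \<tau> within {0<..T}))"

definition backwards_ricci_flow ::
  "real \<Rightarrow> ('j, 'o, 'f::euclidean_space) atlas \<Rightarrow> (real \<Rightarrow> ('j, 'f) metric) \<Rightarrow> bool" where
  "backwards_ricci_flow T B g \<longleftrightarrow>
     (\<forall>\<tau>\<in>{0<..T}. \<forall>j. \<forall>y\<in>cimg B j. \<forall>u v.
        ((\<lambda>s. g s j y u v) has_real_derivative 2 * ricci (cimg B j) (g \<tau> j) y u v)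
          (at \<tau> within {0<..T}))"

section \<open>The space-time track\<close>

definition spacetime_metric ::
  "('j, 'o, 'f::euclidean_space) atlas \<Rightarrow> (real \<Rightarrow> ('j, 'f) metric) \<Rightarrow> real \<Rightarrow>
   ('j, 'f \<times> real) metric" where
  "spacetime_metric B g N j = (\<lambda>(y, \<tau>) (u, a) (v, b).
     g \<tau> j y u v + (N + scalar_curvature (cimg B j) (g \<tau> j) y) * a * b)"

definition track :: "(real \<Rightarrow> 'm \<Rightarrow> 'o) \<Rightarrow> 'm \<times> real \<Rightarrow> 'o \<times> real" where
  "track F = (\<lambda>(x, \<tau>). (F \<tau> x, \<tau>))"

text \<open>The unit normal of the track on the side of \<open>\<nu>\<close>, where \<open>\<nu>\<close> is regarded as the vector
  \<open>(\<nu>, 0)\<close> tangent to \<open>O \<times> (0,T]\<close>.\<close>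

definition track_normal ::
  "real \<Rightarrow> ('i, 'm, 'e::euclidean_space) atlas \<Rightarrow> ('j, 'o, 'f::euclidean_space) atlas \<Rightarrow>
   (real \<Rightarrow> ('j, 'f) metric) \<Rightarrow> (real \<Rightarrow> 'm \<Rightarrow> 'o) \<Rightarrow> (real \<Rightarrow> 'm \<Rightarrow> 'j \<Rightarrow> 'f) \<Rightarrow> real \<Rightarrow>
   'm \<times> real \<Rightarrow> 'j \<Rightarrow> 'f \<times> real" where
  "track_normal T A B g F \<nu> N = (\<lambda>(x, \<tau>). THE w.
     unit_normal (prod_atlas T A) (prod_atlas T B) (spacetime_metric B g N) (track F) (x, \<tau>) w \<and>
     (\<forall>j. F \<tau> x \<in> cdom B j \<longrightarrow>
        spacetime_metric B g N j (cmap B j (F \<tau> x), \<tau>) (w j) (\<nu> \<tau> x j, 0) > 0))"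

definition soliton_error ::
  "real \<Rightarrow> ('i, 'm, 'e::euclidean_space) atlas \<Rightarrow> ('j, 'o, 'f::euclidean_space) atlas \<Rightarrow>
   (real \<Rightarrow> ('j, 'f) metric) \<Rightarrow> (real \<Rightarrow> 'm \<Rightarrow> 'o) \<Rightarrow> (real \<Rightarrow> 'm \<Rightarrow> 'j \<Rightarrow> 'f) \<Rightarrow> real \<Rightarrow>
   'm \<times> real \<Rightarrow> real" where
  "soliton_error T A B g F \<nu> N p =
     mean_curvature (prod_atlas T A) (prod_atlas T B) (spacetime_metric B g N) (track F)
       (track_normal T A B g F \<nu> N) p
     + directional_deriv (prod_atlas T B) (\<lambda>(y, \<tau>). - N * \<tau>) (track F p)
         (track_normal T A B g F \<nu> N p)"

end

theory Submission
  imports Defs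
begin

text \<open>
  Write \<open>L = N + R\<close>, \<open>b = H / L\<close> and \<open>s\<^sup>2 = 1 + H\<^sup>2 / L\<close>.  The track is tangent to \<open>(-H\<nu>, 1)\<close>, so its unit
  normal is \<open>(\<nu>, b) / s\<close>, and its induced metric is the orthogonal sum of the metric of \<open>M\<^sub>\<tau>\<close> and
  \<open>(L + H\<^sup>2) d\<tau>\<^sup>2\<close>.  The spatial part of its second fundamental form is \<open>(h + b Ric) / s\<close>, whose trace is
  \<open>(H + b (R - \<rho>)) / s\<close> with \<open>\<rho> = Ric(\<nu>,\<nu>)\<close>.  The drift term contributes
  \<open>-N b / s = (b R - H) / s\<close>, which cancels \<open>H / s\<close> to leading order, and what remains is
  \<open>b (2R - \<rho>) / s\<close> plus the time-time component divided by \<open>L + H\<^sup>2\<close>, both \<open>O(1/N)\<close> locally uniformly.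

  Two shortcuts avoid the transformation laws of curvature.  Since \<open>Ric = \<partial>\<^sub>\<tau>g / 2\<close> and coordinate changes
  do not involve time, the Ricci tensor is smooth in space-time and tensorial.  Since
  \<open>\<partial>\<^sub>\<tau>F = -H\<nu>\<close> holds in every chart, \<open>H\<close> is smooth and independent of charts.
\<close>

section \<open>Derivatives within relatively open sets\<close>

text \<open>Two obstacles shape the proof. \<open>mean_curvature\<close> and
  \<open>directional_deriv\<close> are evaluated in charts picked by \<open>chart_at\<close>, which
  jump from point to point, so the error cannot be treated as a continuous function directly. It is
  instead estimated pointwise, in the chosen charts, by \<open>error_bound\<close>, an expression
  free of N whose ingredients do not depend on charts. Its coordinate expressions are continuous and
  agree on overlaps, so it is bounded on compact sets, and one constant serves all large N at once.
  The other obstacle is the time-time component of the second fundamental form of the track. The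
  Koszul formula leaves there a spatial derivative of the metric, which depends on the chart. It
  cancels against the derivative of the normal, which is controlled by differentiating the relation
  g(\<nu>,\<nu>) = 1 along the track. The threshold for N comes from a bound \<bar>R\<bar> \<le> C:
  if N \<ge> 2\<bar>C\<bar> + 1, then L \<ge> N/2, and each factor 1/L costs at most 2/N.\<close>

text \<open>The premise of \<open>frechet_derivative_unique_within\<close>.  Steps of either sign are allowed, so that it
  also holds at the final time, where one can only step backwards.\<close>

definition axis_accessible :: "'a::euclidean_space set \<Rightarrow> bool" where
  "axis_accessible S \<longleftrightarrow>
     (\<forall>x\<in>S. \<forall>b\<in>Basis. \<forall>e>0. \<exists>d. 0 < \<bar>d\<bar> \<and> \<bar>d\<bar> < e \<and> x + d *\<^sub>R b \<in> S)"

lemma axis_accessible_open: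
  assumes "open S"
  shows "axis_accessible S"
  unfolding axis_accessible_def
proof (intro ballI allI impI)
  fix x b :: 'a and e :: real
  assume x: "x \<in> S" and b: "b \<in> Basis" and e: "e > 0"
  obtain r where r: "r > 0" "ball x r \<subseteq> S" using assms x openE by blast
  let ?d = "min e r / 2"
  have "x + ?d *\<^sub>R b \<in> ball x r" using r(1) e b by (auto simp: dist_norm)
  then show "\<exists>d. 0 < \<bar>d\<bar> \<and> \<bar>d\<bar> < e \<and> x + d *\<^sub>R b \<in> S"
    using r e by (intro exI[of _ ?d]) auto
qed

lemma axis_accessible_slab:
  fixes S :: "('a::euclidean_space \<times> real) set"
  assumes "openin (top_of_set (UNIV \<times> {0<..T})) S"
  shows "axis_accessible S"
  unfolding axis_accessible_def
proof (intro ballI allI impI)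
  fix x b :: "'a \<times> real" and e :: real
  assume x: "x \<in> S" and b: "b \<in> Basis" and e: "e > 0"
  obtain U where U: "open U" "S = (UNIV \<times> {0<..T}) \<inter> U"
    using assms by (auto simp: openin_open)
  obtain r where r: "r > 0" "ball x r \<subseteq> U" using openE[OF U(1)] x U(2) by (metis IntD2)
  have t: "0 < snd x" "snd x \<le> T" using x by (auto simp: U(2))
  \<comment> \<open>A backward step shorter than \<open>snd x\<close> keeps the time positive and
    never passes \<open>T\<close>, so one sign serves every point and every axis.\<close>
  define m where "m = min (min e r) (snd x) / 2"
  have m: "0 < m" "m < e" "m < r" "m < snd x" using r(1) e t by (auto simp: m_def min_def)
  have "x + (- m) *\<^sub>R b \<in> ball x r" using b m by (simp add: dist_norm)
  moreover have "x + (- m) *\<^sub>R b \<in> UNIV \<times> {0<..T}"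
    using b t m by (cases x) (auto simp: Basis_prod_def)
  ultimately have "x + (- m) *\<^sub>R b \<in> S" unfolding U(2) using subsetD[OF r(2)] by (intro IntI)
  then show "\<exists>d. 0 < \<bar>d\<bar> \<and> \<bar>d\<bar> < e \<and> x + d *\<^sub>R b \<in> S"
    using m by (intro exI[of _ "- m"]) auto
qed

text \<open>\<open>frechet_derivative\<close> is defined by choice, so it can be computed only where
  derivatives are unique. This rule identifies it with a derivative found by calculus.\<close>

lemma deriv_within_eq:
  assumes "axis_accessible S" "x \<in> S" "(f has_derivative f') (at x within S)"
  shows "frechet_derivative f (at x within S) = f'"
proof -
  have "(f has_derivative frechet_derivative f (at x within S)) (at x within S)"
    using assms(3) frechet_derivative_works differentiableI by blast
  then show ?thesis
    using assms(1,2) by (intro frechet_derivative_unique_within[OF _ assms(3)])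
      (auto simp: axis_accessible_def)
qed

lemma has_derivative_within_cong:
  assumes "\<And>y. y \<in> S \<Longrightarrow> f y = h y" "x \<in> S"
  shows "(f has_derivative d) (at x within S) \<longleftrightarrow> (h has_derivative d) (at x within S)"
  using has_derivative_transform[of x S f h d] has_derivative_transform[of x S h f d] assms by auto

lemma deriv_within_cong:
  assumes "\<And>y. y \<in> S \<Longrightarrow> f y = h y" "x \<in> S"
  shows "frechet_derivative f (at x within S) = frechet_derivative h (at x within S)"
  by (simp add: frechet_derivative_def has_derivative_within_cong[OF assms])

text \<open>Linearity in the parameter \<open>z\<close> is known only on \<open>S\<close>, but a
  derivative within \<open>S\<close> sees no more than that. The rule serves metrics, Christoffel
  symbols and differentials of maps alike.\<close>

lemma linear_deriv_within:
  assumes S: "axis_accessible S" "x \<in> S"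
    and lin: "\<And>y. y \<in> S \<Longrightarrow> linear (\<lambda>z. W z y)"
    and W: "\<And>z. (W z has_derivative W' z) (at x within S)"
  shows "linear (\<lambda>z. deriv_within S (W z) x h)"
proof (rule linearI)
  fix z z' c
  have "frechet_derivative (W (z + z')) (at x within S) = frechet_derivative (\<lambda>y. W z y + W z' y) (at x within S)"
    by (rule deriv_within_cong[OF _ S(2)]) (rule linear_add[OF lin])
  then show "deriv_within S (W (z + z')) x h = deriv_within S (W z) x h + deriv_within S (W z') x h"
    by (simp add: deriv_within_eq[OF S has_derivative_add[OF W W]] deriv_within_eq[OF S W])
  have "frechet_derivative (W (c *\<^sub>R z)) (at x within S) = frechet_derivative (\<lambda>y. c *\<^sub>R W z y) (at x within S)"
    by (rule deriv_within_cong[OF _ S(2)]) (rule linear_cmul[OF lin])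
  then show "deriv_within S (W (c *\<^sub>R z)) x h = c *\<^sub>R deriv_within S (W z) x h"
    by (simp add: deriv_within_eq[OF S has_derivative_scaleR_right[OF W]] deriv_within_eq[OF S W])
qed

section \<open>Closure properties of \<open>Ck_on\<close>\<close>

lemma Ck_on_cong:
  assumes "\<And>x. x \<in> S \<Longrightarrow> f x = h x"
  shows "Ck_on k S f \<longleftrightarrow> Ck_on k S h"
  using assms
proof (induction k arbitrary: f h)
  case 0
  then show ?case by (simp cong: continuous_on_cong)
next
  case (Suc k)
  have "(f differentiable (at x within S)) = (h differentiable (at x within S))" if "x \<in> S" for x
    by (simp add: differentiable_def has_derivative_within_cong[OF Suc.prems that])
  moreover have "Ck_on k S (\<lambda>x. deriv_within S f x u) = Ck_on k S (\<lambda>x. deriv_within S h x u)" for u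
    using Suc.prems by (intro Suc.IH) (metis deriv_within_cong)
  ultimately show ?case by simp
qed

lemma Ck_on_imp_continuous_on: "Ck_on k S f \<Longrightarrow> continuous_on S f"
proof (cases k)
  case (Suc n)
  assume "Ck_on k S f"
  then have "\<forall>x\<in>S. f differentiable (at x within S)" unfolding Suc by simp
  then show ?thesis
    unfolding continuous_on_eq_continuous_within
    using differentiable_imp_continuous_within by blast
qed auto

lemma Ck_on_Suc_imp: "Ck_on (Suc k) S f \<Longrightarrow> Ck_on k S f"
proof (induction k arbitrary: f)
  case 0
  then show ?case using Ck_on_imp_continuous_on[OF 0] by simp
next
  case (Suc k)
  then show ?case by (metis Ck_on.simps(2))
qed

text \<open>Lets the closure proofs below supply the derivative given by a calculus rule in place of
  the chosen \<open>frechet_derivative\<close>.\<close>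

lemma Ck_on_SucI:
  assumes "axis_accessible S"
    and "\<And>x. x \<in> S \<Longrightarrow> (f has_derivative f' x) (at x within S)"
    and "\<And>u. Ck_on k S (\<lambda>x. f' x u)"
  shows "Ck_on (Suc k) S f"
proof -
  have "Ck_on k S (\<lambda>x. deriv_within S f x u) = Ck_on k S (\<lambda>x. f' x u)" for u
    using assms(1,2) by (intro Ck_on_cong) (simp add: deriv_within_eq[OF assms(1) _ assms(2)])
  then show ?thesis using assms(2,3) by (auto simp: differentiable_def)
qed

lemma Ck_on_SucD:
  assumes "Ck_on (Suc k) S f"
  shows "x \<in> S \<Longrightarrow> (f has_derivative frechet_derivative f (at x within S)) (at x within S)"
    and "Ck_on k S (\<lambda>x. deriv_within S f x u)"
  using assms by (auto simp: frechet_derivative_works)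

lemma Ck_on_const: "axis_accessible S \<Longrightarrow> Ck_on k S (\<lambda>x. c)"
proof (induction k arbitrary: c)
  case (Suc k)
  show ?case by (rule Ck_on_SucI[OF Suc.prems has_derivative_const Suc.IH[OF Suc.prems]])
qed simp

lemma Ck_on_add:
  assumes "axis_accessible S" "Ck_on k S f" "Ck_on k S h"
  shows "Ck_on k S (\<lambda>x. f x + h x)"
  using assms(2,3)
proof (induction k arbitrary: f h)
  case 0
  then show ?case by (simp add: continuous_on_add)
next
  case (Suc k)
  note f = Ck_on_SucD[OF Suc.prems(1)] and h = Ck_on_SucD[OF Suc.prems(2)]
  show ?case by (rule Ck_on_SucI[OF assms(1) has_derivative_add[OF f(1) h(1)] Suc.IH[OF f(2) h(2)]])
qed

lemma Ck_on_bounded_linear: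
  assumes "axis_accessible S" "bounded_linear L" "Ck_on k S f"
  shows "Ck_on k S (\<lambda>x. L (f x))"
  using assms(3)
proof (induction k arbitrary: f)
  case 0
  then show ?case using bounded_linear.continuous_on[OF assms(2)] by simp
next
  case (Suc k)
  note f = Ck_on_SucD[OF Suc.prems]
  show ?case
    by (rule Ck_on_SucI[OF assms(1) bounded_linear.has_derivative[OF assms(2) f(1)] Suc.IH[OF f(2)]])
qed

lemma Ck_on_bilinear:
  assumes "axis_accessible S" "bounded_bilinear P" "Ck_on k S f" "Ck_on k S h"
  shows "Ck_on k S (\<lambda>x. P (f x) (h x))"
  using assms(3,4)
proof (induction k arbitrary: f h)
  case 0
  then show ?case using bounded_bilinear.continuous_on[OF assms(2)] by simp
next
  case (Suc k)
  \<comment> \<open>The product rule pairs one factor with the derivative of the other, so the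
    factors themselves are also needed one order lower.\<close>
  note f = Ck_on_SucD[OF Suc.prems(1)] Ck_on_Suc_imp[OF Suc.prems(1)]
    and h = Ck_on_SucD[OF Suc.prems(2)] Ck_on_Suc_imp[OF Suc.prems(2)]
  show ?case
    by (rule Ck_on_SucI[OF assms(1) bounded_bilinear.FDERIV[OF assms(2) f(1) h(1)]])
      (simp_all add: Ck_on_add[OF assms(1) Suc.IH[OF f(3) h(2)] Suc.IH[OF f(2) h(3)]])
qed

lemmas Ck_on_mult = Ck_on_bilinear[OF _ bounded_bilinear_mult]
lemmas Ck_on_scaleR = Ck_on_bilinear[OF _ bounded_bilinear_scaleR]

lemma Ck_on_cmult:
  fixes c :: real
  shows "axis_accessible S \<Longrightarrow> Ck_on k S f \<Longrightarrow> Ck_on k S (\<lambda>x. c * f x)"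
  using Ck_on_mult[OF _ Ck_on_const] .

lemma Ck_on_sum:
  assumes "axis_accessible S" "\<And>i. i \<in> K \<Longrightarrow> Ck_on k S (f i)"
  shows "Ck_on k S (\<lambda>x. \<Sum>i\<in>K. f i x)"
  using assms(2)
  by (induction K rule: infinite_finite_induct)
    (simp_all add: Ck_on_add[OF assms(1)] Ck_on_const[OF assms(1)])

lemma smooth_on_deriv: "smooth_on S f \<Longrightarrow> smooth_on S (\<lambda>x. deriv_within S f x u)"
  unfolding smooth_on_def by (metis Ck_on.simps(2))

lemma smooth_on_has_derivative:
  "smooth_on S f \<Longrightarrow> x \<in> S \<Longrightarrow> (f has_derivative frechet_derivative f (at x within S)) (at x within S)"
  unfolding smooth_on_def by (meson Ck_on_SucD(1))

lemma smooth_on_imp_continuous_on: "smooth_on S f \<Longrightarrow> continuous_on S f"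
  unfolding smooth_on_def by (metis Ck_on.simps(1))

lemma smooth_on_cong: "(\<And>x. x \<in> S \<Longrightarrow> f x = h x) \<Longrightarrow> smooth_on S f \<longleftrightarrow> smooth_on S h"
  unfolding smooth_on_def by (metis Ck_on_cong)

section \<open>Inner products and orthonormal bases\<close>

definition inner_form :: "('a::euclidean_space \<Rightarrow> 'a \<Rightarrow> real) \<Rightarrow> bool" where
  "inner_form g \<longleftrightarrow> bilinear g \<and> (\<forall>u v. g u v = g v u) \<and> (\<forall>u. u \<noteq> 0 \<longrightarrow> g u u > 0)"

lemma inner_formD:
  assumes "inner_form g"
  shows "bilinear g" "g u v = g v u" "u \<noteq> 0 \<Longrightarrow> g u u > 0" "g u u \<ge> 0"
proof -
  show b: "bilinear g" and "g u v = g v u" and p: "u \<noteq> 0 \<Longrightarrow> g u u > 0"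
    using assms by (auto simp: inner_form_def)
  show "g u u \<ge> 0" using p bilinear_lzero[OF b] by (cases "u = 0") (auto simp: less_imp_le)
qed

lemmas bilinear_simps = bilinear_ladd bilinear_radd bilinear_lsub bilinear_rsub bilinear_lmul
  bilinear_rmul bilinear_lneg bilinear_rneg bilinear_lzero bilinear_rzero

lemma bilinear_sum_left:
  assumes "bilinear g" shows "g (\<Sum>i\<in>K. f i) v = (\<Sum>i\<in>K. g (f i) v)"
  using linear_sum[of "\<lambda>u. g u v"] assms by (simp add: bilinear_def)

lemma linear_expand:
  assumes "linear (l :: 'a::euclidean_space \<Rightarrow> 'b::real_vector)"
  shows "l z = (\<Sum>e\<in>Basis. (z \<bullet> e) *\<^sub>R l e)"
  using linear_sum[OF assms, of "\<lambda>e. (z \<bullet> e) *\<^sub>R e" Basis]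
  by (simp add: euclidean_representation linear_cmul[OF assms])

lemma bilinear_expand:
  fixes b :: "'a::euclidean_space \<Rightarrow> 'b::euclidean_space \<Rightarrow> real"
  assumes "bilinear b"
  shows "b u v = (\<Sum>e\<in>Basis. \<Sum>e'\<in>Basis. (u \<bullet> e) * (v \<bullet> e') * b e e')"
proof -
  have 1: "linear (\<lambda>u. b u v)" and 2: "linear (b e)" for e
    using assms by (auto simp: bilinear_def)
  have 3: "b e v = (\<Sum>e'\<in>Basis. (v \<bullet> e') * b e e')" for e
    using linear_expand[OF 2, of e v] by simp
  have "b u v = (\<Sum>e\<in>Basis. (u \<bullet> e) * b e v)"
    using linear_expand[OF 1, of u] by simp
  also have "\<dots> = (\<Sum>e\<in>Basis. (u \<bullet> e) * (\<Sum>e'\<in>Basis. (v \<bullet> e') * b e e'))"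
    by (simp only: 3)
  finally show ?thesis by (simp add: sum_distrib_left mult.assoc)
qed

definition orthonormal_set :: "('a::euclidean_space \<Rightarrow> 'a \<Rightarrow> real) \<Rightarrow> 'a set \<Rightarrow> bool" where
  "orthonormal_set g S \<longleftrightarrow> finite S \<and> (\<forall>u\<in>S. \<forall>v\<in>S. g u v = (if u = v then 1 else 0))"

definition orthonormal_basis :: "('a::euclidean_space \<Rightarrow> 'a \<Rightarrow> real) \<Rightarrow> 'a set \<Rightarrow> bool" where
  "orthonormal_basis g S \<longleftrightarrow> orthonormal_set g S \<and> card S = DIM('a)"

lemma orthonormal_set_coeff:
  assumes "bilinear g" "orthonormal_set g S" "e \<in> S"
  shows "g (\<Sum>e\<in>S. c e *\<^sub>R e) e = c e"
proof -
  have "g (\<Sum>e\<in>S. c e *\<^sub>R e) e = (\<Sum>e'\<in>S. c e' * g e' e)"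
    using assms(1) by (simp add: bilinear_sum_left bilinear_simps)
  also have "\<dots> = (\<Sum>e'\<in>S. if e' = e then c e' else 0)"
    using assms(2,3) by (intro sum.cong) (auto simp: orthonormal_set_def)
  finally show ?thesis using assms(2,3) by (simp add: orthonormal_set_def)
qed

lemma orthonormal_set_independent:
  assumes "bilinear g" "orthonormal_set g S"
  shows "independent S"
proof -
  have "u v = 0" if "(\<Sum>v\<in>S. u v *\<^sub>R v) = 0" "v \<in> S" for u v
    using orthonormal_set_coeff[OF assms that(2), of u] that(1) bilinear_lzero[OF assms(1)] by simp
  then show ?thesis
    using assms(2) by (auto simp: dependent_finite orthonormal_set_def)
qed

text \<open>Spanning comes from counting: an independent set of full cardinality spans. The
  coefficients are then read off by orthonormality.\<close>

lemma orthonormal_basis_expand: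
  fixes g :: "'a::euclidean_space \<Rightarrow> 'a \<Rightarrow> real"
  assumes "bilinear g" "orthonormal_basis g S"
  shows "v = (\<Sum>e\<in>S. g v e *\<^sub>R e)"
proof -
  have S: "finite S" "orthonormal_set g S" "card S = DIM('a)"
    using assms(2) by (auto simp: orthonormal_basis_def orthonormal_set_def)
  have "UNIV \<subseteq> span S"
    using orthonormal_set_independent[OF assms(1) S(2)] S
    by (intro card_ge_dim_independent) (auto simp: dim_UNIV)
  then have "v \<in> range (\<lambda>c. \<Sum>e\<in>S. c e *\<^sub>R e)" unfolding span_finite[OF S(1)] by blast
  then obtain c where c: "v = (\<Sum>e\<in>S. c e *\<^sub>R e)" by blast
  have "g v e = c e" if "e \<in> S" for e
    unfolding c by (rule orthonormal_set_coeff[OF assms(1) S(2) that])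
  then have "(\<Sum>e\<in>S. g v e *\<^sub>R e) = (\<Sum>e\<in>S. c e *\<^sub>R e)" by simp
  then show ?thesis using c by argo
qed

text \<open>Orthonormal sets are independent, so their cardinality is bounded and a largest one
  exists. If it did not span, a Gram-Schmidt step would enlarge it.\<close>

lemma orthonormal_basis_exists:
  fixes g :: "'a::euclidean_space \<Rightarrow> 'a \<Rightarrow> real"
  assumes "inner_form g"
  obtains S where "orthonormal_basis g S"
proof -
  note b = inner_formD(1)[OF assms]
  have "orthonormal_set g {}" by (simp add: orthonormal_set_def)
  moreover have le: "card S < Suc DIM('a)" if "orthonormal_set g S" for S
    using independent_card_le[OF orthonormal_set_independent[OF b that]] by simp
  ultimately obtain S where S: "orthonormal_set g S"
    and max: "\<And>S'. orthonormal_set g S' \<Longrightarrow> card S' \<le> card S"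
    using ex_has_greatest_nat[of "orthonormal_set g" "{}" card] by metis
  have fin: "finite S" using S by (simp add: orthonormal_set_def)
  have "card S = DIM('a)"
  proof (rule ccontr)
    assume "card S \<noteq> DIM('a)"
    then have "card S < DIM('a)" using le[OF S] by simp
    then obtain v where v: "v \<notin> span S"
      using span_card_ge_dim[of S UNIV] fin by (auto simp: dim_UNIV)
    define w where "w = v - (\<Sum>e\<in>S. g v e *\<^sub>R e)"
    have "w \<noteq> 0"
      using v span_sum[of S "\<lambda>e. g v e *\<^sub>R e" S] by (auto simp: w_def span_base span_mul)
    then have w0: "g w w > 0" using inner_formD(3)[OF assms] by blast
    have we: "g w e = 0" if "e \<in> S" for e
      using orthonormal_set_coeff[OF b S that] by (simp add: w_def bilinear_simps[OF b])
    define w' where "w' = (1 / sqrt (g w w)) *\<^sub>R w"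
    have w1: "g w' w' = 1" using w0 by (simp add: w'_def bilinear_simps[OF b])
    have w2: "g w' e = 0" "g e w' = 0" if "e \<in> S" for e
      using we[OF that] inner_formD(2)[OF assms, of w e]
      by (simp_all add: w'_def bilinear_simps[OF b])
    then have "w' \<notin> S" using w1 by fastforce
    moreover have "orthonormal_set g (insert w' S)"
      using S w1 w2 \<open>w' \<notin> S\<close> by (auto simp: orthonormal_set_def)
    ultimately show False using max[of "insert w' S"] fin by simp
  qed
  then show thesis using S that by (simp add: orthonormal_basis_def)
qed

section \<open>Raising indices and metric traces\<close>

lemma sharp_unique:
  assumes "inner_form g" "\<And>z. g w z = l z"
  shows "sharp g l = w"
  unfolding sharp_def
proof (rule the_equality)
  fix w' assume "\<forall>z. g w' z = l z"
  then have "g (w' - w) (w' - w) = 0"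
    using assms(2) by (simp add: bilinear_lsub[OF inner_formD(1)[OF assms(1)]])
  then show "w' = w" using inner_formD(3)[OF assms(1), of "w' - w"] by auto
qed (use assms(2) in simp)

text \<open>Riesz representation: the values of \<open>l\<close> on an orthonormal basis are the
  coordinates of the representing vector.\<close>

lemma sharp_works:
  assumes "inner_form g" "linear l"
  shows "g (sharp g l) z = l z"
proof -
  note b = inner_formD(1)[OF assms(1)]
  obtain S where S: "orthonormal_basis g S" using orthonormal_basis_exists[OF assms(1)] .
  let ?w = "\<Sum>e\<in>S. l e *\<^sub>R e"
  have *: "g ?w z = l z" for z
  proof -
    have "l z = l (\<Sum>e\<in>S. g z e *\<^sub>R e)" using arg_cong[OF orthonormal_basis_expand[OF b S]] .
    also have "\<dots> = (\<Sum>e\<in>S. g z e * l e)"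
      using assms(2) by (simp add: linear_sum linear_cmul)
    also have "\<dots> = g ?w z"
      using inner_formD(2)[OF assms(1), of z]
      by (simp add: bilinear_sum_left[OF b] bilinear_simps[OF b] mult.commute)
    finally show ?thesis by simp
  qed
  then show ?thesis using sharp_unique[OF assms(1), of ?w l] by simp
qed

lemma sharp_linear_combination:
  assumes "inner_form g" "\<And>i. i \<in> K \<Longrightarrow> linear (l i)"
  shows "sharp g (\<lambda>z. \<Sum>i\<in>K. c i * l i z) = (\<Sum>i\<in>K. c i *\<^sub>R sharp g (l i))"
  using assms inner_formD(1)[OF assms(1)]
  by (intro sharp_unique) (auto simp: bilinear_sum_left bilinear_simps sharp_works)

text \<open>The vectors \<open>sharp g (\<lambda>z. z \<bullet> e)\<close> are the columns of the
  inverse matrix of \<open>g\<close>. Regularity of \<open>sharp\<close> in the metric reduces to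
  these finitely many vectors.\<close>

lemma sharp_expand:
  fixes g :: "'a::euclidean_space \<Rightarrow> 'a \<Rightarrow> real"
  assumes "inner_form g" "linear l"
  shows "sharp g l = (\<Sum>e\<in>Basis. l e *\<^sub>R sharp g (\<lambda>z. z \<bullet> e))"
proof -
  have "l z = (\<Sum>e\<in>Basis. l e * (z \<bullet> e))" for z
    using linear_expand[OF assms(2), of z] by (simp add: mult.commute)
  then have "l = (\<lambda>z. \<Sum>e\<in>Basis. l e * (z \<bullet> e))" ..
  then show ?thesis
    using sharp_linear_combination[OF assms(1), of Basis "\<lambda>e z. z \<bullet> e" l]
      bounded_linear.linear[OF bounded_linear_inner_left] by auto
qed

text \<open>Expand the elements of \<open>Basis\<close> in \<open>S\<close> and exchange the two sums.\<close>

lemma trace_orthonormal_basis: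
  fixes g :: "'a::euclidean_space \<Rightarrow> 'a \<Rightarrow> real"
  assumes "bilinear g" "orthonormal_basis g S" "linear L"
  shows "(\<Sum>e\<in>Basis. L e \<bullet> e) = (\<Sum>s\<in>S. g (L s) s)"
proof -
  have "(\<Sum>e\<in>Basis. L e \<bullet> e) = (\<Sum>e\<in>Basis. L (\<Sum>s\<in>S. g e s *\<^sub>R s) \<bullet> e)"
    by (intro sum.cong refl arg_cong[where f = "\<lambda>v. L v \<bullet> _"] orthonormal_basis_expand[OF assms(1,2)])
  also have "\<dots> = (\<Sum>e\<in>Basis. \<Sum>s\<in>S. g e s * (L s \<bullet> e))"
    using assms(3) by (simp add: linear_sum linear_cmul inner_sum_left)
  also have "\<dots> = (\<Sum>s\<in>S. \<Sum>e\<in>Basis. (L s \<bullet> e) * g e s)"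
    by (subst sum.swap) (simp add: mult.commute)
  also have "\<dots> = (\<Sum>s\<in>S. g (L s) s)"
  proof (rule sum.cong[OF refl])
    fix s
    have "linear (\<lambda>u. g u s)" using assms(1) by (simp add: bilinear_def)
    from linear_expand[OF this, of "L s"] show "(\<Sum>e\<in>Basis. (L s \<bullet> e) * g e s) = g (L s) s" by simp
  qed
  finally show ?thesis .
qed

lemma metric_trace_orthonormal_basis:
  assumes "inner_form g" "bilinear b" "orthonormal_basis g S"
  shows "metric_trace g b = (\<Sum>s\<in>S. b s s)"
proof -
  have lin: "linear (b u)" for u using assms(2) by (simp add: bilinear_def)
  note gw = sharp_works[OF assms(1) lin]
  have "linear (\<lambda>u. sharp g (b u))"
    using inner_formD(1)[OF assms(1)] gw
    by (intro linearI sharp_unique[OF assms(1)]) (auto simp: bilinear_simps assms(2))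
  then show ?thesis
    using trace_orthonormal_basis[OF inner_formD(1)[OF assms(1)] assms(3)]
    by (simp add: metric_trace_def gw)
qed

text \<open>An isometry carries an orthonormal basis to an orthonormal basis, and the trace may be
  taken in any of them. With \<open>t\<close> a coordinate change, this makes traces independent of
  charts.\<close>

lemma metric_trace_isometry:
  fixes t :: "'a::euclidean_space \<Rightarrow> 'a"
  assumes "inner_form g" "inner_form g'" "bilinear b" "bilinear b'"
    and "\<And>u v. g' (t u) (t v) = g u v" "\<And>u v. b' (t u) (t v) = b u v"
  shows "metric_trace g' b' = metric_trace g b"
proof -
  obtain S where S: "orthonormal_basis g S" using orthonormal_basis_exists[OF assms(1)] .
  \<comment> \<open>If two elements of \<open>S\<close> have the same image, their product is that
    of one of them with itself, namely 1, which in an orthonormal set forces equality.\<close>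
  have inj: "inj_on t S"
  proof
    fix x y assume "x \<in> S" "y \<in> S" "t x = t y"
    moreover from this have "g x y = 1"
      using S assms(5)[of x y] assms(5)[of x x]
      by (simp add: orthonormal_basis_def orthonormal_set_def)
    ultimately show "x = y"
      using S by (auto simp: orthonormal_basis_def orthonormal_set_def split: if_splits)
  qed
  have "orthonormal_basis g' (t ` S)"
    using S inj assms(5)
    by (auto simp: orthonormal_basis_def orthonormal_set_def card_image inj_on_def)
  then show ?thesis
    using metric_trace_orthonormal_basis[OF assms(1,3) S]
      metric_trace_orthonormal_basis[OF assms(2,4)] sum.reindex[OF inj, of "\<lambda>s. b' s s"] assms(6)
    by simp
qed

section \<open>Smooth dependence of solutions of linear systems\<close>

text \<open>The constant is the minimum of the form on the compact unit sphere; homogeneity does the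
  rest.\<close>

lemma inner_form_lower_bound:
  fixes g :: "'a::euclidean_space \<Rightarrow> 'a \<Rightarrow> real"
  assumes "inner_form g"
  obtains c where "c > 0" "\<And>v. c * (norm v)\<^sup>2 \<le> g v v"
proof -
  note b = inner_formD(1)[OF assms]
  have "continuous_on (sphere 0 1) (\<lambda>v. g v v)"
    by (subst bilinear_expand[OF b]) (intro continuous_intros)
  then obtain w :: 'a where w: "w \<in> sphere 0 1" "\<And>v. v \<in> sphere 0 1 \<Longrightarrow> g w w \<le> g v v"
    using continuous_attains_inf[of "sphere (0::'a) 1" "\<lambda>v. g v v"] by (auto simp: sphere_eq_empty)
  have "w \<noteq> 0" using w(1) by auto
  then have "g w w > 0" using inner_formD(3)[OF assms] by blast
  moreover have "g w w * (norm v)\<^sup>2 \<le> g v v" for v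
  proof (cases "v = 0")
    case False
    define e where "e = (1 / norm v) *\<^sub>R v"
    have "e \<in> sphere 0 1" using False by (auto simp: e_def)
    moreover have "g e e = g v v / (norm v)\<^sup>2"
      by (simp add: e_def bilinear_simps[OF b] power2_eq_square)
    then have "g v v = (norm v)\<^sup>2 * g e e" using False by simp
    ultimately show ?thesis using w(2)[of e] by (simp add: mult.commute mult_right_mono)
  qed (simp add: bilinear_lzero[OF b])
  ultimately show thesis using that by blast
qed

lemma norm_bilinear_le:
  fixes b :: "'a::euclidean_space \<Rightarrow> 'b::euclidean_space \<Rightarrow> real"
  assumes "bilinear b"
  shows "\<bar>b u v\<bar> \<le> (\<Sum>e\<in>Basis. \<Sum>e'\<in>Basis. \<bar>b e e'\<bar>) * norm u * norm v"
proof -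
  have "\<bar>b u v\<bar> \<le> (\<Sum>e\<in>Basis. \<Sum>e'\<in>Basis. \<bar>(u \<bullet> e) * (v \<bullet> e') * b e e'\<bar>)"
    by (subst bilinear_expand[OF assms])
      (intro order_trans[OF sum_abs] sum_mono order_refl)
  also have "\<dots> \<le> (\<Sum>e\<in>Basis. \<Sum>e'\<in>Basis. norm u * norm v * \<bar>b e e'\<bar>)"
    unfolding abs_mult
    by (intro sum_mono mult_right_mono mult_mono) (auto simp: Basis_le_norm)
  finally show ?thesis by (simp add: sum_distrib_right sum_distrib_left ac_simps)
qed

lemma bilinear_diff:
  fixes b b' :: "'a::real_vector \<Rightarrow> 'b::real_vector \<Rightarrow> real"
  shows "bilinear b \<Longrightarrow> bilinear b' \<Longrightarrow> bilinear (\<lambda>u v. b u v - b' u v)"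
  unfolding bilinear_def by (intro conjI allI linear_compose_sub) auto

text \<open>Let z be the difference of the solutions at \<open>y\<close> and \<open>x\<close>. Both
  represent the same functional, so \<open>G y z z\<close> equals the defect of \<open>G x\<close>
  against \<open>G y\<close> on the pair of \<open>?s x\<close> and z, which is small. Coercivity
  bounds \<open>G y z z\<close> from below by a multiple of the squared norm of z, and dividing by
  the norm gives the estimate.\<close>

lemma continuous_on_sharp_inner:
  fixes G :: "'x::metric_space \<Rightarrow> 'a::euclidean_space \<Rightarrow> 'a \<Rightarrow> real"
  assumes G: "\<And>x. x \<in> S \<Longrightarrow> inner_form (G x)"
    and cont: "\<And>u v. continuous_on S (\<lambda>x. G x u v)"
  shows "continuous_on S (\<lambda>x. sharp (G x) (\<lambda>z. z \<bullet> e))"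
  unfolding continuous_on_def
proof
  fix x assume x: "x \<in> S"
  let ?s = "\<lambda>y. sharp (G y) (\<lambda>z. z \<bullet> e)"
  have s: "G y (?s y) z = z \<bullet> e" if "y \<in> S" for y z
    using sharp_works[OF G[OF that] bounded_linear.linear[OF bounded_linear_inner_left]] .
  obtain c where c: "c > 0" "\<And>v. c * (norm v)\<^sup>2 \<le> G x v v"
    using inner_form_lower_bound[OF G[OF x]] by blast
  define \<delta> where "\<delta> y = (\<Sum>e\<in>Basis. \<Sum>e'\<in>Basis. \<bar>G y e e' - G x e e'\<bar>)" for y
  have lim: "((\<lambda>y. G y u v - G x u v) \<longlongrightarrow> 0) (at x within S)" for u v
    using cont[of u v] x by (simp add: continuous_on_def LIM_zero)
  have "(\<delta> \<longlongrightarrow> (\<Sum>e\<in>(Basis::'a set). \<Sum>e'\<in>(Basis::'a set). \<bar>0\<bar>)) (at x within S)"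
    unfolding \<delta>_def by (intro tendsto_sum tendsto_rabs lim)
  then have \<delta>: "(\<delta> \<longlongrightarrow> 0) (at x within S)" by simp
  have le: "norm (?s y - ?s x) \<le> 2 / c * norm (?s x) * \<delta> y" if y: "y \<in> S" "\<delta> y < c / 2" for y
  proof -
    define z where "z = ?s y - ?s x"
    have b: "bilinear (\<lambda>u v. G y u v - G x u v)"
      using bilinear_diff inner_formD(1) G x y(1) by blast
    have dl: "\<bar>G y u v - G x u v\<bar> \<le> \<delta> y * norm u * norm v" for u v
      using norm_bilinear_le[OF b, of u v] unfolding \<delta>_def .
    \<comment> \<open>Half of the coercivity constant of \<open>G x\<close> absorbs the change of
      the metric; the other half is left for \<open>G y\<close>.\<close>
    have "\<delta> y * norm z * norm z \<le> c / 2 * (norm z)\<^sup>2"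
      using mult_right_mono[of "\<delta> y" "c / 2" "norm z * norm z"] y(2)
      by (simp add: power2_eq_square mult.assoc)
    then have "c / 2 * (norm z)\<^sup>2 \<le> G y z z"
      using dl[of z z] c(2)[of z] by argo
    also have "G y z z = G y (?s y) z - G y (?s x) z"
      unfolding z_def using bilinear_lsub[OF inner_formD(1)[OF G[OF y(1)]]] .
    also have "\<dots> = G x (?s x) z - G y (?s x) z"
      using s[OF y(1), of z] s[OF x, of z] by argo
    also have "\<dots> \<le> \<delta> y * norm (?s x) * norm z" using dl[of "?s x" z] by argo
    finally have "norm z * (c / 2 * norm z) \<le> norm z * (\<delta> y * norm (?s x))"
      by (simp add: power2_eq_square ac_simps)
    moreover have "0 \<le> \<delta> y" unfolding \<delta>_def by (intro sum_nonneg) auto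
    ultimately have "c / 2 * norm z \<le> \<delta> y * norm (?s x)"
      by (cases "norm z = 0") (auto simp: mult_le_cancel_left)
    then show ?thesis using c(1) unfolding z_def by (simp add: field_simps)
  qed
  have "eventually (\<lambda>y. norm (?s y - ?s x) \<le> 2 / c * norm (?s x) * \<delta> y) (at x within S)"
    using order_tendstoD(2)[OF \<delta>, of "c / 2"] c(1) eventually_at_topological le
    by (auto simp: eventually_at_filter elim!: eventually_mono)
  moreover have "((\<lambda>y. 2 / c * norm (?s x) * \<delta> y) \<longlongrightarrow> 0) (at x within S)"
    using tendsto_mult_right_zero[OF \<delta>] .
  ultimately have "((\<lambda>y. ?s y - ?s x) \<longlongrightarrow> 0) (at x within S)"
    by (rule Lim_null_comparison)
  then show "(?s \<longlongrightarrow> ?s x) (at x within S)" by (simp add: LIM_zero_iff)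
qed

text \<open>Since \<open>m\<close> vanishes at \<open>x\<close>, the product rule asks of the other
  factor only that it be continuous. This breaks a circle: \<open>sharp\<close> is to be
  differentiated when only its continuity is known.\<close>

lemma has_derivative_scaleR_vanishing:
  fixes m :: "'x::real_normed_vector \<Rightarrow> real" and s :: "'x \<Rightarrow> 'y::real_normed_vector"
  assumes m: "(m has_derivative m') (at x within S)" "m x = 0"
    and s: "(s \<longlongrightarrow> s x) (at x within S)"
  shows "((\<lambda>y. m y *\<^sub>R s y) has_derivative (\<lambda>h. m' h *\<^sub>R s x)) (at x within S)"
proof -
  have bl: "bounded_linear m'" using m(1) by (rule has_derivative_bounded_linear)
  obtain K where K: "\<And>h. norm (m' h) \<le> norm h * K" using bounded_linear.bounded[OF bl] by blast
  let ?q = "\<lambda>y. (1 / norm (y - x)) *\<^sub>R (m y - (m x + m' (y - x)))"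
  have q: "(?q \<longlongrightarrow> 0) (at x within S)" using m(1) by (simp add: has_derivative_within)
  have s0: "((\<lambda>y. s y - s x) \<longlongrightarrow> 0) (at x within S)" using s by (simp add: LIM_zero)
  have "((\<lambda>y. ?q y *\<^sub>R (s y - s x)) \<longlongrightarrow> 0 *\<^sub>R 0) (at x within S)"
    by (rule tendsto_scaleR[OF q s0])
  moreover have "((\<lambda>y. (m' (y - x) / norm (y - x)) *\<^sub>R (s y - s x)) \<longlongrightarrow> 0) (at x within S)"
  proof (rule Lim_null_comparison)
    show "\<forall>\<^sub>F y in at x within S. norm ((m' (y - x) / norm (y - x)) *\<^sub>R (s y - s x)) \<le> K * norm (s y - s x)"
    proof (rule always_eventually, rule allI)
      fix y
      have "\<bar>m' (y - x)\<bar> / norm (y - x) \<le> K \<or> y = x"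
        using K[of "y - x"] by (auto simp: divide_le_eq mult.commute)
      then show "norm ((m' (y - x) / norm (y - x)) *\<^sub>R (s y - s x)) \<le> K * norm (s y - s x)"
        using mult_right_mono[of "\<bar>m' (y - x)\<bar> / norm (y - x)" K "norm (s y - s x)"] by auto
    qed
    show "((\<lambda>y. K * norm (s y - s x)) \<longlongrightarrow> 0) (at x within S)"
      using tendsto_mult_right_zero[OF tendsto_norm_zero[OF s0]] .
  qed
  ultimately have "((\<lambda>y. ?q y *\<^sub>R (s y - s x) + (m' (y - x) / norm (y - x)) *\<^sub>R (s y - s x))
      \<longlongrightarrow> 0) (at x within S)"
    using tendsto_add by fastforce
  then have "((\<lambda>y. (1 / norm (y - x)) *\<^sub>R (m y *\<^sub>R (s y - s x))) \<longlongrightarrow> 0) (at x within S)"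
    by (simp add: m(2) flip: scaleR_add_left add_divide_distrib)
  then have "((\<lambda>y. m y *\<^sub>R (s y - s x)) has_derivative (\<lambda>h. 0)) (at x within S)"
    by (simp add: has_derivative_within m(2))
  from has_derivative_add[OF this has_derivative_scaleR_left[OF m(1), of "s x"]]
  show ?thesis by (simp add: scaleR_diff_right)
qed

text \<open>The familiar formula for the derivative of an inverse matrix, minus the inverse times
  the derivative times the inverse. Its right-hand side contains the solutions themselves but not
  their derivatives, so induction on \<open>k\<close> gains one order each time.\<close>

lemma Ck_on_sharp_inner:
  fixes G :: "'x::euclidean_space \<Rightarrow> 'a::euclidean_space \<Rightarrow> 'a \<Rightarrow> real"
  assumes acc: "axis_accessible S"
    and G: "\<And>x. x \<in> S \<Longrightarrow> inner_form (G x)"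
    and "\<And>u v. Ck_on k S (\<lambda>x. G x u v)"
  shows "Ck_on k S (\<lambda>x. sharp (G x) (\<lambda>z. z \<bullet> e))"
  using assms(3)
proof (induction k arbitrary: e)
  case 0
  then show ?case using continuous_on_sharp_inner[of S G, OF G] by simp
next
  case (Suc k)
  let ?s = "\<lambda>e y. sharp (G y) (\<lambda>z. z \<bullet> e)"
  have lin: "linear (\<lambda>z. z \<bullet> e)" for e :: 'a by (rule bounded_linear.linear[OF bounded_linear_inner_left])
  have IH: "Ck_on k S (?s e)" for e
    by (rule Suc.IH) (use Ck_on_Suc_imp[OF Suc.prems] in simp)
  note dG = Ck_on_SucD[OF Suc.prems]
  have lim: "(?s e \<longlongrightarrow> ?s e x) (at x within S)" if "x \<in> S" for e x
    using Ck_on_imp_continuous_on[OF IH[of e]] that by (simp add: continuous_on_def)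
  define D where "D e' x h = (\<Sum>e''\<in>Basis. (?s e x \<bullet> e'') * deriv_within S (\<lambda>y. G y e'' e') x h)" for e' x h
  show ?case
  proof (rule Ck_on_SucI[OF acc])
    fix x assume x: "x \<in> S"
    let ?w = "?s e x"
    \<comment> \<open>The components of the defect of \<open>G x\<close> against \<open>G y\<close>
      on \<open>?w\<close>. They vanish at \<open>x\<close>, and the exact identity
      \<open>expand\<close> writes the change of the solution through them, with the solutions at
      \<open>y\<close> as coefficients.\<close>
    define m where "m e' y = (\<Sum>e''\<in>Basis. (?w \<bullet> e'') * (G x e'' e' - G y e'' e'))" for e' y
    have expand: "?s e y = ?w + (\<Sum>e'\<in>Basis. m e' y *\<^sub>R ?s e' y)" if y: "y \<in> S" for y
    proof (rule sharp_unique[OF G[OF y]])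
      fix z
      have b: "bilinear (G y)" "bilinear (G x)" using inner_formD(1) G x y by blast+
      have GG: "G y' ?w v = (\<Sum>e''\<in>Basis. (?w \<bullet> e'') * G y' e'' v)" if "y' \<in> S" for y' v
      proof -
        have "linear (\<lambda>u. G y' u v)" using inner_formD(1)[OF G[OF that]] by (simp add: bilinear_def)
        from linear_expand[OF this, of ?w] show ?thesis by simp
      qed
      have m: "m e' y = G x ?w e' - G y ?w e'" for e'
        unfolding m_def GG[OF x] GG[OF y] by (simp add: right_diff_distrib sum_subtractf)
      have "linear (\<lambda>z. G x ?w z - G y ?w z)"
        using b by (intro linear_compose_sub) (auto simp: bilinear_def)
      from linear_expand[OF this, of z]
      have "(\<Sum>e'\<in>Basis. m e' y * (z \<bullet> e')) = G x ?w z - G y ?w z" by (simp add: m mult.commute)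
      moreover have "G y (\<Sum>e'\<in>Basis. m e' y *\<^sub>R ?s e' y) z = (\<Sum>e'\<in>Basis. m e' y * (z \<bullet> e'))"
        by (simp add: bilinear_sum_left[OF b(1)] bilinear_lmul[OF b(1)] sharp_works[OF G[OF y] lin])
      moreover have "G x ?w z = z \<bullet> e" by (rule sharp_works[OF G[OF x] lin])
      ultimately show "G y (?w + (\<Sum>e'\<in>Basis. m e' y *\<^sub>R ?s e' y)) z = z \<bullet> e"
        by (simp add: bilinear_ladd[OF b(1)])
    qed
    have dm: "(m e' has_derivative (\<lambda>h. - D e' x h)) (at x within S)" for e'
    proof -
      have "((\<lambda>y. \<Sum>e''\<in>Basis. (?w \<bullet> e'') * (G x e'' e' - G y e'' e')) has_derivative
          (\<lambda>h. \<Sum>e''\<in>Basis. (?w \<bullet> e'') * (0 - deriv_within S (\<lambda>y. G y e'' e') x h))) (at x within S)"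
        by (intro has_derivative_sum has_derivative_mult_right has_derivative_diff
            has_derivative_const dG(1)[OF x])
      then show ?thesis by (simp add: m_def[abs_def] D_def sum_negf)
    qed
    have m0: "m e' x = 0" for e' by (simp add: m_def)
    have "((\<lambda>y. ?w + (\<Sum>e'\<in>Basis. m e' y *\<^sub>R ?s e' y)) has_derivative
        (\<lambda>h. 0 + (\<Sum>e'\<in>Basis. (- D e' x h) *\<^sub>R ?s e' x))) (at x within S)"
      by (intro has_derivative_add has_derivative_const has_derivative_sum
          has_derivative_scaleR_vanishing[OF dm m0 lim[OF x]])
    then show "(?s e has_derivative (\<lambda>h. 0 + (\<Sum>e'\<in>Basis. (- D e' x h) *\<^sub>R ?s e' x))) (at x within S)"
      by (subst has_derivative_within_cong[OF expand x])
  next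
    fix h
    have "Ck_on k S (\<lambda>x. D e' x h)" for e'
      unfolding D_def
      by (intro Ck_on_sum[OF acc] Ck_on_mult[OF acc] dG(2)
          Ck_on_bounded_linear[OF acc bounded_linear_inner_left] IH)
    then have "Ck_on k S (\<lambda>x. - D e' x h)" for e'
      using Ck_on_bounded_linear[OF acc bounded_linear_minus[OF bounded_linear_ident]] by blast
    then show "Ck_on k S (\<lambda>x. 0 + (\<Sum>e'\<in>Basis. (- D e' x h) *\<^sub>R ?s e' x))"
      unfolding add_0 by (intro Ck_on_sum[OF acc] Ck_on_scaleR[OF acc] IH)
  qed
qed

lemma Ck_on_sharp:
  fixes G :: "'x::euclidean_space \<Rightarrow> 'a::euclidean_space \<Rightarrow> 'a \<Rightarrow> real"
  assumes acc: "axis_accessible S"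
    and G: "\<And>x. x \<in> S \<Longrightarrow> inner_form (G x)" "\<And>u v. Ck_on k S (\<lambda>x. G x u v)"
    and l: "\<And>x. x \<in> S \<Longrightarrow> linear (l x)" "\<And>z. Ck_on k S (\<lambda>x. l x z)"
  shows "Ck_on k S (\<lambda>x. sharp (G x) (l x))"
proof -
  have "Ck_on k S (\<lambda>x. \<Sum>e\<in>Basis. l x e *\<^sub>R sharp (G x) (\<lambda>z. z \<bullet> e))"
    by (intro Ck_on_sum[OF acc] Ck_on_scaleR[OF acc] l(2) Ck_on_sharp_inner[OF acc G])
  then show ?thesis
    by (subst Ck_on_cong[OF sharp_expand[OF G(1) l(1)]])
qed

section \<open>Christoffel symbols and curvature on a patch\<close>

text \<open>Accessibility takes the place of openness so that the same calculus covers a chart image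
  with the metric at a fixed time and a space-time slab that contains its final time.\<close>

locale metric_patch =
  fixes S :: "'e::euclidean_space set" and G :: "'e \<Rightarrow> 'e \<Rightarrow> 'e \<Rightarrow> real"
  assumes accessible: "axis_accessible S"
    and inner: "x \<in> S \<Longrightarrow> inner_form (G x)"
    and smooth: "smooth_on S (\<lambda>x. G x u v)"
begin

abbreviation dmetric :: "'e \<Rightarrow> 'e \<Rightarrow> 'e \<Rightarrow> 'e \<Rightarrow> real" where
  "dmetric x u v h \<equiv> deriv_within S (\<lambda>y. G y u v) x h"

lemmas bilinear_G = inner_formD(1)[OF inner]
lemmas G_commute = inner_formD(2)[OF inner]

lemma has_derivative_G:
  "x \<in> S \<Longrightarrow> ((\<lambda>y. G y u v) has_derivative dmetric x u v) (at x within S)"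
  using smooth_on_has_derivative[OF smooth] .

lemma dmetric_commute: "x \<in> S \<Longrightarrow> dmetric x u v h = dmetric x v u h"
  by (rule arg_cong[where f = "\<lambda>d. d h"], rule deriv_within_cong) (rule G_commute)

lemma linear_dmetric: "x \<in> S \<Longrightarrow> linear (dmetric x u v)"
  using has_derivative_bounded_linear[OF has_derivative_G] bounded_linear.linear by blast

lemma linear_dmetric_right:
  assumes x: "x \<in> S" shows "linear (\<lambda>v. dmetric x u v h)"
  using bilinear_G by (intro linear_deriv_within[OF accessible x _ has_derivative_G[OF x]]) (simp add: bilinear_def)

lemma linear_dmetric_left: "x \<in> S \<Longrightarrow> linear (\<lambda>u. dmetric x u v h)"
  using linear_dmetric_right[of x v h] by (simp add: dmetric_commute[of x _ v])

abbreviation koszul :: "'e \<Rightarrow> 'e \<Rightarrow> 'e \<Rightarrow> 'e \<Rightarrow> real" where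
  "koszul x u v z \<equiv> (dmetric x v z u + dmetric x u z v - dmetric x u v z) / 2"

lemma linear_koszul: "x \<in> S \<Longrightarrow> linear (koszul x u v)"
  by (intro linearI)
    (simp_all add: linear_add[OF linear_dmetric] linear_add[OF linear_dmetric_right]
      linear_cmul[OF linear_dmetric] linear_cmul[OF linear_dmetric_right] field_simps)

lemma metric_christoffel: "x \<in> S \<Longrightarrow> G x (christoffel S G x u v) z = koszul x u v z"
  unfolding christoffel_def by (rule sharp_works[OF inner linear_koszul])

lemma christoffel_commute:
  assumes "x \<in> S" shows "christoffel S G x u v = christoffel S G x v u"
  unfolding christoffel_def
  by (rule arg_cong[where f = "sharp (G x)"]) (simp add: dmetric_commute[OF assms, of u v] add.commute)

lemma linear_christoffel_right:
  assumes x: "x \<in> S" shows "linear (christoffel S G x u)"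
proof -
  have D: "dmetric x (v + w) z h = dmetric x v z h + dmetric x w z h"
    "dmetric x (c *\<^sub>R v) z h = c * dmetric x v z h"
    "dmetric x u (v + w) h = dmetric x u v h + dmetric x u w h"
    "dmetric x u (c *\<^sub>R v) h = c * dmetric x u v h"
    "dmetric x u z (v + w) = dmetric x u z v + dmetric x u z w"
    "dmetric x u z (c *\<^sub>R v) = c * dmetric x u z v" for v w z h c
    using linear_add[OF linear_dmetric_left[OF x]] linear_cmul[OF linear_dmetric_left[OF x]]
      linear_add[OF linear_dmetric_right[OF x]] linear_cmul[OF linear_dmetric_right[OF x]]
      linear_add[OF linear_dmetric[OF x]] linear_cmul[OF linear_dmetric[OF x]]
    by simp_all
  show ?thesis
  proof (rule linearI)
    fix v w :: 'e and c :: real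
    show "christoffel S G x u (v + w) = christoffel S G x u v + christoffel S G x u w"
      unfolding christoffel_def[of S G x u "v + w"]
      by (rule sharp_unique[OF inner[OF x]])
        (simp add: bilinear_ladd[OF bilinear_G[OF x]] metric_christoffel[OF x] D field_simps)
    show "christoffel S G x u (c *\<^sub>R v) = c *\<^sub>R christoffel S G x u v"
      unfolding christoffel_def[of S G x u "c *\<^sub>R v"]
      by (rule sharp_unique[OF inner[OF x]])
        (simp add: bilinear_lmul[OF bilinear_G[OF x]] metric_christoffel[OF x] D field_simps)
  qed
qed

lemma linear_christoffel_left: "x \<in> S \<Longrightarrow> linear (\<lambda>u. christoffel S G x u v)"
  using linear_christoffel_right[of x v] by (simp add: christoffel_commute[of x _ v])

lemma smooth_on_christoffel: "smooth_on S (\<lambda>x. christoffel S G x u v)"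
  unfolding smooth_on_def christoffel_def
proof
  fix k
  have G: "Ck_on k S (\<lambda>x. G x u v)" for u v using smooth by (simp add: smooth_on_def)
  have D: "Ck_on k S (\<lambda>x. dmetric x u v h)" for u v h
    using smooth_on_deriv[OF smooth] by (simp add: smooth_on_def)
  have "Ck_on k S (\<lambda>x. (1/2) * (dmetric x v z u + dmetric x u z v + (-1) * dmetric x u v z))" for z
    by (intro Ck_on_cmult[OF accessible] Ck_on_add[OF accessible] D)
  then have K: "Ck_on k S (\<lambda>x. koszul x u v z)" for z by simp
  show "Ck_on k S (\<lambda>x. sharp (G x) (koszul x u v))"
    by (rule Ck_on_sharp[OF accessible inner G linear_koszul K])
qed

text \<open>Linearity in the slot that \<open>ricci\<close> contracts, so that this contraction may
  be computed in an orthonormal basis.\<close>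

lemma linear_riemann:
  assumes x: "x \<in> S" shows "linear (\<lambda>e. riemann S G x e v w)"
proof -
  note dC = smooth_on_has_derivative[OF smooth_on_christoffel x]
  have 1: "linear (\<lambda>e. deriv_within S (\<lambda>y. christoffel S G y v w) x e)"
    using has_derivative_bounded_linear[OF dC] bounded_linear.linear by blast
  have 2: "linear (\<lambda>e. deriv_within S (\<lambda>y. christoffel S G y e w) x v)"
    by (intro linear_deriv_within[OF accessible x _ dC] linear_christoffel_left)
  have 3: "linear (\<lambda>e. christoffel S G x v (christoffel S G x e w))"
    using linear_compose[OF linear_christoffel_left[OF x] linear_christoffel_right[OF x]]
    by (simp add: o_def)
  show ?thesis
    unfolding riemann_def cov_deriv_def
    by (intro linear_compose_sub linear_compose_add 1 2 3 linear_christoffel_left[OF x])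
qed

text \<open>In an orthonormal basis the scalar curvature is a double sum of curvature components on
  unit vectors, each of absolute value at most \<open>C\<close>. Bilinearity of Ricci is a premise
  here; for a flow it is obtained from the evolution equation.\<close>

lemma scalar_curvature_bounded:
  assumes x: "x \<in> S" and ric: "bilinear (ricci S G x)"
    and C: "\<And>u v w z. \<bar>G x (riemann S G x u v w) z\<bar>
      \<le> C * sqrt (G x u u) * sqrt (G x v v) * sqrt (G x w w) * sqrt (G x z z)"
  shows "\<bar>scalar_curvature S G x\<bar> \<le> real DIM('e) * (real DIM('e) * C)"
proof -
  obtain O' where O': "orthonormal_basis (G x) O'" using orthonormal_basis_exists[OF inner[OF x]] .
  have unit: "G x e e = 1" if "e \<in> O'" for e
    using O' that by (simp add: orthonormal_basis_def orthonormal_set_def)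
  have ric: "scalar_curvature S G x = (\<Sum>e\<in>O'. \<Sum>e'\<in>O'. G x (riemann S G x e' e e) e')"
    unfolding scalar_curvature_def metric_trace_orthonormal_basis[OF inner[OF x] ric O']
    unfolding ricci_def trace_orthonormal_basis[OF bilinear_G[OF x] O' linear_riemann[OF x]] ..
  have "\<bar>scalar_curvature S G x\<bar> \<le> (\<Sum>e\<in>O'. \<Sum>e'\<in>O'. \<bar>G x (riemann S G x e' e e) e'\<bar>)"
    unfolding ric by (intro order_trans[OF sum_abs] sum_mono order_refl)
  also have "\<dots> \<le> (\<Sum>e\<in>O'. \<Sum>e'\<in>O'. C)"
    by (intro sum_mono order_trans[OF C]) (simp add: unit)
  finally show ?thesis using O' by (simp add: orthonormal_basis_def)
qed

end

section \<open>Slabs and slices\<close>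

lemma accessible_time: "axis_accessible {0<..T::real}"
  unfolding axis_accessible_def
proof (intro ballI allI impI)
  fix x b e :: real
  assume x: "x \<in> {0<..T}" and b: "b \<in> Basis" and e: "e > 0"
  define m where "m = min e x / 2"
  have m: "0 < m" "m < e" "m < x" using x e by (auto simp: m_def min_def)
  then show "\<exists>d. 0 < \<bar>d\<bar> \<and> \<bar>d\<bar> < e \<and> x + d *\<^sub>R b \<in> {0<..T}"
    using x b by (intro exI[of _ "- m"]) auto
qed

lemma openin_slab:
  "open Y \<Longrightarrow> openin (top_of_set (UNIV \<times> {0<..T})) (Y \<times> {0<..T::real})"
  unfolding openin_open by (intro exI[of _ "Y \<times> UNIV"]) (auto intro: open_Times)

lemma accessible_slab:
  fixes Y :: "'a::euclidean_space set"
  shows "open Y \<Longrightarrow> axis_accessible (Y \<times> {0<..T::real})"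
  using axis_accessible_slab openin_slab by blast

lemma has_derivative_time_unique:
  fixes T :: real
  assumes "\<tau> \<in> {0<..T}" "(f has_derivative D) (at \<tau> within {0<..T})"
    "(f has_derivative D') (at \<tau> within {0<..T})"
  shows "D = D'"
  using deriv_within_eq[OF accessible_time assms(1)] assms(2,3) by metis

lemma has_real_derivative_time_unique:
  fixes T :: real
  assumes "\<tau> \<in> {0<..T}" "(f has_real_derivative a) (at \<tau> within {0<..T})"
    "(f has_real_derivative b) (at \<tau> within {0<..T})"
  shows "a = b"
proof -
  have "(*) a = (*) b"
    using has_derivative_time_unique assms unfolding has_field_derivative_def by blast
  then show ?thesis by (metis mult.right_neutral)
qed

lemma has_real_derivative_within_cong:
  assumes "\<And>y. y \<in> S \<Longrightarrow> f y = h y" "x \<in> S"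
  shows "(f has_real_derivative d) (at x within S) \<longleftrightarrow> (h has_real_derivative d) (at x within S)"
  unfolding has_field_derivative_def by (rule has_derivative_within_cong[OF assms])

lemma has_derivative_space_slice:
  assumes "(f has_derivative D) (at (y, \<tau>) within S)" "\<And>z. z \<in> Y \<Longrightarrow> (z, \<tau>) \<in> S"
  shows "((\<lambda>z. f (z, \<tau>)) has_derivative (\<lambda>u. D (u, 0))) (at y within Y)"
proof -
  have "((\<lambda>z. (z, \<tau>)) has_derivative (\<lambda>u. (u, 0))) (at y within Y)"
    by (intro has_derivative_Pair has_derivative_ident has_derivative_const)
  moreover have "(f has_derivative D) (at (y, \<tau>) within (\<lambda>z. (z, \<tau>)) ` Y)"
    using assms by (blast intro: has_derivative_subset)
  ultimately show ?thesis by (rule has_derivative_in_compose)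
qed

lemma has_derivative_time_slice:
  assumes "(f has_derivative D) (at (y, \<tau>) within S)" "\<And>s. s \<in> J \<Longrightarrow> (y, s) \<in> S"
  shows "((\<lambda>s. f (y, s)) has_derivative (\<lambda>h. D (0, h))) (at \<tau> within J)"
proof -
  have "((\<lambda>s. (y, s)) has_derivative (\<lambda>h. (0, h))) (at \<tau> within J)"
    by (intro has_derivative_Pair has_derivative_ident has_derivative_const)
  moreover have "(f has_derivative D) (at (y, \<tau>) within (\<lambda>s. (y, s)) ` J)"
    using assms by (blast intro: has_derivative_subset)
  ultimately show ?thesis by (rule has_derivative_in_compose)
qed

lemma has_real_derivative_time_slice:
  fixes f :: "'a::euclidean_space \<times> real \<Rightarrow> real"
  assumes "(f has_derivative D) (at (y, \<tau>) within S)" "\<And>s. s \<in> J \<Longrightarrow> (y, s) \<in> S"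
  shows "((\<lambda>s. f (y, s)) has_real_derivative D (0, 1)) (at \<tau> within J)"
proof -
  have "linear D" using has_derivative_bounded_linear[OF assms(1)] bounded_linear.linear by blast
  then have "D (0, h) = D (0, 1) * h" for h
    using linear_cmul[of D h "(0, 1)"] by (simp add: mult.commute)
  then have "(\<lambda>h. D (0, h)) = (*) (D (0, 1))" by (rule ext)
  then show ?thesis
    using has_derivative_time_slice[of f D y \<tau> S J, OF assms]
    unfolding has_field_derivative_def by simp
qed

lemma has_derivative_slab_map:
  assumes "(f has_derivative f') (at y within K)"
  shows "((\<lambda>(y, \<tau>). (f y, \<tau>)) has_derivative (\<lambda>(u, a). (f' u, a))) (at (y, \<tau>) within K \<times> J)"
proof -
  have "(fst has_derivative fst) (at (y, \<tau>) within K \<times> J)"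
    by (rule has_derivative_fst[OF has_derivative_ident])
  moreover have "(f has_derivative f') (at (fst (y, \<tau>)) within fst ` (K \<times> J))"
    using assms by (auto intro: has_derivative_subset)
  ultimately have "((\<lambda>p. f (fst p)) has_derivative (\<lambda>h. f' (fst h))) (at (y, \<tau>) within K \<times> J)"
    by (rule has_derivative_in_compose)
  from has_derivative_Pair[OF this has_derivative_snd[OF has_derivative_ident]]
  show ?thesis by (simp add: case_prod_beta')
qed

section \<open>Atlases\<close>

lemma cdom_prod_atlas [simp]: "cdom (prod_atlas T A) i = cdom A i \<times> {0<..T}"
  by (simp add: cdom_def prod_atlas_def)

lemma cmap_prod_atlas [simp]: "cmap (prod_atlas T A) i p = (cmap A i (fst p), snd p)"
  by (simp add: cmap_def prod_atlas_def case_prod_beta)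

lemma cimg_prod_atlas [simp]: "cimg (prod_atlas T A) i = cimg A i \<times> {0<..T}"
  by (force simp: cimg_def)

lemma chart_at_prod_atlas: "\<tau> \<in> {0<..T} \<Longrightarrow> chart_at (prod_atlas T A) (p, \<tau>) = chart_at A p"
  by (simp add: chart_at_def)

locale atlas =
  fixes A :: "('i, 'm::{t2_space, second_countable_topology}, 'e::euclidean_space) atlas"
  assumes atlas: "smooth_atlas A"
begin

lemma open_cdom: "open (cdom A i)"
  and open_cimg: "open (cimg A i)"
  and homeomorphism_chart: "homeomorphism (cdom A i) (cimg A i) (cmap A i) (cinv A i)"
  using atlas by (auto simp: smooth_atlas_def)

lemma cinv_cmap [simp]: "p \<in> cdom A i \<Longrightarrow> cinv A i (cmap A i p) = p"
  and cmap_cinv [simp]: "u \<in> cimg A i \<Longrightarrow> cmap A i (cinv A i u) = u"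
  and cmap_in_cimg: "p \<in> cdom A i \<Longrightarrow> cmap A i p \<in> cimg A i"
  and cinv_in_cdom: "u \<in> cimg A i \<Longrightarrow> cinv A i u \<in> cdom A i"
  using homeomorphism_chart[of i] by (auto simp: homeomorphism_def)

lemma chart_at_in: "p \<in> cdom A (chart_at A p)"
proof -
  have "\<exists>i. p \<in> cdom A i" using atlas by (auto simp: smooth_atlas_def)
  then show ?thesis unfolding chart_at_def by (rule someI_ex)
qed

lemma cinv_prod_atlas:
  assumes "u \<in> cimg A i" "\<tau> \<in> {0<..T}"
  shows "cinv (prod_atlas T A) i (u, \<tau>) = (cinv A i u, \<tau>)"
  unfolding cinv_def[of "prod_atlas T A"]
proof (rule inv_into_f_eq)
  show "inj_on (cmap (prod_atlas T A) i) (cdom (prod_atlas T A) i)"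
    by (rule inj_on_inverseI[where g = "\<lambda>p. (cinv A i (fst p), snd p)"]) auto
qed (use assms cinv_in_cdom in auto)

lemma open_chart_image:
  assumes "open U" shows "open (cmap A i ` (cdom A i \<inter> U))"
proof -
  have "cmap A i ` (cdom A i \<inter> U) = cinv A i -` U \<inter> cimg A i"
    using cinv_in_cdom by (auto simp: cmap_in_cimg intro!: image_eqI[of _ _ "cinv A i _"])
  moreover have "continuous_on (cimg A i) (cinv A i)"
    using homeomorphism_chart[of i] by (simp add: homeomorphism_def)
  ultimately show ?thesis
    using open_cimg[of i] assms by (simp add: continuous_on_open_vimage)
qed

lemma has_derivative_transition:
  assumes "p \<in> cdom A i" "p \<in> cdom A j"
  shows "((cmap A j \<circ> cinv A i) has_derivative transition A i j p)
    (at (cmap A i p) within cmap A i ` (cdom A i \<inter> cdom A j))"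
proof -
  have "smooth_on (cmap A i ` (cdom A i \<inter> cdom A j)) (cmap A j \<circ> cinv A i)"
    using atlas by (simp add: smooth_atlas_def)
  from smooth_on_has_derivative[OF this, of "cmap A i p"] assms
  show ?thesis unfolding transition_def[abs_def] by blast
qed

lemma transition_prod_atlas:
  assumes "p \<in> cdom A i" "p \<in> cdom A j" "\<tau> \<in> {0<..T}"
  shows "transition (prod_atlas T A) i j (p, \<tau>) w = (transition A i j p (fst w), snd w)"
proof -
  let ?K = "cmap A i ` (cdom A i \<inter> cdom A j)"
  have K: "cmap (prod_atlas T A) i ` (cdom (prod_atlas T A) i \<inter> cdom (prod_atlas T A) j)
      = ?K \<times> {0<..T}" by force
  have KY: "?K \<subseteq> cimg A i" by (auto simp: cmap_in_cimg)
  have "frechet_derivative (cmap (prod_atlas T A) j \<circ> cinv (prod_atlas T A) i)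
        (at (cmap A i p, \<tau>) within ?K \<times> {0<..T})
      = frechet_derivative (\<lambda>(y, \<tau>). ((cmap A j \<circ> cinv A i) y, \<tau>)) (at (cmap A i p, \<tau>) within ?K \<times> {0<..T})"
    using assms KY by (intro deriv_within_cong) (auto simp: cinv_prod_atlas subset_iff)
  also have "\<dots> = (\<lambda>(u, a). (transition A i j p u, a))"
    using assms by (intro deriv_within_eq accessible_slab open_chart_image open_cdom
        has_derivative_slab_map has_derivative_transition) auto
  finally show ?thesis
    unfolding transition_def[of "prod_atlas T A"] K by (simp add: case_prod_beta)
qed

end

section \<open>The curvature of a backwards Ricci flow\<close>

locale ricci_background = B: atlas B
  for B :: "('j, 'o::{t2_space, second_countable_topology}, 'f::euclidean_space) atlas" +
  fixes T :: real and g :: "real \<Rightarrow> ('j, 'f) metric"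
  assumes family: "smooth_metric_family T B g"
    and flow: "backwards_ricci_flow T B g"
begin

abbreviation slab :: "'j \<Rightarrow> ('f \<times> real) set" where
  "slab j \<equiv> cimg B j \<times> {0<..T}"

text \<open>The metric, like \<open>ric\<close> and \<open>scal\<close> below, is regarded as a
  function on the space-time slab, since both the space-time metric and the track mix spatial and
  time derivatives.\<close>

definition met :: "'j \<Rightarrow> 'f \<times> real \<Rightarrow> 'f \<Rightarrow> 'f \<Rightarrow> real" where
  "met j p = g (snd p) j (fst p)"

definition ric :: "'j \<Rightarrow> 'f \<times> real \<Rightarrow> 'f \<Rightarrow> 'f \<Rightarrow> real" where
  "ric j p = ricci (cimg B j) (g (snd p) j) (fst p)"

definition scal :: "'j \<Rightarrow> 'f \<times> real \<Rightarrow> real" where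
  "scal j p = scalar_curvature (cimg B j) (g (snd p) j) (fst p)"

lemma slab_accessible: "axis_accessible (slab j)"
  by (rule accessible_slab[OF B.open_cimg])

lemma inner_met: "p \<in> slab j \<Longrightarrow> inner_form (met j p)"
  using family unfolding met_def inner_form_def smooth_metric_family_def riemannian_metric_def
  by (metis mem_Times_iff)

lemmas bilinear_met = inner_formD(1)[OF inner_met]

lemma smooth_met: "smooth_on (slab j) (\<lambda>p. met j p u v)"
  using family unfolding smooth_metric_family_def met_def by (simp add: case_prod_beta')

abbreviation dmet :: "'j \<Rightarrow> 'f \<times> real \<Rightarrow> 'f \<Rightarrow> 'f \<Rightarrow> 'f \<times> real \<Rightarrow> real" where
  "dmet j p u v \<equiv> frechet_derivative (\<lambda>p. met j p u v) (at p within slab j)"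

lemma has_derivative_met:
  "p \<in> slab j \<Longrightarrow> ((\<lambda>p. met j p u v) has_derivative dmet j p u v) (at p within slab j)"
  by (rule smooth_on_has_derivative[OF smooth_met])

lemma met_time_derivative:
  assumes "y \<in> cimg B j" "\<tau> \<in> {0<..T}"
  shows "((\<lambda>s. met j (y, s) u v) has_real_derivative 2 * ric j (y, \<tau>) u v) (at \<tau> within {0<..T})"
  using flow assms unfolding backwards_ricci_flow_def met_def ric_def by auto

lemma ric_eq_dmet:
  assumes "p \<in> slab j" shows "ric j p u v = dmet j p u v (0, 1) / 2"
proof -
  obtain y \<tau> where p: "p = (y, \<tau>)" "y \<in> cimg B j" "\<tau> \<in> {0<..T}" using assms by (cases p) auto
  have "((\<lambda>s. met j (y, s) u v) has_real_derivative dmet j p u v (0, 1)) (at \<tau> within {0<..T})"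
    using p has_derivative_met[OF assms, of u v]
    by (intro has_real_derivative_time_slice[where S = "slab j"]) auto
  from has_real_derivative_time_unique[OF p(3) this met_time_derivative[OF p(2,3)]]
  show ?thesis by (simp add: p)
qed

text \<open>Each algebraic identity of the metric holds at all times; differentiating both sides in
  time and comparing by uniqueness gives it for Ricci, without touching the curvature
  expression.\<close>

lemma bilinear_ric:
  assumes "p \<in> slab j" shows "bilinear (ric j p)"
proof -
  obtain y \<tau> where p: "p = (y, \<tau>)" "y \<in> cimg B j" "\<tau> \<in> {0<..T}" using assms by (cases p) auto
  note d = met_time_derivative[OF p(2,3)] and unique = has_real_derivative_time_unique[OF p(3)]
  have bil: "bilinear (met j (y, s))" if "s \<in> {0<..T}" for s
    using bilinear_met p that by simp
  note cong = has_real_derivative_within_cong[OF _ p(3)]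
  have add: "((\<lambda>s. met j (y, s) u v + met j (y, s) u' v') has_real_derivative
      2 * ric j p u v + 2 * ric j p u' v') (at \<tau> within {0<..T})" for u v u' v'
    using DERIV_add[OF d d] by (simp add: p)
  have cmult: "((\<lambda>s. c * met j (y, s) u v) has_real_derivative c * (2 * ric j p u v))
      (at \<tau> within {0<..T})" for c u v
    using DERIV_cmult[OF d] by (simp add: p)
  have 1: "ric j p (u + u') v = ric j p u v + ric j p u' v" for u u' v
    using unique[OF d[of "u + u'" v], of "2 * ric j p u v + 2 * ric j p u' v"] add[of u v u' v]
      cong[of "\<lambda>s. met j (y, s) (u + u') v" "\<lambda>s. met j (y, s) u v + met j (y, s) u' v"] bil
    by (simp add: p bilinear_ladd)
  have 2: "ric j p v (u + u') = ric j p v u + ric j p v u'" for u u' v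
    using unique[OF d[of v "u + u'"], of "2 * ric j p v u + 2 * ric j p v u'"] add[of v u v u']
      cong[of "\<lambda>s. met j (y, s) v (u + u')" "\<lambda>s. met j (y, s) v u + met j (y, s) v u'"] bil
    by (simp add: p bilinear_radd)
  have 3: "ric j p (c *\<^sub>R u) v = c * ric j p u v" for c u v
    using unique[OF d[of "c *\<^sub>R u" v], of "c * (2 * ric j p u v)"] cmult[of c u v]
      cong[of "\<lambda>s. met j (y, s) (c *\<^sub>R u) v" "\<lambda>s. c * met j (y, s) u v"] bil
    by (simp add: p bilinear_lmul)
  have 4: "ric j p v (c *\<^sub>R u) = c * ric j p v u" for c u v
    using unique[OF d[of v "c *\<^sub>R u"], of "c * (2 * ric j p v u)"] cmult[of c v u]
      cong[of "\<lambda>s. met j (y, s) v (c *\<^sub>R u)" "\<lambda>s. c * met j (y, s) v u"] bil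
    by (simp add: p bilinear_rmul)
  show ?thesis unfolding bilinear_def by (intro conjI allI linearI) (simp_all add: 1 2 3 4)
qed

lemma smooth_ric: "smooth_on (slab j) (\<lambda>p. ric j p u v)"
proof -
  have "Ck_on k (slab j) (\<lambda>p. (1/2) * dmet j p u v (0, 1))" for k
    using smooth_on_deriv[OF smooth_met] by (intro Ck_on_cmult slab_accessible) (simp add: smooth_on_def)
  then have "smooth_on (slab j) (\<lambda>p. dmet j p u v (0, 1) / 2)" by (simp add: smooth_on_def)
  then show ?thesis by (simp add: smooth_on_cong[OF ric_eq_dmet])
qed

lemma scal_eq: "scal j p = metric_trace (met j p) (ric j p)"
  by (simp add: scal_def scalar_curvature_def met_def ric_def)

lemma smooth_scal: "smooth_on (slab j) (scal j)"
  unfolding smooth_on_def scal_eq[abs_def] metric_trace_def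
  using smooth_met smooth_ric bilinear_ric
  by (intro allI Ck_on_sum Ck_on_bounded_linear[OF _ bounded_linear_inner_left] Ck_on_sharp
      slab_accessible inner_met) (simp_all add: smooth_on_def bilinear_def)

abbreviation dscal :: "'j \<Rightarrow> 'f \<times> real \<Rightarrow> 'f \<times> real \<Rightarrow> real" where
  "dscal j p \<equiv> frechet_derivative (scal j) (at p within slab j)"

lemma has_derivative_scal: "p \<in> slab j \<Longrightarrow> (scal j has_derivative dscal j p) (at p within slab j)"
  by (rule smooth_on_has_derivative[OF smooth_scal])

lemma metric_patch_slice: "\<tau> \<in> {0<..T} \<Longrightarrow> metric_patch (cimg B j) (g \<tau> j)"
  using family B.open_cimg
  by unfold_locales (auto simp: smooth_metric_family_def riemannian_metric_def inner_form_def
      intro: axis_accessible_open)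

text \<open>One constant for all charts and times. It determines the threshold for N in the
  theorem.\<close>

lemma scal_bounded:
  assumes "\<exists>C. \<forall>\<tau>\<in>{0<..T}. curvature_bounded_by C B (g \<tau>)"
  obtains C where "\<And>j p. p \<in> slab j \<Longrightarrow> \<bar>scal j p\<bar> \<le> C"
proof -
  obtain C where C: "\<And>\<tau>. \<tau> \<in> {0<..T} \<Longrightarrow> curvature_bounded_by C B (g \<tau>)" using assms by blast
  have "\<bar>scal j p\<bar> \<le> real DIM('f) * (real DIM('f) * C)" if p: "p \<in> slab j" for j p
    unfolding scal_def
  proof (rule metric_patch.scalar_curvature_bounded)
    show "metric_patch (cimg B j) (g (snd p) j)" using metric_patch_slice p by auto
    show "bilinear (ricci (cimg B j) (g (snd p) j) (fst p))" using bilinear_ric[OF p] by (simp add: ric_def)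
  qed (use p C[of "snd p"] in \<open>auto simp: curvature_bounded_by_def\<close>)
  then show thesis using that by blast
qed

lemma met_transition:
  assumes "q \<in> cdom B i" "q \<in> cdom B j" "\<tau> \<in> {0<..T}"
  shows "met j (cmap B j q, \<tau>) (transition B i j q u) (transition B i j q v) = met i (cmap B i q, \<tau>) u v"
  using family assms unfolding smooth_metric_family_def riemannian_metric_def met_def by simp

text \<open>The coordinate changes do not depend on time, so the flow equation makes the Ricci tensor
  inherit the transformation law of the metric.\<close>

lemma ric_transition:
  assumes "q \<in> cdom B i" "q \<in> cdom B j" "\<tau> \<in> {0<..T}"
  shows "ric j (cmap B j q, \<tau>) (transition B i j q u) (transition B i j q v) = ric i (cmap B i q, \<tau>) u v"
proof -
  have "((\<lambda>s. met i (cmap B i q, s) u v) has_real_derivative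
      2 * ric j (cmap B j q, \<tau>) (transition B i j q u) (transition B i j q v)) (at \<tau> within {0<..T})"
    using met_time_derivative[OF B.cmap_in_cimg[OF assms(2)] assms(3)]
    by (subst has_real_derivative_within_cong[OF met_transition[OF assms(1,2), symmetric] assms(3)])
  from has_real_derivative_time_unique[OF assms(3) this met_time_derivative[OF B.cmap_in_cimg[OF assms(1)] assms(3)]]
  show ?thesis by simp
qed

lemma scal_transition:
  assumes "q \<in> cdom B i" "q \<in> cdom B j" "\<tau> \<in> {0<..T}"
  shows "scal j (cmap B j q, \<tau>) = scal i (cmap B i q, \<tau>)"
  unfolding scal_eq
  using assms B.cmap_in_cimg
  by (intro metric_trace_isometry[where t = "transition B i j q"] inner_met bilinear_ric
      met_transition ric_transition) auto

section \<open>The space-time metric\<close>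

abbreviation stmet :: "real \<Rightarrow> 'j \<Rightarrow> 'f \<times> real \<Rightarrow> 'f \<times> real \<Rightarrow> 'f \<times> real \<Rightarrow> real" where
  "stmet \<equiv> spacetime_metric B g"

lemma stmet_eq: "stmet N j p w z = met j p (fst w) (fst z) + (N + scal j p) * snd w * snd z"
  by (simp add: spacetime_metric_def met_def scal_def case_prod_beta)

lemma bilinear_stmet:
  assumes "p \<in> slab j" shows "bilinear (stmet N j p)"
  unfolding bilinear_def stmet_eq
  by (intro conjI allI linearI)
    (simp_all add: bilinear_simps[OF bilinear_met[OF assms]] algebra_simps)

lemma inner_stmet:
  assumes p: "p \<in> slab j" and N: "0 < N + scal j p"
  shows "inner_form (stmet N j p)"
  unfolding inner_form_def
proof (intro conjI allI impI bilinear_stmet[OF p])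
  fix w z :: "'f \<times> real"
  show "stmet N j p w z = stmet N j p z w"
    using inner_formD(2)[OF inner_met[OF p], of "fst w" "fst z"] by (simp add: stmet_eq)
  assume "w \<noteq> 0"
  then consider "fst w \<noteq> 0" | "snd w \<noteq> 0" by (auto simp: prod_eq_iff)
  then show "stmet N j p w w > 0"
  proof cases
    case 1
    then have "met j p (fst w) (fst w) > 0" using inner_formD(3)[OF inner_met[OF p]] by blast
    then show ?thesis using N by (simp add: stmet_eq mult.assoc add_pos_nonneg)
  next
    case 2
    then have "(N + scal j p) * (snd w * snd w) > 0"
      using N by (simp add: zero_less_mult_iff) linarith
    then show ?thesis
      using inner_formD(4)[OF inner_met[OF p], of "fst w"] by (simp add: stmet_eq mult.assoc)
  qed
qed

lemma smooth_stmet: "smooth_on (slab j) (\<lambda>p. stmet N j p w z)"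
proof -
  have "Ck_on k (slab j) (\<lambda>p. met j p (fst w) (fst z) + (snd w * snd z) * (N + scal j p))" for k
    using smooth_met smooth_scal
    by (intro Ck_on_add Ck_on_cmult Ck_on_const slab_accessible) (simp_all add: smooth_on_def)
  then show ?thesis by (simp add: smooth_on_def stmet_eq[abs_def] ac_simps)
qed

lemma metric_patch_stmet:
  assumes "\<And>p. p \<in> slab j \<Longrightarrow> 0 < N + scal j p"
  shows "metric_patch (slab j) (stmet N j)"
  by unfold_locales (use assms inner_stmet smooth_stmet slab_accessible in auto)

lemma riemannian_stmet:
  assumes "\<And>j p. p \<in> slab j \<Longrightarrow> 0 < N + scal j p"
  shows "riemannian_metric (prod_atlas T B) (stmet N)"
  unfolding riemannian_metric_def cimg_prod_atlas
proof (intro conjI allI impI ballI)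
  fix j :: 'j and x u v :: "'f \<times> real"
  assume x: "x \<in> slab j"
  note inner = inner_stmet[OF x assms[OF x]]
  show "bilinear (stmet N j x)" "stmet N j x u v = stmet N j x v u" "u \<noteq> 0 \<Longrightarrow> 0 < stmet N j x u u"
    using inner_formD[OF inner] by auto
next
  fix i j :: 'j and p :: "'o \<times> real" and u v :: "'f \<times> real"
  assume "p \<in> cdom (prod_atlas T B) i \<and> p \<in> cdom (prod_atlas T B) j"
  then obtain q \<tau> where p: "p = (q, \<tau>)" "q \<in> cdom B i" "q \<in> cdom B j" "\<tau> \<in> {0<..T}"
    by (cases p) auto
  show "stmet N j (cmap (prod_atlas T B) j p) (transition (prod_atlas T B) i j p u)
      (transition (prod_atlas T B) i j p v) = stmet N i (cmap (prod_atlas T B) i p) u v"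
    unfolding p(1) B.transition_prod_atlas[OF p(2-4)]
    by (simp add: stmet_eq met_transition[OF p(2-4)] scal_transition[OF p(2-4)])
qed (rule smooth_stmet)

end

section \<open>The second fundamental form in charts\<close>

text \<open>Isolates the Christoffel term so that the Koszul formula can be applied to it. The
  second premise makes the base points of the two terms literally the same.\<close>

lemma second_fundamental_form_eq:
  assumes "bilinear (G j (cmap B j (F p)))" "cmap B j (F p) = rep A B F i j (cmap A i p)"
  shows "second_fundamental_form A B G F \<nu> i j p u v =
    - G j (cmap B j (F p)) (deriv_within (rep_dom A B F i j) (\<lambda>y. rep_deriv A B F i j y v) (cmap A i p) u) (\<nu> p j)
    - G j (cmap B j (F p)) (christoffel (cimg B j) (G j) (cmap B j (F p))
        (rep_deriv A B F i j (cmap A i p) u) (rep_deriv A B F i j (cmap A i p) v)) (\<nu> p j)"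
  using assms by (simp add: second_fundamental_form_def cov_deriv_along_def bilinear_ladd)

text \<open>Bilinearity is what allows the mean curvature, a metric trace, to be summed over an
  orthonormal basis. The lemma serves both the hypersurfaces at fixed time and the track.\<close>

lemma bilinear_second_fundamental_form:
  fixes A :: "('i, 'm, 'e::euclidean_space) atlas" and B :: "('j, 'o, 'f::euclidean_space) atlas"
  assumes patch: "metric_patch (cimg B j) (G j)"
    and acc: "axis_accessible (rep_dom A B F i j)" and x: "cmap A i p \<in> rep_dom A B F i j"
    and rep: "smooth_on (rep_dom A B F i j) (rep A B F i j)"
    and y: "cmap B j (F p) \<in> cimg B j" "cmap B j (F p) = rep A B F i j (cmap A i p)"
  shows "bilinear (second_fundamental_form A B G F \<nu> i j p)"
proof -
  interpret metric_patch "cimg B j" "G j" by (rule patch)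
  let ?D = "rep_dom A B F i j" and ?d = "rep_deriv A B F i j" and ?x = "cmap A i p"
  let ?y = "cmap B j (F p)"
  have d: "(rep A B F i j has_derivative ?d z) (at z within ?D)" if "z \<in> ?D" for z
    using smooth_on_has_derivative[OF rep that] by (simp add: rep_deriv_def)
  have lin_d: "linear (?d z)" if "z \<in> ?D" for z
    using has_derivative_bounded_linear[OF d[OF that]] bounded_linear.linear by blast
  have dd: "((\<lambda>z. ?d z v) has_derivative frechet_derivative (\<lambda>z. ?d z v) (at ?x within ?D)) (at ?x within ?D)" for v
    unfolding rep_deriv_def by (rule smooth_on_has_derivative[OF smooth_on_deriv[OF rep] x])
  have 1: "linear (\<lambda>u. deriv_within ?D (\<lambda>z. ?d z v) ?x u)" for v
    using has_derivative_bounded_linear[OF dd] bounded_linear.linear by blast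
  have 2: "linear (\<lambda>v. deriv_within ?D (\<lambda>z. ?d z v) ?x u)" for u
    using linear_deriv_within[OF acc x lin_d dd] .
  have 3: "linear (\<lambda>u. christoffel (cimg B j) (G j) ?y (?d ?x u) (?d ?x v))" for v
    using linear_compose[OF lin_d[OF x] linear_christoffel_left[OF y(1)]] by (simp add: o_def)
  have 4: "linear (\<lambda>v. christoffel (cimg B j) (G j) ?y (?d ?x u) (?d ?x v))" for u
    using linear_compose[OF lin_d[OF x] linear_christoffel_right[OF y(1)]] by (simp add: o_def)
  have G: "linear (\<lambda>w. G j ?y w z)" for z
    using bilinear_G[OF y(1)] by (simp add: bilinear_def)
  have G: "linear (\<lambda>w. - G j ?y (f w) z)" if "linear f" for f :: "'e \<Rightarrow> 'f" and z
    using linear_compose_neg[OF linear_compose[OF that G[of z]]] by (simp add: o_def)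
  show ?thesis
    unfolding bilinear_def second_fundamental_form_def cov_deriv_along_def y(2)[symmetric]
    by (intro conjI allI G linear_compose_add 1 2 3 4)
qed

section \<open>The space-time track\<close>

lemma accessible_time_slice:
  fixes S :: "('a::euclidean_space \<times> real) set"
  assumes "axis_accessible S" shows "axis_accessible {s. (u, s) \<in> S}"
  unfolding axis_accessible_def
proof (intro ballI allI impI)
  fix x b e :: real
  assume "x \<in> {s. (u, s) \<in> S}" "b \<in> Basis" and e: "0 < e"
  then have "(u, x) \<in> S" "(0, b) \<in> Basis" by (simp_all add: Basis_prod_def)
  from assms[unfolded axis_accessible_def, rule_format, OF this e]
  obtain d where "0 < \<bar>d\<bar> \<and> \<bar>d\<bar> < e \<and> (u, x) + d *\<^sub>R (0, b) \<in> S" ..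
  then show "\<exists>d. 0 < \<bar>d\<bar> \<and> \<bar>d\<bar> < e \<and> x + d *\<^sub>R b \<in> {s. (u, s) \<in> S}" by auto
qed

lemma accessible_space_slice:
  fixes S :: "('a::euclidean_space \<times> real) set"
  assumes "axis_accessible S" shows "axis_accessible {u. (u, s) \<in> S}"
  unfolding axis_accessible_def
proof (intro ballI allI impI)
  fix x b :: 'a and e :: real
  assume "x \<in> {u. (u, s) \<in> S}" "b \<in> Basis" and e: "0 < e"
  then have "(x, s) \<in> S" "(b, 0) \<in> Basis" by (simp_all add: Basis_prod_def)
  from assms[unfolded axis_accessible_def, rule_format, OF this e]
  obtain d where "0 < \<bar>d\<bar> \<and> \<bar>d\<bar> < e \<and> (x, s) + d *\<^sub>R (b, 0) \<in> S" ..
  then show "\<exists>d. 0 < \<bar>d\<bar> \<and> \<bar>d\<bar> < e \<and> x + d *\<^sub>R b \<in> {u. (u, s) \<in> S}" by auto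
qed

lemma Ck_on_ident: "axis_accessible S \<Longrightarrow> Ck_on k S (\<lambda>x. x)"
proof (cases k)
  case (Suc n)
  assume S: "axis_accessible S"
  show ?thesis unfolding Suc by (rule Ck_on_SucI[OF S has_derivative_ident Ck_on_const[OF S]])
qed simp

lemma Ck_on_Pair:
  assumes S: "axis_accessible S" and "Ck_on k S f" "Ck_on k S h"
  shows "Ck_on k S (\<lambda>x. (f x, h x))"
proof -
  have l: "bounded_linear (\<lambda>y. (y, 0))" "bounded_linear (\<lambda>z. (0, z))"
    by (intro bounded_linear_Pair bounded_linear_ident bounded_linear_zero)+
  have "Ck_on k S (\<lambda>x. (f x, 0) + (0, h x))"
    by (rule Ck_on_add[OF S Ck_on_bounded_linear[OF S l(1) assms(2)]
          Ck_on_bounded_linear[OF S l(2) assms(3)]])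
  then show ?thesis by simp
qed

locale flow_track = ricci_background B T g + A: atlas A
  for A :: "('i, 'm::{t2_space, second_countable_topology}, 'e::euclidean_space) atlas"
    and B :: "('j, 'o::{t2_space, second_countable_topology}, 'f::euclidean_space) atlas"
    and T :: real and g :: "real \<Rightarrow> ('j, 'f) metric" +
  fixes F :: "real \<Rightarrow> 'm \<Rightarrow> 'o" and \<nu> :: "real \<Rightarrow> 'm \<Rightarrow> 'j \<Rightarrow> 'f"
  assumes dim: "DIM('f) = DIM('e) + 1"
    and immersions: "smooth_immersion_family T A B F"
    and normals: "smooth_unit_normal_family T A B g F \<nu>"
    and motion: "mean_curvature_flow T A B g F \<nu>"
begin

abbreviation track_dom :: "'i \<Rightarrow> 'j \<Rightarrow> ('e \<times> real) set" where
  "track_dom \<equiv> rep_dom (prod_atlas T A) B (\<lambda>(x, \<tau>). F \<tau> x)"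

text \<open>Written with the chart of the hypersurface at fixed time, so that restricting to a time
  is substitution. It agrees with \<open>rep\<close> of the space-time map on
  \<open>track_dom\<close>, where the inverse chart of the product atlas splits.\<close>

definition pos :: "'i \<Rightarrow> 'j \<Rightarrow> 'e \<times> real \<Rightarrow> 'f" where
  "pos i j p = cmap B j (F (snd p) (cinv A i (fst p)))"

definition nor :: "'i \<Rightarrow> 'j \<Rightarrow> 'e \<times> real \<Rightarrow> 'f" where
  "nor i j p = \<nu> (snd p) (cinv A i (fst p)) j"

definition mean :: "real \<Rightarrow> 'm \<Rightarrow> real" where
  "mean \<tau> x = mean_curvature A B (g \<tau>) (F \<tau>) (\<nu> \<tau>) x"

definition lmean :: "'i \<Rightarrow> 'e \<times> real \<Rightarrow> real" where
  "lmean i p = mean (snd p) (cinv A i (fst p))"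

abbreviation stpos :: "'i \<Rightarrow> 'j \<Rightarrow> 'e \<times> real \<Rightarrow> 'f \<times> real" where
  "stpos i j p \<equiv> (pos i j p, snd p)"

abbreviation dpos :: "'i \<Rightarrow> 'j \<Rightarrow> 'e \<times> real \<Rightarrow> 'e \<times> real \<Rightarrow> 'f" where
  "dpos i j p \<equiv> frechet_derivative (pos i j) (at p within track_dom i j)"

lemma track_dom_iff:
  "(u, \<tau>) \<in> track_dom i j \<longleftrightarrow> u \<in> cimg A i \<and> \<tau> \<in> {0<..T} \<and> F \<tau> (cinv A i u) \<in> cdom B j"
  by (force simp: rep_dom_def A.cmap_in_cimg A.cinv_in_cdom)

lemma track_domD:
  assumes "p \<in> track_dom i j"
  shows "fst p \<in> cimg A i" "snd p \<in> {0<..T}" "F (snd p) (cinv A i (fst p)) \<in> cdom B j"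
    "cinv A i (fst p) \<in> cdom A i" "stpos i j p \<in> slab j"
  using assms track_dom_iff[of "fst p" "snd p"]
  by (auto simp: A.cinv_in_cdom pos_def B.cmap_in_cimg)

lemma chart_in_track_dom:
  "x \<in> cdom A i \<Longrightarrow> \<tau> \<in> {0<..T} \<Longrightarrow> F \<tau> x \<in> cdom B j \<Longrightarrow> (cmap A i x, \<tau>) \<in> track_dom i j"
  by (simp add: track_dom_iff A.cmap_in_cimg)

text \<open>A chart that contains \<open>F \<tau> x\<close> keeps containing it under small changes
  of \<open>x\<close> and \<tau>. The set of such pairs is only relatively open, because \<tau> may
  be \<open>T\<close>.\<close>

lemma openin_flow_preimage:
  assumes "open U"
  obtains W where "open W" "{(x, \<tau>). \<tau> \<in> {0<..T} \<and> F \<tau> x \<in> U} = (UNIV \<times> {0<..T}) \<inter> W"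
proof -
  have "continuous_on (\<Union>i. cdom (prod_atlas T A) i) (\<lambda>(x, \<tau>). F \<tau> x)"
    using immersions by (simp add: smooth_immersion_family_def smooth_map_def)
  moreover have "(\<Union>i. cdom (prod_atlas T A) i) = UNIV \<times> {0<..T}"
    using A.atlas by (auto simp: smooth_atlas_def)
  ultimately have "openin (top_of_set (UNIV \<times> {0<..T})) ((UNIV \<times> {0<..T}) \<inter> (\<lambda>(x, \<tau>). F \<tau> x) -` U)"
    using assms continuous_openin_preimage_gen by metis
  moreover have "(UNIV \<times> {0<..T}) \<inter> (\<lambda>(x, \<tau>). F \<tau> x) -` U = {(x, \<tau>). \<tau> \<in> {0<..T} \<and> F \<tau> x \<in> U}" by auto
  ultimately show thesis using that by (auto simp: openin_open)
qed

lemma openin_track_dom: "openin (top_of_set (UNIV \<times> {0<..T})) (track_dom i j)"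
proof -
  obtain W where W: "open W" "{(x, \<tau>). \<tau> \<in> {0<..T} \<and> F \<tau> x \<in> cdom B j} = (UNIV \<times> {0<..T}) \<inter> W"
    using openin_flow_preimage[OF B.open_cdom] by blast
  let ?h = "\<lambda>p. (cinv A i (fst p), snd p :: real)"
  have c: "continuous_on (cimg A i) (cinv A i)"
    using A.homeomorphism_chart by (simp add: homeomorphism_def)
  have "continuous_on (cimg A i \<times> UNIV) (\<lambda>p. cinv A i (fst p))"
    by (rule continuous_on_compose2[OF c continuous_on_fst[OF continuous_on_id]]) auto
  then have "continuous_on (cimg A i \<times> UNIV) ?h"
    by (rule continuous_on_Pair[OF _ continuous_on_snd[OF continuous_on_id]])
  then have "open (?h -` W \<inter> cimg A i \<times> UNIV)"
    using W(1) A.open_cimg by (simp add: continuous_on_open_vimage open_Times)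
  moreover have "track_dom i j = (UNIV \<times> {0<..T}) \<inter> (?h -` W \<inter> cimg A i \<times> UNIV)"
  proof -
    have "(x, \<tau>) \<in> W \<longleftrightarrow> F \<tau> x \<in> cdom B j" if "\<tau> \<in> {0<..T}" for x \<tau>
      using W(2) that by (auto simp: set_eq_iff)
    then show ?thesis by (auto simp: track_dom_iff)
  qed
  ultimately show ?thesis by (auto simp: openin_open)
qed

lemma track_dom_accessible: "axis_accessible (track_dom i j)"
  by (rule axis_accessible_slab[OF openin_track_dom])

lemma smooth_pos: "smooth_on (track_dom i j) (pos i j)"
proof -
  have sm: "smooth_on (track_dom i j) (rep (prod_atlas T A) B (\<lambda>(x, \<tau>). F \<tau> x) i j)"
    using immersions by (simp add: smooth_immersion_family_def smooth_map_def)
  have eq: "rep (prod_atlas T A) B (\<lambda>(x, \<tau>). F \<tau> x) i j p = pos i j p" if "p \<in> track_dom i j" for p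
    using track_domD[OF that] A.cinv_prod_atlas[of "fst p" i "snd p" T] by (simp add: rep_def pos_def)
  show ?thesis by (rule iffD1[OF smooth_on_cong[OF eq] sm])
qed

lemma smooth_nor: "smooth_on (track_dom i j) (nor i j)"
proof -
  have sm: "smooth_on (track_dom i j) (\<lambda>p. (\<lambda>(x, \<tau>). \<nu> \<tau> x) (cinv (prod_atlas T A) i p) j)"
    using normals unfolding smooth_unit_normal_family_def smooth_field_along_def by blast
  have eq: "(\<lambda>(x, \<tau>). \<nu> \<tau> x) (cinv (prod_atlas T A) i p) j = nor i j p" if "p \<in> track_dom i j" for p
    using track_domD[OF that] A.cinv_prod_atlas[of "fst p" i "snd p" T] by (simp add: nor_def)
  show ?thesis by (rule iffD1[OF smooth_on_cong[OF eq] sm])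
qed

lemma has_derivative_pos:
  "p \<in> track_dom i j \<Longrightarrow> (pos i j has_derivative dpos i j p) (at p within track_dom i j)"
  by (rule smooth_on_has_derivative[OF smooth_pos])

lemma linear_dpos: "p \<in> track_dom i j \<Longrightarrow> linear (dpos i j p)"
  using has_derivative_bounded_linear[OF has_derivative_pos] bounded_linear.linear by blast

lemma rep_dom_slice: "\<tau> \<in> {0<..T} \<Longrightarrow> rep_dom A B (F \<tau>) i j = {u. (u, \<tau>) \<in> track_dom i j}"
  by (force simp: track_dom_iff rep_dom_def A.cmap_in_cimg A.cinv_in_cdom)

lemma rep_slice: "rep A B (F \<tau>) i j = (\<lambda>u. pos i j (u, \<tau>))"
  by (auto simp: rep_def pos_def)

lemma rep_deriv_slice:
  assumes "(u, \<tau>) \<in> track_dom i j"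
  shows "rep_deriv A B (F \<tau>) i j u v = dpos i j (u, \<tau>) (v, 0)"
proof -
  have \<tau>: "\<tau> \<in> {0<..T}" using assms track_domD by fastforce
  have "frechet_derivative (\<lambda>u. pos i j (u, \<tau>)) (at u within {u. (u, \<tau>) \<in> track_dom i j})
      = (\<lambda>v. dpos i j (u, \<tau>) (v, 0))"
    using assms by (intro deriv_within_eq accessible_space_slice track_dom_accessible
        has_derivative_space_slice[where S = "track_dom i j"] has_derivative_pos) auto
  then show ?thesis unfolding rep_deriv_def rep_dom_slice[OF \<tau>] rep_slice by simp
qed

lemma inj_dpos:
  assumes p: "p \<in> track_dom i j" and 0: "dpos i j p (v, 0) = 0"
  shows "v = 0"
proof -
  obtain u \<tau> where u: "p = (u, \<tau>)" by (cases p)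
  note \<tau> = track_domD(2)[OF p[unfolded u], unfolded snd_conv]
  have "inj (rep_deriv A B (F \<tau>) i j u)"
    using immersions \<tau> p rep_dom_slice[OF \<tau>] unfolding u
    by (auto simp: smooth_immersion_family_def smooth_immersion_def)
  moreover have "rep_deriv A B (F \<tau>) i j u v = rep_deriv A B (F \<tau>) i j u 0"
    using 0 linear_0[OF linear_dpos[OF p]] p unfolding u
    by (simp add: rep_deriv_slice zero_prod_def[symmetric])
  ultimately show ?thesis by (rule injD)
qed

lemma nor_tangent:
  assumes "p \<in> track_dom i j"
  shows "met j (stpos i j p) (nor i j p) (nor i j p) = 1"
    and "met j (stpos i j p) (dpos i j p (v, 0)) (nor i j p) = 0"
proof -
  obtain u \<tau> where u: "p = (u, \<tau>)" by (cases p)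
  note d = track_domD[OF assms[unfolded u], unfolded fst_conv snd_conv]
  have "unit_normal A B (g \<tau>) (F \<tau>) (cinv A i u) (\<nu> \<tau> (cinv A i u))"
    using normals d(2) by (auto simp: smooth_unit_normal_family_def)
  then have n: "g \<tau> j (cmap B j (F \<tau> (cinv A i u))) (\<nu> \<tau> (cinv A i u) j) (\<nu> \<tau> (cinv A i u) j) = 1"
    "g \<tau> j (cmap B j (F \<tau> (cinv A i u))) (rep_deriv A B (F \<tau>) i j u v) (\<nu> \<tau> (cinv A i u) j) = 0"
    using d unfolding unit_normal_def by (metis A.cmap_cinv)+
  from n(1) show "met j (stpos i j p) (nor i j p) (nor i j p) = 1" by (simp add: u met_def nor_def pos_def)
  from n(2) show "met j (stpos i j p) (dpos i j p (v, 0)) (nor i j p) = 0"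
    using rep_deriv_slice[OF assms[unfolded u], of v] by (simp add: u met_def nor_def pos_def)
qed

lemma nor_nonzero: "p \<in> track_dom i j \<Longrightarrow> nor i j p \<noteq> 0"
  using nor_tangent(1) bilinear_lzero[OF bilinear_met[OF track_domD(5)]] by fastforce

lemma velocity:
  assumes "p \<in> track_dom i j"
  shows "dpos i j p (0, 1) = - lmean i p *\<^sub>R nor i j p"
proof -
  obtain u \<tau> where u: "p = (u, \<tau>)" by (cases p)
  note d = track_domD[OF assms[unfolded u], unfolded fst_conv snd_conv]
  \<comment> \<open>The times at which the point with coordinates \<open>u\<close> lies in chart
    \<open>j\<close>. The flow equation and the restriction of the space-time derivative are
    compared on this set.\<close>
  let ?J = "{s. (u, s) \<in> track_dom i j}"
  have "((\<lambda>s. pos i j (u, s)) has_derivative (\<lambda>h. dpos i j (u, \<tau>) (0, h))) (at \<tau> within ?J)"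
    using has_derivative_pos assms u by (intro has_derivative_time_slice[where S = "track_dom i j"]) auto
  moreover have "((\<lambda>s. pos i j (u, s)) has_derivative (\<lambda>h. h *\<^sub>R (- lmean i p *\<^sub>R nor i j p))) (at \<tau> within ?J)"
  proof (rule has_derivative_subset)
    show "((\<lambda>s. pos i j (u, s)) has_derivative (\<lambda>h. h *\<^sub>R (- lmean i p *\<^sub>R nor i j p))) (at \<tau> within {0<..T})"
      using motion d unfolding mean_curvature_flow_def has_vector_derivative_def
      by (simp add: pos_def lmean_def mean_def nor_def u)
  qed (auto simp: track_dom_iff)
  moreover have "axis_accessible ?J" by (rule accessible_time_slice[OF track_dom_accessible])
  ultimately have "(\<lambda>h. dpos i j (u, \<tau>) (0, h)) = (\<lambda>h. h *\<^sub>R (- lmean i p *\<^sub>R nor i j p))"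
    using deriv_within_eq[of ?J \<tau> "\<lambda>s. pos i j (u, s)"] assms u by (metis mem_Collect_eq)
  from fun_cong[OF this, of 1] show ?thesis by (simp add: u)
qed

lemma dpos_eq:
  assumes "p \<in> track_dom i j"
  shows "dpos i j p w = dpos i j p (fst w, 0) - (snd w * lmean i p) *\<^sub>R nor i j p"
proof -
  have "w = (fst w, 0) + snd w *\<^sub>R (0, 1)" by (simp add: prod_eq_iff)
  then have "dpos i j p w = dpos i j p (fst w, 0) + snd w *\<^sub>R dpos i j p (0, 1)"
    using linear_add[OF linear_dpos[OF assms]] linear_cmul[OF linear_dpos[OF assms]] by metis
  then show ?thesis by (simp add: velocity[OF assms])
qed

lemma rep_dom_track: "rep_dom (prod_atlas T A) (prod_atlas T B) (track F) i j = track_dom i j"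
  by (auto simp: rep_dom_def track_def)

lemma rep_track:
  assumes "p \<in> track_dom i j"
  shows "rep (prod_atlas T A) (prod_atlas T B) (track F) i j p = stpos i j p"
  using track_domD[OF assms] A.cinv_prod_atlas[of "fst p" i "snd p" T]
  by (simp add: rep_def track_def pos_def)

lemma smooth_stpos: "smooth_on (track_dom i j) (stpos i j)"
  using smooth_pos Ck_on_bounded_linear[OF track_dom_accessible bounded_linear_snd
      Ck_on_ident[OF track_dom_accessible]]
  unfolding smooth_on_def by (blast intro: Ck_on_Pair[OF track_dom_accessible])

lemma smooth_rep_track:
  "smooth_on (track_dom i j) (rep (prod_atlas T A) (prod_atlas T B) (track F) i j)"
  by (rule iffD2[OF smooth_on_cong[OF rep_track] smooth_stpos])

lemma rep_deriv_track:
  assumes "p \<in> track_dom i j"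
  shows "rep_deriv (prod_atlas T A) (prod_atlas T B) (track F) i j p w = (dpos i j p w, snd w)"
proof -
  have "frechet_derivative (rep (prod_atlas T A) (prod_atlas T B) (track F) i j) (at p within track_dom i j)
      = frechet_derivative (stpos i j) (at p within track_dom i j)"
    by (rule deriv_within_cong[OF rep_track assms])
  also have "\<dots> = (\<lambda>w. (dpos i j p w, snd w))"
    by (intro deriv_within_eq track_dom_accessible assms has_derivative_Pair has_derivative_pos
        has_derivative_snd has_derivative_ident)
  finally show ?thesis by (simp add: rep_deriv_def rep_dom_track)
qed

end

lemma Ck_on_inverse:
  fixes f :: "'a::euclidean_space \<Rightarrow> real"
  assumes S: "axis_accessible S" and nz: "\<And>x. x \<in> S \<Longrightarrow> f x \<noteq> 0"
  shows "Ck_on k S f \<Longrightarrow> Ck_on k S (\<lambda>x. inverse (f x))"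
proof (induction k)
  case 0
  then show ?case using nz by (simp add: continuous_on_inverse)
next
  case (Suc k)
  note f = Ck_on_SucD[OF Suc.prems] and inv = Suc.IH[OF Ck_on_Suc_imp[OF Suc.prems]]
  have "Ck_on k S (\<lambda>x. (-1) * (inverse (f x) * deriv_within S f x u * inverse (f x)))" for u
    by (rule Ck_on_cmult[OF S Ck_on_mult[OF S Ck_on_mult[OF S inv f(2)] inv]])
  then show ?case
    by (intro Ck_on_SucI[OF S Deriv.has_derivative_inverse[OF nz f(1)]]) simp_all
qed

section \<open>Derivatives of the metric in space and time\<close>

context ricci_background
begin

lemma linear_dmet: "p \<in> slab j \<Longrightarrow> linear (dmet j p u v)"
  using has_derivative_bounded_linear[OF has_derivative_met] bounded_linear.linear by blast

lemma bilinear_dmet: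
  assumes p: "p \<in> slab j" shows "bilinear (\<lambda>u v. dmet j p u v h)"
  unfolding bilinear_def
proof (intro conjI allI)
  fix w
  show "linear (\<lambda>v. dmet j p w v h)" and "linear (\<lambda>u. dmet j p u w h)"
    using bilinear_met
    by (intro linear_deriv_within[OF slab_accessible p _ has_derivative_met[OF p]];
        simp add: bilinear_def)+
qed

lemma linear_dscal: "p \<in> slab j \<Longrightarrow> linear (dscal j p)"
  using has_derivative_bounded_linear[OF has_derivative_scal] bounded_linear.linear by blast

lemma linear_pair_split:
  fixes D :: "'a::real_vector \<times> real \<Rightarrow> real"
  assumes "linear D"
  shows "D (k *\<^sub>R v, l) = k * D (v, 0) + l * D (0, 1)"
proof -
  have "(k *\<^sub>R v, l) = k *\<^sub>R (v, 0) + l *\<^sub>R (0, 1)" by simp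
  then show ?thesis using linear_add[OF assms] linear_cmul[OF assms] by (metis real_scaleR_def)
qed

text \<open>Through this splitting Ricci enters the second fundamental form of the track: the time
  component of a direction sees the flow equation.\<close>

lemma dmet_split:
  assumes "p \<in> slab j"
  shows "dmet j p u v (k *\<^sub>R w, l) = k * dmet j p u v (w, 0) + 2 * l * ric j p u v"
  using linear_pair_split[OF linear_dmet[OF assms]] by (simp add: ric_eq_dmet[OF assms])

lemma dstmet:
  assumes "p \<in> slab j"
  shows "deriv_within (slab j) (\<lambda>p. stmet N j p w z) p h
    = dmet j p (fst w) (fst z) h + snd w * snd z * dscal j p h"
proof -
  have "((\<lambda>p. met j p (fst w) (fst z) + (N + scal j p) * (snd w * snd z)) has_derivative
      (\<lambda>h. dmet j p (fst w) (fst z) h + (0 + dscal j p h) * (snd w * snd z))) (at p within slab j)"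
    by (intro has_derivative_add has_derivative_mult_left has_derivative_const
        has_derivative_met[OF assms] has_derivative_scal[OF assms])
  from deriv_within_eq[OF slab_accessible assms this] show ?thesis
    by (simp add: stmet_eq[abs_def] mult.assoc)
qed

text \<open>Expresses the Koszul formula at a fixed time in space-time derivatives, so that the
  second fundamental forms of the hypersurface and of the track can be matched term by term.\<close>

lemma dmet_slice:
  assumes "y \<in> cimg B j" "\<tau> \<in> {0<..T}"
  shows "deriv_within (cimg B j) (\<lambda>y. g \<tau> j y u v) y h = dmet j (y, \<tau>) u v (h, 0)"
proof -
  have "((\<lambda>y. met j (y, \<tau>) u v) has_derivative (\<lambda>h. dmet j (y, \<tau>) u v (h, 0))) (at y within cimg B j)"
    using assms has_derivative_met by (intro has_derivative_space_slice[where S = "slab j"]) auto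
  from deriv_within_eq[OF axis_accessible_open[OF B.open_cimg] assms(1) this]
  show ?thesis by (simp add: met_def)
qed

end

section \<open>Second derivatives along the flow\<close>

context flow_track
begin

abbreviation ddpos :: "'i \<Rightarrow> 'j \<Rightarrow> 'e \<times> real \<Rightarrow> 'e \<times> real \<Rightarrow> 'e \<times> real \<Rightarrow> 'f" where
  "ddpos i j p z \<equiv> frechet_derivative (\<lambda>y. dpos i j y z) (at p within track_dom i j)"

abbreviation dlmean :: "'i \<Rightarrow> 'j \<Rightarrow> 'e \<times> real \<Rightarrow> 'e \<times> real \<Rightarrow> real" where
  "dlmean i j p \<equiv> frechet_derivative (lmean i) (at p within track_dom i j)"

abbreviation dnor :: "'i \<Rightarrow> 'j \<Rightarrow> 'e \<times> real \<Rightarrow> 'e \<times> real \<Rightarrow> 'f" where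
  "dnor i j p \<equiv> frechet_derivative (nor i j) (at p within track_dom i j)"

lemma has_derivative_dpos:
  "p \<in> track_dom i j \<Longrightarrow> ((\<lambda>y. dpos i j y z) has_derivative ddpos i j p z) (at p within track_dom i j)"
  by (rule smooth_on_has_derivative[OF smooth_on_deriv[OF smooth_pos]])

lemma has_derivative_nor:
  "p \<in> track_dom i j \<Longrightarrow> (nor i j has_derivative dnor i j p) (at p within track_dom i j)"
  by (rule smooth_on_has_derivative[OF smooth_nor])

text \<open>The velocity and the normal are parallel in every chart, so the factor between them can
  be extracted with the Euclidean inner product of the coordinates.\<close>

lemma smooth_lmean: "smooth_on (track_dom i j) (lmean i)"
proof -
  note acc = track_dom_accessible[of i j]
  let ?h = "\<lambda>p. - 1 * ((dpos i j p (0, 1) \<bullet> nor i j p) * inverse (nor i j p \<bullet> nor i j p))"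
  have nor: "Ck_on k (track_dom i j) (nor i j)" for k using smooth_nor by (simp add: smooth_on_def)
  have dpos: "Ck_on k (track_dom i j) (\<lambda>p. dpos i j p (0, 1))" for k
    using smooth_on_deriv[OF smooth_pos] by (simp add: smooth_on_def)
  note inner = Ck_on_bilinear[OF acc bounded_bilinear_inner]
  have "smooth_on (track_dom i j) ?h"
    unfolding smooth_on_def
    by (intro allI Ck_on_cmult[OF acc] Ck_on_mult[OF acc] inner[OF dpos nor]
        Ck_on_inverse[OF acc _ inner[OF nor nor]]) (simp add: nor_nonzero)
  moreover have "lmean i p = ?h p" if "p \<in> track_dom i j" for p
    using nor_nonzero[OF that] by (simp add: velocity[OF that])
  ultimately show ?thesis by (subst smooth_on_cong[of "track_dom i j" "lmean i" ?h]) auto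
qed

lemma has_derivative_lmean:
  "p \<in> track_dom i j \<Longrightarrow> (lmean i has_derivative dlmean i j p) (at p within track_dom i j)"
  by (rule smooth_on_has_derivative[OF smooth_lmean])

lemma acceleration:
  assumes "p \<in> track_dom i j"
  shows "ddpos i j p (0, 1) h = - (dlmean i j p h *\<^sub>R nor i j p) - lmean i p *\<^sub>R dnor i j p h"
proof -
  have "ddpos i j p (0, 1)
      = frechet_derivative (\<lambda>y. - (lmean i y *\<^sub>R nor i j y)) (at p within track_dom i j)"
    by (rule deriv_within_cong[OF _ assms]) (simp add: velocity)
  also have "\<dots> = (\<lambda>h. - (lmean i p *\<^sub>R dnor i j p h + dlmean i j p h *\<^sub>R nor i j p))"
    by (intro deriv_within_eq track_dom_accessible assms has_derivative_minus has_derivative_scaleR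
        has_derivative_lmean has_derivative_nor)
  finally show ?thesis by simp
qed

lemma has_derivative_stpos:
  assumes "p \<in> track_dom i j"
  shows "(stpos i j has_derivative (\<lambda>h. (dpos i j p h, snd h))) (at p within track_dom i j)"
  by (intro has_derivative_Pair has_derivative_pos[OF assms] has_derivative_snd has_derivative_ident)

text \<open>The derivative along the track of the unit length of the normal. It gives the normal
  component of \<open>dnor\<close> as a derivative of the metric.\<close>

lemma nor_derivative:
  assumes p: "p \<in> track_dom i j"
  shows "dmet j (stpos i j p) (nor i j p) (nor i j p) (dpos i j p h, snd h)
    + 2 * met j (stpos i j p) (dnor i j p h) (nor i j p) = 0"
proof -
  let ?D = "track_dom i j" and ?q = "stpos i j p" and ?n = "nor i j p" and ?n' = "dnor i j p"
  note q = track_domD(5)[OF p]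
  have met: "((\<lambda>y. met j (stpos i j y) e e') has_derivative
      (\<lambda>h. dmet j ?q e e' (dpos i j p h, snd h))) (at p within ?D)" for e e'
  proof (rule has_derivative_in_compose[OF has_derivative_stpos[OF p]])
    show "((\<lambda>q. met j q e e') has_derivative dmet j ?q e e') (at ?q within stpos i j ` ?D)"
      using track_domD(5) by (blast intro: has_derivative_subset[OF has_derivative_met[OF q]])
  qed
  have nor: "((\<lambda>y. nor i j y \<bullet> e) has_derivative (\<lambda>h. ?n' h \<bullet> e)) (at p within ?D)" for e
    by (rule has_derivative_inner_left[OF has_derivative_nor[OF p]])
  \<comment> \<open>The metric and its two arguments all vary. Expanding in the fixed coordinate
    basis leaves products of scalar functions, to which the product rule applies.\<close>
  let ?f = "\<lambda>y. \<Sum>e\<in>Basis. \<Sum>e'\<in>Basis. (nor i j y \<bullet> e) * (nor i j y \<bullet> e') * met j (stpos i j y) e e'"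
  let ?f' = "\<lambda>h. \<Sum>e\<in>Basis. \<Sum>e'\<in>Basis.
        (?n \<bullet> e) * (?n \<bullet> e') * dmet j ?q e e' (dpos i j p h, snd h)
        + ((?n \<bullet> e) * (?n' h \<bullet> e') + (?n' h \<bullet> e) * (?n \<bullet> e')) * met j ?q e e'"
  have der: "(?f has_derivative ?f') (at p within ?D)"
    by (intro has_derivative_sum has_derivative_mult nor met)
  have one: "?f y = 1" if "y \<in> ?D" for y
    using bilinear_expand[OF bilinear_met[OF track_domD(5)[OF that]], of "nor i j y" "nor i j y"]
      nor_tangent(1)[OF that] by simp
  have "((\<lambda>y. 1) has_derivative ?f') (at p within ?D)"
    by (rule iffD1[OF has_derivative_within_cong[OF one p] der])
  then have 1: "frechet_derivative (\<lambda>y. 1) (at p within ?D) = ?f'"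
    by (rule deriv_within_eq[OF track_dom_accessible p])
  have 0: "frechet_derivative (\<lambda>y. 1::real) (at p within ?D) = (\<lambda>h. 0)"
    by (rule deriv_within_eq[OF track_dom_accessible p has_derivative_const])
  have "?f' h = 0" by (rule fun_cong[OF trans[OF 1[symmetric] 0]])
  then have "dmet j ?q ?n ?n (dpos i j p h, snd h) + (met j ?q ?n (?n' h) + met j ?q (?n' h) ?n) = 0"
    by (simp only: bilinear_expand[OF bilinear_met[OF q], of ?n "?n' h"]
        bilinear_expand[OF bilinear_met[OF q], of "?n' h" ?n]
        bilinear_expand[OF bilinear_dmet[OF q], where u = ?n and v = ?n] distrib_right sum.distrib)
  then show ?thesis using inner_formD(2)[OF inner_met[OF q], of ?n "?n' h"] by simp
qed

section \<open>Frames adapted to the hypersurface\<close>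

definition induced :: "'i \<Rightarrow> 'j \<Rightarrow> 'e \<times> real \<Rightarrow> 'e \<Rightarrow> 'e \<Rightarrow> real" where
  "induced i j p u v = met j (stpos i j p) (dpos i j p (u, 0)) (dpos i j p (v, 0))"

lemma linear_dpos_space: "p \<in> track_dom i j \<Longrightarrow> linear (\<lambda>u. dpos i j p (u, 0))"
  using linear_compose[OF _ linear_dpos, of "\<lambda>u. (u, 0)"]
  by (simp add: o_def linear_iff)

lemma inner_induced:
  assumes p: "p \<in> track_dom i j"
  shows "inner_form (induced i j p)"
proof -
  note b = bilinear_met[OF track_domD(5)[OF p]]
  note d = linear_add[OF linear_dpos_space[OF p]] linear_cmul[OF linear_dpos_space[OF p]]
  show ?thesis
    unfolding inner_form_def
  proof (intro conjI allI impI)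
    show "bilinear (induced i j p)"
      unfolding bilinear_def induced_def
      by (intro conjI allI linearI) (simp_all add: d bilinear_simps[OF b])
    show "induced i j p u v = induced i j p v u" for u v
      unfolding induced_def by (rule inner_formD(2)[OF inner_met[OF track_domD(5)[OF p]]])
    show "induced i j p u u > 0" if "u \<noteq> 0" for u
      unfolding induced_def
      using inner_formD(3)[OF inner_met[OF track_domD(5)[OF p]]] inj_dpos[OF p] that by blast
  qed
qed

text \<open>The codimension enters here: one tangent frame together with the normal has exactly
  \<open>DIM('f)\<close> elements.\<close>

lemma adapted_frame:
  assumes p: "p \<in> track_dom i j" and S: "orthonormal_basis (induced i j p) S"
  shows "inj_on (\<lambda>e. dpos i j p (e, 0)) S" "nor i j p \<notin> (\<lambda>e. dpos i j p (e, 0)) ` S"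
    "orthonormal_basis (met j (stpos i j p)) (insert (nor i j p) ((\<lambda>e. dpos i j p (e, 0)) ` S))"
proof -
  let ?d = "\<lambda>e. dpos i j p (e, 0)"
  show inj: "inj_on ?d S"
  proof (rule inj_onI)
    fix u v assume "?d u = ?d v"
    then have "?d (u - v) = 0" using linear_diff[OF linear_dpos_space[OF p], of u v] by simp
    then show "u = v" using inj_dpos[OF p] by fastforce
  qed
  have ne: "?d u \<noteq> nor i j p" for u using nor_tangent(2)[OF p, of u] nor_tangent(1)[OF p] by auto
  show n: "nor i j p \<notin> ?d ` S"
  proof
    assume "nor i j p \<in> ?d ` S"
    then obtain u where "nor i j p = ?d u" by (rule imageE)
    then show False using ne[of u] by simp
  qed
  have "met j (stpos i j p) (nor i j p) (?d u) = 0" for u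
    using nor_tangent(2)[OF p] inner_formD(2)[OF inner_met[OF track_domD(5)[OF p]]] by metis
  then have "orthonormal_set (met j (stpos i j p)) (insert (nor i j p) (?d ` S))"
    using S inj ne nor_tangent[OF p]
    by (auto simp: orthonormal_basis_def orthonormal_set_def induced_def inj_on_def)
  moreover have "card (insert (nor i j p) (?d ` S)) = DIM('f)"
    using S n by (simp add: orthonormal_basis_def orthonormal_set_def card_image[OF inj] dim)
  ultimately show "orthonormal_basis (met j (stpos i j p)) (insert (nor i j p) (?d ` S))"
    by (simp add: orthonormal_basis_def)
qed

lemma scal_trace:
  assumes p: "p \<in> track_dom i j" and S: "orthonormal_basis (induced i j p) S"
  shows "(\<Sum>e\<in>S. ric j (stpos i j p) (dpos i j p (e, 0)) (dpos i j p (e, 0)))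
    = scal j (stpos i j p) - ric j (stpos i j p) (nor i j p) (nor i j p)"
proof -
  note q = track_domD(5)[OF p] and f = adapted_frame[OF p S]
  have "finite S" using S by (simp add: orthonormal_basis_def orthonormal_set_def)
  then show ?thesis
    unfolding scal_eq metric_trace_orthonormal_basis[OF inner_met[OF q] bilinear_ric[OF q] f(3)]
    using f(2) by (simp add: sum.reindex[OF f(1)])
qed

text \<open>In an adapted frame all tangential coefficients vanish. This yields uniqueness of the
  unit normal of the track.\<close>

lemma normal_direction:
  assumes p: "p \<in> track_dom i j" and v: "\<And>u. met j (stpos i j p) (dpos i j p (u, 0)) v = 0"
  shows "v = met j (stpos i j p) v (nor i j p) *\<^sub>R nor i j p"
proof -
  note q = track_domD(5)[OF p]
  obtain S where S: "orthonormal_basis (induced i j p) S"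
    using orthonormal_basis_exists[OF inner_induced[OF p]] .
  note f = adapted_frame[OF p S]
  have "finite S" using S by (simp add: orthonormal_basis_def orthonormal_set_def)
  moreover have "met j (stpos i j p) v (dpos i j p (u, 0)) = 0" for u
    using v inner_formD(2)[OF inner_met[OF q]] by metis
  ultimately show ?thesis
    using orthonormal_basis_expand[OF bilinear_met[OF q] f(3), of v] f(2)
    by (simp add: sum.reindex[OF f(1)])
qed

section \<open>Mean curvature at a fixed time\<close>

lemma deriv_rep_deriv_slice:
  assumes "(u, \<tau>) \<in> track_dom i j"
  shows "deriv_within (rep_dom A B (F \<tau>) i j) (\<lambda>y. rep_deriv A B (F \<tau>) i j y v) u w
    = ddpos i j (u, \<tau>) (v, 0) (w, 0)"
proof -
  have \<tau>: "\<tau> \<in> {0<..T}" using assms track_domD by fastforce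
  have "frechet_derivative (\<lambda>y. rep_deriv A B (F \<tau>) i j y v) (at u within {u. (u, \<tau>) \<in> track_dom i j})
      = frechet_derivative (\<lambda>y. dpos i j (y, \<tau>) (v, 0)) (at u within {u. (u, \<tau>) \<in> track_dom i j})"
    using assms by (intro deriv_within_cong) (auto simp: rep_deriv_slice)
  also have "\<dots> = (\<lambda>w. ddpos i j (u, \<tau>) (v, 0) (w, 0))"
    using assms has_derivative_space_slice[OF has_derivative_dpos[OF assms, of "(v, 0)"],
        of "{u. (u, \<tau>) \<in> track_dom i j}"]
    by (intro deriv_within_eq accessible_space_slice track_dom_accessible) auto
  finally show ?thesis unfolding rep_dom_slice[OF \<tau>] by simp
qed

lemma deriv_rep_deriv_track:
  assumes "p \<in> track_dom i j"
  shows "deriv_within (track_dom i j)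
      (\<lambda>y. rep_deriv (prod_atlas T A) (prod_atlas T B) (track F) i j y z) p w = (ddpos i j p z w, 0)"
proof -
  have "frechet_derivative (\<lambda>y. rep_deriv (prod_atlas T A) (prod_atlas T B) (track F) i j y z)
        (at p within track_dom i j)
      = frechet_derivative (\<lambda>y. (dpos i j y z, snd z)) (at p within track_dom i j)"
    by (rule deriv_within_cong[OF _ assms]) (simp add: rep_deriv_track)
  also have "\<dots> = (\<lambda>w. (ddpos i j p z w, 0))"
    by (intro deriv_within_eq track_dom_accessible assms has_derivative_Pair
        has_derivative_dpos has_derivative_const)
  finally show ?thesis by simp
qed

lemma at_chart:
  assumes "x \<in> cdom A i"
  shows "pos i j (cmap A i x, \<tau>) = cmap B j (F \<tau> x)" "nor i j (cmap A i x, \<tau>) = \<nu> \<tau> x j"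
    "lmean i (cmap A i x, \<tau>) = mean \<tau> x"
  using assms by (simp_all add: pos_def nor_def lmean_def)

text \<open>A trace in an orthonormal basis needs diagonal values only, and on the diagonal two of
  the three Koszul terms coincide.\<close>

lemma sff_space:
  assumes x: "x \<in> cdom A i" and p: "p \<in> track_dom i j" "p = (cmap A i x, \<tau>)"
  shows "second_fundamental_form A B (g \<tau>) (F \<tau>) (\<nu> \<tau>) i j x u u =
    - met j (stpos i j p) (ddpos i j p (u, 0) (u, 0)) (nor i j p)
    - dmet j (stpos i j p) (dpos i j p (u, 0)) (nor i j p) (dpos i j p (u, 0), 0)
    + dmet j (stpos i j p) (dpos i j p (u, 0)) (dpos i j p (u, 0)) (nor i j p, 0) / 2"
proof -
  have \<tau>: "\<tau> \<in> {0<..T}" and y: "cmap B j (F \<tau> x) \<in> cimg B j"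
    using track_domD[OF p(1)] p(2) at_chart[OF x] by auto
  interpret patch: metric_patch "cimg B j" "g \<tau> j" by (rule metric_patch_slice[OF \<tau>])
  have q: "(cmap B j (F \<tau> x), \<tau>) = stpos i j p" and n: "\<nu> \<tau> x j = nor i j p"
    by (simp_all add: p(2) at_chart[OF x])
  have G: "g \<tau> j (cmap B j (F \<tau> x)) v w = met j (stpos i j p) v w" for v w
    unfolding q[symmetric] by (simp add: met_def)
  have r: "rep_deriv A B (F \<tau>) i j (cmap A i x) u = dpos i j p (u, 0)"
    and d: "deriv_within (rep_dom A B (F \<tau>) i j) (\<lambda>y. rep_deriv A B (F \<tau>) i j y u) (cmap A i x) u
      = ddpos i j p (u, 0) (u, 0)"
    using rep_deriv_slice deriv_rep_deriv_slice p(1) unfolding p(2) by blast+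
  have "second_fundamental_form A B (g \<tau>) (F \<tau>) (\<nu> \<tau>) i j x u u =
      - met j (stpos i j p) (ddpos i j p (u, 0) (u, 0)) (nor i j p)
      - g \<tau> j (cmap B j (F \<tau> x)) (christoffel (cimg B j) (g \<tau> j) (cmap B j (F \<tau> x))
        (dpos i j p (u, 0)) (dpos i j p (u, 0))) (nor i j p)"
    using second_fundamental_form_eq[of "g \<tau>" j B "F \<tau>" x A i "\<nu> \<tau>" u u, OF patch.bilinear_G[OF y]]
    unfolding r d G n by (simp add: rep_slice at_chart[OF x])
  then show ?thesis
    unfolding patch.metric_christoffel[OF y] dmet_slice[OF y \<tau>] q by argo
qed

lemma bilinear_sff_space:
  assumes x: "x \<in> cdom A i" and p: "(cmap A i x, \<tau>) \<in> track_dom i j"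
  shows "bilinear (second_fundamental_form A B (g \<tau>) (F \<tau>) (\<nu> \<tau>) i j x)"
proof (rule bilinear_second_fundamental_form)
  have \<tau>: "\<tau> \<in> {0<..T}" using track_domD[OF p] by simp
  show "metric_patch (cimg B j) (g \<tau> j)" by (rule metric_patch_slice[OF \<tau>])
  show "axis_accessible (rep_dom A B (F \<tau>) i j)"
    unfolding rep_dom_slice[OF \<tau>] by (rule accessible_space_slice[OF track_dom_accessible])
  show "cmap A i x \<in> rep_dom A B (F \<tau>) i j" using p by (simp add: rep_dom_slice[OF \<tau>])
  show "smooth_on (rep_dom A B (F \<tau>) i j) (rep A B (F \<tau>) i j)"
    using immersions \<tau> by (simp add: smooth_immersion_family_def smooth_immersion_def smooth_map_def)
  show "cmap B j (F \<tau> x) \<in> cimg B j" "cmap B j (F \<tau> x) = rep A B (F \<tau>) i j (cmap A i x)"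
    using track_domD[OF p] x by (auto simp: rep_def B.cmap_in_cimg)
qed

text \<open>The charts are those of \<open>chart_at\<close> because \<open>mean_curvature\<close> is
  defined in them.\<close>

lemma mean_eq:
  assumes \<tau>: "\<tau> \<in> {0<..T}"
    and ij: "i = chart_at A x" "j = chart_at B (F \<tau> x)" and p: "p = (cmap A i x, \<tau>)"
    and S: "orthonormal_basis (induced i j p) S"
  shows "(\<Sum>e\<in>S. second_fundamental_form A B (g \<tau>) (F \<tau>) (\<nu> \<tau>) i j x e e) = mean \<tau> x"
proof -
  have x: "x \<in> cdom A i" unfolding ij by (rule A.chart_at_in)
  have pd: "p \<in> track_dom i j"
    unfolding p using chart_in_track_dom[OF x \<tau>] ij B.chart_at_in by blast
  have "induced_metric A B (g \<tau>) (F \<tau>) i j x = induced i j p"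
    using rep_deriv_slice[OF pd[unfolded p]] x
    by (auto simp: induced_metric_def induced_def met_def p at_chart fun_eq_iff)
  then have "mean \<tau> x = metric_trace (induced i j p) (second_fundamental_form A B (g \<tau>) (F \<tau>) (\<nu> \<tau>) i j x)"
    by (simp add: mean_def mean_curvature_def Let_def ij)
  then show ?thesis
    using metric_trace_orthonormal_basis[OF inner_induced[OF pd] bilinear_sff_space[OF x pd[unfolded p]] S]
    by simp
qed

end

context flow_track
begin

definition scalp :: "real \<Rightarrow> 'm \<Rightarrow> real" where
  "scalp \<tau> x = scal (chart_at B (F \<tau> x)) (cmap B (chart_at B (F \<tau> x)) (F \<tau> x), \<tau>)"

lemma scalp_eq:
  "F \<tau> x \<in> cdom B j \<Longrightarrow> \<tau> \<in> {0<..T} \<Longrightarrow> scalp \<tau> x = scal j (cmap B j (F \<tau> x), \<tau>)"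
  unfolding scalp_def by (rule scal_transition[OF _ B.chart_at_in])

end

lemma track_at [simp]: "track F (x, \<tau>) = (F \<tau> x, \<tau>)"
  by (simp add: track_def)

section \<open>Normal and mean curvature of the track\<close>

locale flow_track_lapse = flow_track A B T g F \<nu>
  for A :: "('i, 'm::{t2_space, second_countable_topology}, 'e::euclidean_space) atlas"
    and B :: "('j, 'o::{t2_space, second_countable_topology}, 'f::euclidean_space) atlas"
    and T :: real and g :: "real \<Rightarrow> ('j, 'f) metric"
    and F :: "real \<Rightarrow> 'm \<Rightarrow> 'o" and \<nu> :: "real \<Rightarrow> 'm \<Rightarrow> 'j \<Rightarrow> 'f" +
  fixes N :: real
  assumes lapse_positive: "\<And>j p. p \<in> cimg B j \<times> {0<..T} \<Longrightarrow> 0 < N + scal j p"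
begin

text \<open>The coefficient of the squared time differential, hence the square of what is usually
  called the lapse.\<close>

definition lapse :: "real \<Rightarrow> 'm \<Rightarrow> real" where
  "lapse \<tau> x = N + scalp \<tau> x"

definition tilt :: "real \<Rightarrow> 'm \<Rightarrow> real" where
  "tilt \<tau> x = mean \<tau> x / lapse \<tau> x"

text \<open>The length of the unnormalised normal, with spatial part \<nu> and time part
  \<open>tilt\<close>.\<close>

definition speed :: "real \<Rightarrow> 'm \<Rightarrow> real" where
  "speed \<tau> x = sqrt (1 + (mean \<tau> x)\<^sup>2 / lapse \<tau> x)"

text \<open>The value 0 follows the convention of \<open>tangent_vector\<close>; without it the
  vector would not be the one singled out by the definite description in
  \<open>track_normal\<close>.\<close>

definition tnor :: "real \<Rightarrow> 'm \<Rightarrow> 'j \<Rightarrow> 'f \<times> real" where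
  "tnor \<tau> x j = (if F \<tau> x \<in> cdom B j then (1 / speed \<tau> x) *\<^sub>R (\<nu> \<tau> x j, tilt \<tau> x) else 0)"

lemma lapse_pos:
  assumes "\<tau> \<in> {0<..T}" shows "0 < lapse \<tau> x"
  using lapse_positive B.cmap_in_cimg[OF B.chart_at_in] assms by (simp add: lapse_def scalp_def)

lemma speed_ge_1: "\<tau> \<in> {0<..T} \<Longrightarrow> speed \<tau> x \<ge> 1"
  using lapse_pos[of \<tau> x] by (simp add: speed_def)

lemma speed_square: "\<tau> \<in> {0<..T} \<Longrightarrow> (speed \<tau> x)\<^sup>2 = 1 + (mean \<tau> x)\<^sup>2 / lapse \<tau> x"
  using lapse_pos[of \<tau> x] by (simp add: speed_def add_nonneg_nonneg)

end

locale flow_point = flow_track_lapse A B T g F \<nu> N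
  for A :: "('i, 'm::{t2_space, second_countable_topology}, 'e::euclidean_space) atlas"
    and B :: "('j, 'o::{t2_space, second_countable_topology}, 'f::euclidean_space) atlas"
    and T :: real and g :: "real \<Rightarrow> ('j, 'f) metric"
    and F :: "real \<Rightarrow> 'm \<Rightarrow> 'o" and \<nu> :: "real \<Rightarrow> 'm \<Rightarrow> 'j \<Rightarrow> 'f" and N :: real +
  fixes i :: 'i and j :: 'j and x :: 'm and \<tau> :: real
  assumes x: "x \<in> cdom A i" and y: "F \<tau> x \<in> cdom B j" and \<tau>: "\<tau> \<in> {0<..T}"
begin

abbreviation "pt \<equiv> (cmap A i x, \<tau>)"
abbreviation "st \<equiv> (pos i j pt, \<tau>)"
abbreviation "n \<equiv> nor i j pt"
abbreviation "H \<equiv> mean \<tau> x"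
abbreviation "L \<equiv> lapse \<tau> x"
abbreviation "b \<equiv> tilt \<tau> x"
abbreviation "s \<equiv> speed \<tau> x"

lemma pt: "pt \<in> track_dom i j"
  by (rule chart_in_track_dom[OF x \<tau> y])

lemmas st = track_domD(5)[OF pt, unfolded snd_conv]
lemmas n_tangent = nor_tangent[OF pt, unfolded snd_conv]

lemma st_eq: "pos i j pt = cmap B j (F \<tau> x)" and n_eq: "n = \<nu> \<tau> x j" and lmean_pt: "lmean i pt = H"
  by (simp_all add: at_chart[OF x])

lemma lapse_eq: "N + scal j st = L"
  using scalp_eq[OF y \<tau>] by (simp add: lapse_def st_eq)

lemma pos: "L > 0" "s > 0"
  using lapse_pos[OF \<tau>] speed_ge_1[OF \<tau>, of x] by auto

lemma tilt_lapse: "L * b = H"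
  using pos by (simp add: tilt_def)

lemma tnor_eq: "tnor \<tau> x j = ((1 / s) *\<^sub>R n, b / s)"
  using y by (simp add: tnor_def n_eq)

lemma stmet_track_vector:
  "stmet N j st (dpos i j pt w, snd w) z
    = met j st (dpos i j pt (fst w, 0)) (fst z) + snd w * (L * snd z - H * met j st n (fst z))"
  unfolding stmet_eq dpos_eq[OF pt, of w] lapse_eq
  by (simp add: bilinear_simps[OF bilinear_met[OF st]] lmean_pt algebra_simps)

lemma stmet_normal:
  "stmet N j st (dpos i j pt w, snd w) (tnor \<tau> x j) = 0"
  "stmet N j st (tnor \<tau> x j) (tnor \<tau> x j) = 1"
  "stmet N j st (tnor \<tau> x j) (\<nu> \<tau> x j, 0) > 0"
proof -
  note b = bilinear_simps[OF bilinear_met[OF st]] and n = n_tangent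
  show "stmet N j st (dpos i j pt w, snd w) (tnor \<tau> x j) = 0"
    using tilt_lapse by (simp add: stmet_track_vector tnor_eq b n)
  have "stmet N j st (tnor \<tau> x j) (tnor \<tau> x j) = (1 + (L * b) * b) / s\<^sup>2"
    by (simp add: stmet_eq tnor_eq b n lapse_eq power2_eq_square add_divide_distrib ac_simps)
  also have "\<dots> = 1"
    unfolding speed_square[OF \<tau>] tilt_lapse using pos(1)
    by (simp add: tilt_def power2_eq_square add_nonneg_eq_0_iff)
  finally show "stmet N j st (tnor \<tau> x j) (tnor \<tau> x j) = 1" .
  show "stmet N j st (tnor \<tau> x j) (\<nu> \<tau> x j, 0) > 0"
    using pos by (simp add: stmet_eq tnor_eq n_eq[symmetric] b n del: n_eq)
qed

text \<open>Orthogonality to the spatial tangent vectors makes the spatial part a multiple of the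
  normal, orthogonality to the image of the time direction fixes the time part, unit length fixes
  the factor up to sign, and the chosen side fixes the sign.\<close>

lemma stmet_normal_unique:
  assumes orth: "\<And>w. stmet N j st (dpos i j pt w, snd w) z = 0"
    and unit: "stmet N j st z z = 1" and side: "stmet N j st z (\<nu> \<tau> x j, 0) > 0"
  shows "z = tnor \<tau> x j"
proof -
  note bil = bilinear_simps[OF bilinear_met[OF st]]
  define l where "l = met j st (fst z) n"
  have "met j st (dpos i j pt (u, 0)) (fst z) = 0" for u
    using orth[of "(u, 0)"] unfolding stmet_track_vector by simp
  from normal_direction[OF pt, unfolded snd_conv, OF this] have 1: "fst z = l *\<^sub>R n" by (simp add: l_def)
  have "met j st n (fst z) = l" using n_tangent(1) by (simp add: 1 bil)
  then have "L * snd z = H * l"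
    using orth[of "(0, 1)"] linear_0[OF linear_dpos_space[OF pt]] unfolding stmet_track_vector
    by (simp add: bil)
  then have 2: "snd z = l * b" using pos(1) by (simp add: tilt_def field_simps)
  have "1 = l\<^sup>2 * (1 + (L * b) * b)"
    using unit n_tangent(1)
    by (simp add: stmet_eq 1 2 bil lapse_eq power2_eq_square algebra_simps)
  also have "1 + (L * b) * b = s\<^sup>2"
    unfolding speed_square[OF \<tau>] tilt_lapse by (simp add: tilt_def power2_eq_square)
  finally have "(l * s)\<^sup>2 = 1" by (simp add: power_mult_distrib)
  moreover have "l > 0" using side by (simp add: stmet_eq l_def n_eq)
  ultimately have "l * s = 1" using pos(2) by (simp add: power2_eq_1_iff) (smt (verit) mult_pos_pos)
  then have "l = 1 / s" using pos(2) by (simp add: field_simps)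
  then show ?thesis using 1 2 by (simp add: tnor_eq prod_eq_iff)
qed

end

context flow_track_lapse
begin

lemma track_normal_eq:
  assumes \<tau>: "\<tau> \<in> {0<..T}"
  shows "track_normal T A B g F \<nu> N (x, \<tau>) = tnor \<tau> x"
proof -
  have point: "flow_point A B T g F \<nu> N i j x \<tau>" if "x \<in> cdom A i" "F \<tau> x \<in> cdom B j" for i j
    using that \<tau> by unfold_locales
  \<comment> \<open>\<open>speed\<close> and \<open>tilt\<close> carry no chart index and coordinate
    changes fix the time component, so the transformation law is inherited from
    \<open>\<nu>\<close>.\<close>
  have tangent: "tangent_vector (prod_atlas T B) (F \<tau> x, \<tau>) (tnor \<tau> x)"
    unfolding tangent_vector_def
  proof (intro conjI allI impI)
    fix j k assume "(F \<tau> x, \<tau>) \<in> cdom (prod_atlas T B) j \<and> (F \<tau> x, \<tau>) \<in> cdom (prod_atlas T B) k"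
    then have jk: "F \<tau> x \<in> cdom B j" "F \<tau> x \<in> cdom B k" by auto
    have "tangent_vector B (F \<tau> x) (\<nu> \<tau> x)"
      using normals \<tau> by (simp add: smooth_unit_normal_family_def unit_normal_def)
    then have "\<nu> \<tau> x k = transition B j k (F \<tau> x) (\<nu> \<tau> x j)"
      using jk unfolding tangent_vector_def by blast
    moreover have "linear (transition B j k (F \<tau> x))"
      using has_derivative_bounded_linear[OF B.has_derivative_transition[OF jk]] bounded_linear.linear by blast
    ultimately show "tnor \<tau> x k = transition (prod_atlas T B) j k (F \<tau> x, \<tau>) (tnor \<tau> x j)"
      unfolding B.transition_prod_atlas[OF jk \<tau>] using jk by (simp add: tnor_def linear_cmul)
  qed (use \<tau> in \<open>auto simp: tnor_def zero_prod_def\<close>)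
  show ?thesis
    unfolding track_normal_def prod.case
  proof (rule the_equality)
    show "unit_normal (prod_atlas T A) (prod_atlas T B) (stmet N) (track F) (x, \<tau>) (tnor \<tau> x) \<and>
        (\<forall>j. F \<tau> x \<in> cdom B j \<longrightarrow> stmet N j (cmap B j (F \<tau> x), \<tau>) (tnor \<tau> x j) (\<nu> \<tau> x j, 0) > 0)"
    proof (intro conjI allI impI)
      show "unit_normal (prod_atlas T A) (prod_atlas T B) (stmet N) (track F) (x, \<tau>) (tnor \<tau> x)"
        unfolding unit_normal_def
      proof (intro conjI allI impI)
        show "tangent_vector (prod_atlas T B) (track F (x, \<tau>)) (tnor \<tau> x)"
          using tangent by (simp add: track_at)
        fix i j assume "(x, \<tau>) \<in> cdom (prod_atlas T A) i \<and> track F (x, \<tau>) \<in> cdom (prod_atlas T B) j"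
        then interpret flow_point A B T g F \<nu> N i j x \<tau> by (intro point) (auto simp: track_at)
        show "stmet N j (cmap (prod_atlas T B) j (track F (x, \<tau>))) (tnor \<tau> x j) (tnor \<tau> x j) = 1"
          using stmet_normal(2) by (simp add: track_at st_eq)
        show "stmet N j (cmap (prod_atlas T B) j (track F (x, \<tau>)))
          (rep_deriv (prod_atlas T A) (prod_atlas T B) (track F) i j (cmap (prod_atlas T A) i (x, \<tau>)) w)
          (tnor \<tau> x j) = 0" for w
          using stmet_normal(1) rep_deriv_track[OF pt] by (simp add: track_at st_eq)
      qed
      fix j assume "F \<tau> x \<in> cdom B j"
      then interpret flow_point A B T g F \<nu> N "chart_at A x" j x \<tau> by (intro point A.chart_at_in)
      show "stmet N j (cmap B j (F \<tau> x), \<tau>) (tnor \<tau> x j) (\<nu> \<tau> x j, 0) > 0"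
        using stmet_normal(3) by (simp add: st_eq)
    qed
  next
    fix w
    assume w: "unit_normal (prod_atlas T A) (prod_atlas T B) (stmet N) (track F) (x, \<tau>) w \<and>
        (\<forall>j. F \<tau> x \<in> cdom B j \<longrightarrow> stmet N j (cmap B j (F \<tau> x), \<tau>) (w j) (\<nu> \<tau> x j, 0) > 0)"
    show "w = tnor \<tau> x"
    proof
      fix j
      show "w j = tnor \<tau> x j"
      proof (cases "F \<tau> x \<in> cdom B j")
        case True
        let ?i = "chart_at A x"
        interpret flow_point A B T g F \<nu> N ?i j x \<tau> by (rule point[OF A.chart_at_in True])
        have "(x, \<tau>) \<in> cdom (prod_atlas T A) ?i \<and> track F (x, \<tau>) \<in> cdom (prod_atlas T B) j"
          using x y \<tau> by (simp add: track_at)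
        from conjunct1[OF w, unfolded unit_normal_def, THEN conjunct2, rule_format, OF this]
        have u: "stmet N j st (w j) (w j) = 1"
          "stmet N j st (rep_deriv (prod_atlas T A) (prod_atlas T B) (track F) ?i j pt v) (w j) = 0" for v
          by (simp_all add: track_at st_eq del: split_paired_All)
        show ?thesis
          using u w True by (intro stmet_normal_unique) (simp_all add: rep_deriv_track[OF pt] st_eq)
      next
        \<comment> \<open>In charts away from the point both families are 0 by convention.\<close>
        case False
        have "tangent_vector (prod_atlas T B) (F \<tau> x, \<tau>) w"
          using w by (simp add: unit_normal_def track_at)
        from this[unfolded tangent_vector_def, THEN conjunct2, rule_format, of j] False
        show ?thesis by (simp add: tnor_def)
      qed
    qed
  qed
qed

end

section \<open>Second fundamental form and mean curvature of the track\<close>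

context flow_point
begin

abbreviation "sff \<equiv> second_fundamental_form A B (g \<tau>) (F \<tau>) (\<nu> \<tau>) i j x"
abbreviation "stsff \<equiv> second_fundamental_form (prod_atlas T A) (prod_atlas T B) (stmet N) (track F)
  (track_normal T A B g F \<nu> N) i j (x, \<tau>)"
abbreviation "\<rho> \<equiv> ric j st n n"

lemma bilinear_stsff: "bilinear stsff"
proof (rule bilinear_second_fundamental_form)
  show "metric_patch (cimg (prod_atlas T B) j) (stmet N j)"
    using metric_patch_stmet[OF lapse_positive] by simp
  show "axis_accessible (rep_dom (prod_atlas T A) (prod_atlas T B) (track F) i j)"
    unfolding rep_dom_track by (rule track_dom_accessible)
  show "cmap (prod_atlas T A) i (x, \<tau>) \<in> rep_dom (prod_atlas T A) (prod_atlas T B) (track F) i j"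
    using pt by (simp add: rep_dom_track)
  show "smooth_on (rep_dom (prod_atlas T A) (prod_atlas T B) (track F) i j)
      (rep (prod_atlas T A) (prod_atlas T B) (track F) i j)"
    unfolding rep_dom_track by (rule smooth_rep_track)
  show "cmap (prod_atlas T B) j (track F (x, \<tau>)) \<in> cimg (prod_atlas T B) j"
    using st by (simp add: track_at st_eq)
  show "cmap (prod_atlas T B) j (track F (x, \<tau>))
      = rep (prod_atlas T A) (prod_atlas T B) (track F) i j (cmap (prod_atlas T A) i (x, \<tau>))"
    using rep_track[OF pt, unfolded snd_conv] by (simp add: track_at st_eq)
qed

text \<open>The Koszul formula for the space-time metric. Every term is linear in the unit normal,
  so \<open>1 / s\<close> factors out.\<close>

lemma stsff_eq:
  "stsff w w = - (met j st (ddpos i j pt w w) n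
      + dmet j st (dpos i j pt w) n (dpos i j pt w, snd w) + snd w * b * dscal j st (dpos i j pt w, snd w)
      - (dmet j st (dpos i j pt w) (dpos i j pt w) (n, b) + (snd w)\<^sup>2 * dscal j st (n, b)) / 2) / s"
proof -
  interpret patch: metric_patch "slab j" "stmet N j" by (rule metric_patch_stmet[OF lapse_positive])
  let ?V = "(dpos i j pt w, snd w)" and ?Z = "((1 / s) *\<^sub>R n, b / s)"
  have c: "cmap (prod_atlas T B) j (track F (x, \<tau>)) = st" by (simp add: track_at st_eq)
  have c': "cmap (prod_atlas T A) i (x, \<tau>) = pt" by simp
  have bil: "bilinear (stmet N j (cmap (prod_atlas T B) j (track F (x, \<tau>))))"
    unfolding c by (rule patch.bilinear_G[OF st])
  have r: "cmap (prod_atlas T B) j (track F (x, \<tau>))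
      = rep (prod_atlas T A) (prod_atlas T B) (track F) i j (cmap (prod_atlas T A) i (x, \<tau>))"
    unfolding c c' rep_track[OF pt, unfolded snd_conv] ..
  have Z: "track_normal T A B g F \<nu> N (x, \<tau>) j = ?Z"
    by (simp add: track_normal_eq[OF \<tau>] tnor_eq)
  have "stsff w w = - stmet N j st (ddpos i j pt w w, 0) ?Z
      - stmet N j st (christoffel (slab j) (stmet N j) st ?V ?V) ?Z"
    unfolding second_fundamental_form_eq[of "stmet N" j "prod_atlas T B" "track F" "(x, \<tau>)"
        "prod_atlas T A" i "track_normal T A B g F \<nu> N" w w, OF bil r]
    unfolding c c' Z rep_dom_track cimg_prod_atlas deriv_rep_deriv_track[OF pt] rep_deriv_track[OF pt] ..
  also have "\<dots> = - met j st (ddpos i j pt w w) ((1 / s) *\<^sub>R n)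
     - (2 * (dmet j st (dpos i j pt w) ((1 / s) *\<^sub>R n) ?V + snd w * (b / s) * dscal j st ?V)
       - (dmet j st (dpos i j pt w) (dpos i j pt w) ?Z + snd w * snd w * dscal j st ?Z)) / 2"
    unfolding patch.metric_christoffel[OF st] dstmet[OF st] by (simp add: stmet_eq)
  also have "?Z = (1 / s) *\<^sub>R (n, b)" by simp
  finally show ?thesis
    using pos(2)
    by (simp only: bilinear_rmul[OF bilinear_met[OF st]] bilinear_rmul[OF bilinear_dmet[OF st]]
        linear_cmul[OF linear_dmet[OF st]] linear_cmul[OF linear_dscal[OF st]])
      (simp add: field_simps power2_eq_square)
qed

text \<open>The Ricci term comes from the time component \<open>b\<close> of the normal, in whose
  direction the metric is differentiated; the other terms are those of
  \<open>sff_space\<close>.\<close>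

lemma stsff_space: "stsff (u, 0) (u, 0) = (sff u u + b * ric j st (dpos i j pt (u, 0)) (dpos i j pt (u, 0))) / s"
  using dmet_split[OF st, of "dpos i j pt (u, 0)" "dpos i j pt (u, 0)" 1 n b]
  by (simp add: stsff_eq sff_space[OF x pt refl, unfolded snd_conv] algebra_simps)

lemma dmet_nor: "dmet j st (a *\<^sub>R n) (c *\<^sub>R n) (k *\<^sub>R n, l) = a * c * (k * dmet j st n n (n, 0) + 2 * l * \<rho>)"
proof -
  note bil = bilinear_lmul[OF bilinear_dmet[OF st]] bilinear_rmul[OF bilinear_dmet[OF st]]
  show ?thesis by (simp add: bil dmet_split[OF st] bilinear_simps[OF bilinear_ric[OF st]])
qed

text \<open>The chart-dependent term \<open>?\<delta>\<close> enters three times: from the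
  acceleration by way of \<open>nor_derivative\<close>, and from the two metric derivatives of the
  Koszul formula. Its coefficients are one half, minus one and one half of \<open>H\<^sup>2\<close>,
  so it cancels.\<close>

lemma stsff_time:
  "stsff (0, 1) (0, 1) = (dlmean i j pt (0, 1) + H * \<rho> + dscal j st (n, 0) / 2
    + b * (H * dscal j st (n, 0) - dscal j st (0, 1) / 2 + H\<^sup>2 * \<rho>)) / s"
proof -
  let ?\<delta> = "dmet j st n n (n, 0)"
  have v: "dpos i j pt (0, 1) = (- H) *\<^sub>R n" using velocity[OF pt] by (simp add: lmean_pt)
  have "dmet j st n n ((- H) *\<^sub>R n, 1) + 2 * met j st (dnor i j pt (0, 1)) n = 0"
    using nor_derivative[OF pt, of "(0, 1)", unfolded snd_conv] v by simp
  then have m: "met j st (dnor i j pt (0, 1)) n = H * ?\<delta> / 2 - \<rho>"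
    using dmet_nor[of 1 1 "- H" 1] by simp
  have 1: "met j st (ddpos i j pt (0, 1) (0, 1)) n = - dlmean i j pt (0, 1) - H * (H * ?\<delta> / 2 - \<rho>)"
    unfolding acceleration[OF pt]
    by (simp add: bilinear_simps[OF bilinear_met[OF st]] n_tangent(1) lmean_pt m)
  have 2: "dmet j st ((- H) *\<^sub>R n) n ((- H) *\<^sub>R n, 1) = (- H) * ((- H) * ?\<delta> + 2 * \<rho>)"
    using dmet_nor[of "- H" 1 "- H" 1] by simp
  have 3: "dmet j st ((- H) *\<^sub>R n) ((- H) *\<^sub>R n) (n, b) = H * H * (?\<delta> + 2 * b * \<rho>)"
    using dmet_nor[of "- H" "- H" 1 b] by simp
  have 4: "dscal j st ((- H) *\<^sub>R n, 1) = (- H) * dscal j st (n, 0) + dscal j st (0, 1)"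
    "dscal j st (n, b) = dscal j st (n, 0) + b * dscal j st (0, 1)"
    using linear_pair_split[OF linear_dscal[OF st], of "- H" n 1]
      linear_pair_split[OF linear_dscal[OF st], of 1 n b] by simp_all
  show ?thesis
    unfolding stsff_eq v snd_conv 1 2 3 4 using pos(2) by (simp add: field_simps power2_eq_square)
qed

text \<open>The velocity is normal to the hypersurface, so the image of the time direction is
  orthogonal to the spatial tangent vectors. The induced metric therefore splits, and so does the
  trace.\<close>

lemma mean_curvature_track:
  assumes ij: "i = chart_at A x" "j = chart_at B (F \<tau> x)"
  shows "mean_curvature (prod_atlas T A) (prod_atlas T B) (stmet N) (track F)
      (track_normal T A B g F \<nu> N) (x, \<tau>)
    = (H + b * (scal j st - \<rho>)) / s + stsff (0, 1) (0, 1) / (L + H\<^sup>2)"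
proof -
  let ?I = "\<lambda>w z. induced i j pt (fst w) (fst z) + (L + H\<^sup>2) * snd w * snd z"
  have metric: "induced_metric (prod_atlas T A) (prod_atlas T B) (stmet N) (track F) i j (x, \<tau>) = ?I"
  proof (intro ext)
    fix w z
    have *: "met j st n (dpos i j pt (u, 0)) = 0" for u
      using n_tangent(2) inner_formD(2)[OF inner_met[OF st]] by metis
    have "induced_metric (prod_atlas T A) (prod_atlas T B) (stmet N) (track F) i j (x, \<tau>) w z
        = stmet N j st (dpos i j pt w, snd w) (dpos i j pt z, snd z)"
      by (simp add: induced_metric_def rep_deriv_track[OF pt] track_at st_eq)
    also have "\<dots> = ?I w z"
      unfolding stmet_track_vector fst_conv snd_conv dpos_eq[OF pt, of z]
      by (simp add: bilinear_simps[OF bilinear_met[OF st]] n_tangent * lmean_pt induced_def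
          algebra_simps power2_eq_square)
    finally show "induced_metric (prod_atlas T A) (prod_atlas T B) (stmet N) (track F) i j (x, \<tau>) w z = ?I w z" .
  qed
  note ind = inner_formD[OF inner_induced[OF pt]]
  have LH: "L + H\<^sup>2 > 0" using pos(1) by (simp add: add_pos_nonneg)
  have inner: "inner_form ?I"
    unfolding inner_form_def
  proof (intro conjI allI impI)
    show "bilinear ?I"
      unfolding bilinear_def
      by (intro conjI allI linearI) (simp_all add: bilinear_simps[OF ind(1)] algebra_simps)
    fix w z :: "'e \<times> real"
    show "?I w z = ?I z w" using ind(2)[of "fst w" "fst z"] by simp
    assume "w \<noteq> 0"
    then consider "fst w \<noteq> 0" | "snd w \<noteq> 0" by (auto simp: prod_eq_iff)
    then show "?I w w > 0"
    proof cases
      case 1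
      then show ?thesis using ind(3)[of "fst w"] LH by (simp add: mult.assoc add_pos_nonneg)
    next
      case 2
      then have "(L + H\<^sup>2) * (snd w * snd w) > 0" using LH by (simp add: zero_less_mult_iff) linarith
      then show ?thesis using ind(4)[of "fst w"] by (simp add: mult.assoc)
    qed
  qed
  obtain S where S: "orthonormal_basis (induced i j pt) S"
    using orthonormal_basis_exists[OF inner_induced[OF pt]] .
  \<comment> \<open>The time direction scaled to unit length in \<open>?I\<close>; it completes the
    spatial basis to an orthonormal one.\<close>
  let ?t = "(0, 1 / sqrt (L + H\<^sup>2))"
  let ?S = "insert ?t ((\<lambda>e. (e, 0)) ` S)"
  have inj: "inj_on (\<lambda>e. (e, 0)) S" by (simp add: inj_on_def)
  have t: "?t \<notin> (\<lambda>e. (e, 0)) ` S" using LH by auto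
  have fin: "finite S" "card S = DIM('e)" using S by (auto simp: orthonormal_basis_def orthonormal_set_def)
  have "orthonormal_set ?I ?S"
    using S LH by (auto simp: orthonormal_basis_def orthonormal_set_def bilinear_simps[OF ind(1)])
  moreover have "card ?S = DIM('e \<times> real)" using t fin by (simp add: card_image[OF inj])
  ultimately have basis: "orthonormal_basis ?I ?S" by (simp add: orthonormal_basis_def)
  have eq: "?t = (1 / sqrt (L + H\<^sup>2)) *\<^sub>R (0::'e, 1)" by simp
  have "stsff ?t ?t = stsff (0, 1) (0, 1) / (L + H\<^sup>2)"
    using LH unfolding eq bilinear_lmul[OF bilinear_stsff] bilinear_rmul[OF bilinear_stsff] by simp
  then have "metric_trace ?I stsff = (\<Sum>e\<in>S. stsff (e, 0) (e, 0)) + stsff (0, 1) (0, 1) / (L + H\<^sup>2)"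
    using metric_trace_orthonormal_basis[OF inner bilinear_stsff basis] t fin(1)
    by (simp add: sum.reindex[OF inj])
  also have "(\<Sum>e\<in>S. stsff (e, 0) (e, 0))
      = ((\<Sum>e\<in>S. sff e e) + b * (\<Sum>e\<in>S. ric j st (dpos i j pt (e, 0)) (dpos i j pt (e, 0)))) / s"
    by (simp add: stsff_space sum.distrib sum_distrib_left sum_divide_distrib[symmetric])
  also have "\<dots> = (H + b * (scal j st - \<rho>)) / s"
    unfolding scal_trace[OF pt S, unfolded snd_conv] mean_eq[OF \<tau> ij refl S] ..
  finally show ?thesis
    unfolding mean_curvature_def Let_def chart_at_prod_atlas[OF \<tau>] track_at ij[symmetric]
    using metric by (simp add: track_at)
qed

text \<open>The scalar curvature appears twice, once in the trace over the spatial frame and once in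
  the drift term, where N is L minus the scalar curvature.\<close>

lemma soliton_error_eq:
  assumes ij: "i = chart_at A x" "j = chart_at B (F \<tau> x)"
  shows "soliton_error T A B g F \<nu> N (x, \<tau>) =
    (b * (2 * scal j st - \<rho>) + (dlmean i j pt (0, 1) + H * \<rho> + dscal j st (n, 0) / 2
      + b * (H * dscal j st (n, 0) - dscal j st (0, 1) / 2 + H\<^sup>2 * \<rho>)) / (L + H\<^sup>2)) / s"
proof -
  let ?f = "\<lambda>(y, \<tau>). - N * \<tau>"
  have "frechet_derivative (?f \<circ> cinv (prod_atlas T B) j) (at st within slab j)
      = frechet_derivative (\<lambda>p. - N * snd p) (at st within slab j)"
    by (rule deriv_within_cong[OF _ st]) (auto simp: B.cinv_prod_atlas)
  also have "\<dots> = (\<lambda>h. - N * snd h)"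
    by (intro deriv_within_eq slab_accessible st has_derivative_mult_right has_derivative_snd has_derivative_ident)
  finally have d: "frechet_derivative (?f \<circ> cinv (prod_atlas T B) j) (at st within slab j) = (\<lambda>h. - N * snd h)" .
  have "directional_deriv (prod_atlas T B) ?f (track F (x, \<tau>)) (track_normal T A B g F \<nu> N (x, \<tau>))
      = frechet_derivative (?f \<circ> cinv (prod_atlas T B) j) (at st within slab j) (tnor \<tau> x j)"
    unfolding directional_deriv_def track_at chart_at_prod_atlas[OF \<tau>] Let_def ij(2)[symmetric]
      track_normal_eq[OF \<tau>] cimg_prod_atlas cmap_prod_atlas fst_conv snd_conv st_eq ..
  then have D: "directional_deriv (prod_atlas T B) ?f (track F (x, \<tau>)) (track_normal T A B g F \<nu> N (x, \<tau>))
      = - N * (b / s)"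
    unfolding d by (simp add: tnor_eq)
  have "- (N * b) = scal j st * b - H"
    using tilt_lapse unfolding lapse_eq[symmetric] by (simp add: algebra_simps)
  then have M: "- N * (b / s) = (scal j st * b - H) / s" by (metis minus_mult_left times_divide_eq_right)
  show ?thesis
    unfolding soliton_error_def mean_curvature_track[OF ij] stsff_time D M
    by (simp add: add_divide_distrib diff_divide_distrib algebra_simps)
qed

end

section \<open>Boundedness on compact sets\<close>

context ricci_background
begin

text \<open>Both sides are derivatives of one function in two charts. They are compared within the
  overlap of the charts, where derivatives are still unique.\<close>

lemma dscal_transition:
  assumes q: "q \<in> cdom B i" "q \<in> cdom B j" and \<tau>: "\<tau> \<in> {0<..T}"
  shows "dscal i (cmap B i q, \<tau>) h = dscal j (cmap B j q, \<tau>) (transition B i j q (fst h), snd h)"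
proof -
  let ?K = "cmap B i ` (cdom B i \<inter> cdom B j)"
  let ?t = "\<lambda>(y, s). ((cmap B j \<circ> cinv B i) y, s)"
  let ?p = "(cmap B i q, \<tau>)"
  have p: "?p \<in> ?K \<times> {0<..T}" using q \<tau> by auto
  have sub: "?K \<times> {0<..T} \<subseteq> slab i" by (auto simp: B.cmap_in_cimg)
  have tsub: "?t ` (?K \<times> {0<..T}) \<subseteq> slab j" by (auto simp: B.cmap_in_cimg)
  have tp: "?t ?p = (cmap B j q, \<tau>)" using q by simp
  note acc = accessible_slab[OF B.open_chart_image[OF B.open_cdom]]
  have "(?t has_derivative (\<lambda>(u, a). (transition B i j q u, a))) (at ?p within ?K \<times> {0<..T})"
    by (rule has_derivative_slab_map[OF B.has_derivative_transition[OF q]])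
  moreover have "(scal j has_derivative dscal j (?t ?p)) (at (?t ?p) within ?t ` (?K \<times> {0<..T}))"
    using has_derivative_subset[OF has_derivative_scal tsub] p tsub by blast
  ultimately have "((\<lambda>p. scal j (?t p)) has_derivative
      (\<lambda>h. dscal j (?t ?p) ((\<lambda>(u, a). (transition B i j q u, a)) h))) (at ?p within ?K \<times> {0<..T})"
    by (rule has_derivative_in_compose)
  then have 1: "frechet_derivative (\<lambda>p. scal j (?t p)) (at ?p within ?K \<times> {0<..T})
      = (\<lambda>h. dscal j (?t ?p) ((\<lambda>(u, a). (transition B i j q u, a)) h))"
    by (rule deriv_within_eq[OF acc p])
  have "frechet_derivative (scal i) (at ?p within ?K \<times> {0<..T}) = dscal i ?p"
    by (rule deriv_within_eq[OF acc p has_derivative_subset[OF has_derivative_scal sub]])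
      (use p sub in blast)
  moreover have "scal i p' = scal j (?t p')" if "p' \<in> ?K \<times> {0<..T}" for p'
  proof -
    obtain y s where p': "p' = (y, s)" by (cases p')
    then have "y \<in> ?K" and s: "s \<in> {0<..T}" using that by simp_all
    then obtain q' where "y = cmap B i q'" "q' \<in> cdom B i" "q' \<in> cdom B j" by blast
    then show ?thesis using scal_transition[of q' i j s] s p' by simp
  qed
  then have "frechet_derivative (scal i) (at ?p within ?K \<times> {0<..T})
      = frechet_derivative (\<lambda>p. scal j (?t p)) (at ?p within ?K \<times> {0<..T})"
    using p by (rule deriv_within_cong)
  ultimately have "dscal i ?p = (\<lambda>h. dscal j (?t ?p) ((\<lambda>(u, a). (transition B i j q u, a)) h))"
    using 1 by simp
  from fun_cong[OF this, of h] show ?thesis unfolding tp by (simp add: case_prod_beta)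
qed

end

context flow_track
begin

lemma nor_transition:
  assumes "F \<tau> x \<in> cdom B i" "F \<tau> x \<in> cdom B j" "\<tau> \<in> {0<..T}"
  shows "\<nu> \<tau> x j = transition B i j (F \<tau> x) (\<nu> \<tau> x i)"
proof -
  have "tangent_vector B (F \<tau> x) (\<nu> \<tau> x)"
    using normals assms by (simp add: smooth_unit_normal_family_def unit_normal_def)
  then show ?thesis using assms unfolding tangent_vector_def by blast
qed

text \<open>Identifies the coordinate quantity as the time derivative at a fixed point of the
  manifold, which refers to no chart; this gives its chart independence.\<close>

lemma mean_time_derivative:
  assumes x: "x \<in> cdom A i" and y: "F \<tau> x \<in> cdom B j" and \<tau>: "\<tau> \<in> {0<..T}"
  shows "((\<lambda>s. mean s x) has_real_derivative dlmean i j (cmap A i x, \<tau>) (0, 1)) (at \<tau> within {0<..T})"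
proof -
  obtain W where W: "open W" "{(x, \<tau>). \<tau> \<in> {0<..T} \<and> F \<tau> x \<in> cdom B j} = (UNIV \<times> {0<..T}) \<inter> W"
    using openin_flow_preimage[OF B.open_cdom] by blast
  let ?U = "(\<lambda>s. (x, s)) -` W"
  have U: "open ?U" by (intro open_vimage W continuous_intros)
  have W_iff: "(x, s) \<in> W \<longleftrightarrow> F s x \<in> cdom B j" if "s \<in> {0<..T}" for s
    using W(2) that by (auto simp: set_eq_iff)
  note d = has_derivative_lmean[OF chart_in_track_dom[OF x \<tau> y]]
  have "((\<lambda>s. lmean i (cmap A i x, s)) has_real_derivative dlmean i j (cmap A i x, \<tau>) (0, 1))
      (at \<tau> within {0<..T} \<inter> ?U)"
    using W_iff by (intro has_real_derivative_time_slice[OF d] chart_in_track_dom[OF x]) auto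
  \<comment> \<open>Near \<tau> the point stays in chart \<open>j\<close>, so the restriction to
    \<open>?U\<close> does not change the derivative.\<close>
  moreover have "at \<tau> within {0<..T} \<inter> ?U = at \<tau> within {0<..T}"
    using W_iff[OF \<tau>] y by (intro at_within_nhd[OF _ U]) auto
  ultimately show ?thesis by (simp add: at_chart[OF x])
qed

text \<open>The agreement of \<open>f\<close> with \<open>\<psi>\<close> in all charts, not just in
  one per point, is what makes \<open>f\<close> continuous: one fixed pair of charts then represents
  it on a whole neighbourhood.\<close>

lemma bounded_on_compact:
  fixes f :: "real \<Rightarrow> 'm \<Rightarrow> real"
  assumes cont: "\<And>i j. continuous_on (track_dom i j) (\<psi> i j)"
    and chart: "\<And>i j x \<tau>. x \<in> cdom A i \<Longrightarrow> F \<tau> x \<in> cdom B j \<Longrightarrow> \<tau> \<in> {0<..T} \<Longrightarrow>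
      f \<tau> x = \<psi> i j (cmap A i x, \<tau>)"
    and K: "compact K" "K \<subseteq> UNIV \<times> {0<..T}"
  shows "\<exists>C. \<forall>(x, \<tau>)\<in>K. f \<tau> x \<le> C"
proof -
  let ?f = "\<lambda>p. f (snd p) (fst p)"
  have "continuous (at p within UNIV \<times> {0<..T}) ?f" if p: "p \<in> UNIV \<times> {0<..T}" for p
  proof -
    obtain x \<tau> where x: "p = (x, \<tau>)" "\<tau> \<in> {0<..T}" using p by (cases p) auto
    let ?i = "chart_at A x" and ?j = "chart_at B (F \<tau> x)"
    obtain W where W: "open W" "{(x, \<tau>). \<tau> \<in> {0<..T} \<and> F \<tau> x \<in> cdom B ?j} = (UNIV \<times> {0<..T}) \<inter> W"
      using openin_flow_preimage[OF B.open_cdom] by blast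
    let ?V = "(UNIV \<times> {0<..T}) \<inter> (W \<inter> cdom A ?i \<times> UNIV)"
    have W_iff: "(x, s) \<in> W \<longleftrightarrow> F s x \<in> cdom B ?j" if "s \<in> {0<..T}" for s x
      using W(2) that by (auto simp: set_eq_iff)
    have c: "continuous_on (cdom A ?i) (cmap A ?i)"
      using A.homeomorphism_chart by (simp add: homeomorphism_def)
    have "continuous_on ?V (\<lambda>q. cmap A ?i (fst q))"
      by (rule continuous_on_compose2[OF c continuous_on_fst[OF continuous_on_id]]) auto
    then have c': "continuous_on ?V (\<lambda>q. (cmap A ?i (fst q), snd q))"
      by (rule continuous_on_Pair[OF _ continuous_on_snd[OF continuous_on_id]])
    have loc: "continuous_on ?V (\<lambda>q. \<psi> ?i ?j (cmap A ?i (fst q), snd q))"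
      by (rule continuous_on_compose2[OF cont c']) (auto simp: W_iff intro!: chart_in_track_dom)
    have eq: "?f q = \<psi> ?i ?j (cmap A ?i (fst q), snd q)" if "q \<in> ?V" for q
      using that by (intro chart) (auto simp: W_iff)
    have "continuous_on ?V ?f" by (rule iffD2[OF continuous_on_cong[OF refl eq] loc])
    moreover have pV: "p \<in> ?V" using x W_iff[OF x(2)] A.chart_at_in B.chart_at_in by auto
    ultimately have "continuous (at p within ?V) ?f"
      by (simp add: continuous_on_eq_continuous_within)
    moreover have "at p within ?V = at p within UNIV \<times> {0<..T}"
    proof (rule at_within_nhd)
      show "open (W \<inter> cdom A ?i \<times> UNIV)"
        using W(1) A.open_cdom by (intro open_Int open_Times) auto
    qed (use pV in auto)
    ultimately show ?thesis by simp
  qed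
  then have "continuous_on (UNIV \<times> {0<..T}) ?f" by (simp add: continuous_on_eq_continuous_within)
  then have "compact (?f ` K)"
    using K by (intro compact_continuous_image continuous_on_subset[where t = K]) auto
  then obtain C where "\<forall>r\<in>?f ` K. norm r \<le> C" using compact_imp_bounded bounded_iff by blast
  then have "\<forall>(x, \<tau>)\<in>K. f \<tau> x \<le> C" by force
  then show ?thesis ..
qed

text \<open>A bound for \<open>N \<bar>E\<^sub>N\<bar>\<close> with \<open>H\<close>, \<open>R\<close>, \<open>\<rho>\<close>, \<open>H'\<close>, \<open>r\<^sub>n\<close>, \<open>r\<^sub>t\<close> standing for the mean curvature,
  the scalar curvature, \<open>Ric(\<nu>,\<nu>)\<close>, \<open>\<partial>\<^sub>\<tau>H\<close>, \<open>dR(\<nu>)\<close> and \<open>\<partial>\<^sub>\<tau>R\<close>.\<close>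

definition error_bound :: "real \<Rightarrow> real \<Rightarrow> real \<Rightarrow> real \<Rightarrow> real \<Rightarrow> real \<Rightarrow> real" where
  "error_bound H R \<rho> H' rn rt = 2 * \<bar>H\<bar> * (2 * \<bar>R\<bar> + \<bar>\<rho>\<bar>)
    + 2 * (\<bar>H'\<bar> + \<bar>H\<bar> * \<bar>\<rho>\<bar> + \<bar>rn\<bar> / 2 + 2 * \<bar>H\<bar> * (\<bar>H\<bar> * \<bar>rn\<bar> + \<bar>rt\<bar> / 2 + H\<^sup>2 * \<bar>\<rho>\<bar>))"

text \<open>The factors 2 are bounds for N / L, and for N / (L + \<open>H\<^sup>2\<close>), which is
  smaller still. Hence \<open>N * \<bar>b\<bar>\<close> is at most \<open>2 * \<bar>H\<bar>\<close>,
  and so is \<open>\<bar>b\<bar>\<close> alone because \<open>1 \<le> N\<close>; division by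
  \<open>s\<close> only decreases the absolute value.\<close>

lemma error_bound:
  assumes N: "1 \<le> N" "N / 2 \<le> L" and s: "1 \<le> s" and b: "b = H / L"
  shows "N * \<bar>(b * (2 * R - \<rho>) + (H' + H * \<rho> + rn / 2 + b * (H * rn - rt / 2 + H\<^sup>2 * \<rho>)) / (L + H\<^sup>2)) / s\<bar>
    \<le> error_bound H R \<rho> H' rn rt"
proof -
  have L: "L > 0" using N by linarith
  have NL: "N / L \<le> 2" using N L by (simp add: divide_le_eq)
  have Nb: "N * \<bar>b\<bar> \<le> 2 * \<bar>H\<bar>"
  proof -
    have "N * \<bar>b\<bar> = (N / L) * \<bar>H\<bar>" using L b by (simp add: abs_div)
    also have "\<dots> \<le> 2 * \<bar>H\<bar>" by (rule mult_right_mono[OF NL]) simp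
    finally show ?thesis .
  qed
  have b': "\<bar>b\<bar> \<le> 2 * \<bar>H\<bar>" using Nb mult_right_mono[OF N(1), of "\<bar>b\<bar>"] by simp
  have NLH: "N / (L + H\<^sup>2) \<le> 2"
  proof -
    have "N / (L + H\<^sup>2) \<le> N / L" using N(1) L by (intro divide_left_mono) (auto simp: add_pos_nonneg)
    then show ?thesis using NL by simp
  qed
  let ?X = "H' + H * \<rho> + rn / 2 + b * (H * rn - rt / 2 + H\<^sup>2 * \<rho>)"
  let ?Y = "\<bar>H'\<bar> + \<bar>H\<bar> * \<bar>\<rho>\<bar> + \<bar>rn\<bar> / 2 + 2 * \<bar>H\<bar> * (\<bar>H\<bar> * \<bar>rn\<bar> + \<bar>rt\<bar> / 2 + H\<^sup>2 * \<bar>\<rho>\<bar>)"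
  have "\<bar>H * rn - rt / 2 + H\<^sup>2 * \<rho>\<bar> \<le> \<bar>H * rn\<bar> + \<bar>rt\<bar> / 2 + \<bar>H\<^sup>2 * \<rho>\<bar>" by linarith
  also have "\<dots> = \<bar>H\<bar> * \<bar>rn\<bar> + \<bar>rt\<bar> / 2 + H\<^sup>2 * \<bar>\<rho>\<bar>" by (simp add: abs_mult)
  finally have Z: "\<bar>b * (H * rn - rt / 2 + H\<^sup>2 * \<rho>)\<bar>
      \<le> 2 * \<bar>H\<bar> * (\<bar>H\<bar> * \<bar>rn\<bar> + \<bar>rt\<bar> / 2 + H\<^sup>2 * \<bar>\<rho>\<bar>)"
    unfolding abs_mult[of b] using b' by (intro mult_mono) auto
  have X: "\<bar>?X\<bar> \<le> ?Y"
  proof -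
    have "\<bar>?X\<bar> \<le> \<bar>H'\<bar> + \<bar>H * \<rho>\<bar> + \<bar>rn\<bar> / 2 + \<bar>b * (H * rn - rt / 2 + H\<^sup>2 * \<rho>)\<bar>" by linarith
    then show ?thesis using Z by (simp add: abs_mult)
  qed
  let ?E = "b * (2 * R - \<rho>) + ?X / (L + H\<^sup>2)"
  have LH: "L + H\<^sup>2 > 0" using L by (simp add: add_pos_nonneg)
  have "\<bar>?E / s\<bar> = \<bar>?E\<bar> / s" using s by (simp add: abs_div)
  also have "\<dots> \<le> \<bar>?E\<bar>" using s divide_left_mono[OF s abs_ge_zero[of ?E]] by simp
  also have "\<dots> \<le> \<bar>b * (2 * R - \<rho>)\<bar> + \<bar>?X / (L + H\<^sup>2)\<bar>" by (rule abs_triangle_ineq)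
  also have "\<dots> = \<bar>b\<bar> * \<bar>2 * R - \<rho>\<bar> + \<bar>?X\<bar> / (L + H\<^sup>2)" using LH by (simp add: abs_mult abs_div)
  finally have "N * \<bar>?E / s\<bar> \<le> N * (\<bar>b\<bar> * \<bar>2 * R - \<rho>\<bar> + \<bar>?X\<bar> / (L + H\<^sup>2))"
    using N(1) by (intro mult_left_mono) auto
  also have "\<dots> = (N * \<bar>b\<bar>) * \<bar>2 * R - \<rho>\<bar> + (N / (L + H\<^sup>2)) * \<bar>?X\<bar>" by (simp add: algebra_simps)
  also have "\<dots> \<le> (2 * \<bar>H\<bar>) * (2 * \<bar>R\<bar> + \<bar>\<rho>\<bar>) + 2 * ?Y"
    by (rule add_mono[OF mult_mono[OF Nb _ _ abs_ge_zero] mult_mono[OF NLH X _ abs_ge_zero]]) auto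
  finally show ?thesis unfolding error_bound_def .
qed

definition local_bound :: "'i \<Rightarrow> 'j \<Rightarrow> 'e \<times> real \<Rightarrow> real" where
  "local_bound i j p = error_bound (lmean i p) (scal j (stpos i j p))
    (ric j (stpos i j p) (nor i j p) (nor i j p)) (dlmean i j p (0, 1))
    (dscal j (stpos i j p) (nor i j p, 0)) (dscal j (stpos i j p) (0, 1))"

text \<open>Smoothness of \<open>ric\<close> and \<open>dscal\<close> is available for fixed
  arguments, so the terms that contain the normal are first expanded in the coordinate
  basis.\<close>

lemma continuous_on_local_bound: "continuous_on (track_dom i j) (local_bound i j)"
proof -
  note cont = smooth_on_imp_continuous_on
  have along: "continuous_on (track_dom i j) (\<lambda>p. h (stpos i j p))" if "continuous_on (slab j) h" for h :: "'f \<times> real \<Rightarrow> real"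
    by (rule continuous_on_compose2[OF that cont[OF smooth_stpos]]) (use track_domD(5) in blast)
  have nor: "continuous_on (track_dom i j) (\<lambda>p. nor i j p \<bullet> e)" for e
    using cont[OF smooth_nor] by (intro continuous_on_inner continuous_on_const)
  have ds: "continuous_on (track_dom i j) (\<lambda>p. dscal j (stpos i j p) h)" for h
    by (rule along[OF cont[OF smooth_on_deriv[OF smooth_scal]]])
  have "continuous_on (track_dom i j) (\<lambda>p. \<Sum>e\<in>Basis. \<Sum>e'\<in>Basis.
      (nor i j p \<bullet> e) * (nor i j p \<bullet> e') * ric j (stpos i j p) e e')"
    by (intro continuous_on_sum continuous_on_mult nor along cont smooth_ric)
  moreover have "ric j (stpos i j p) (nor i j p) (nor i j p) = (\<Sum>e\<in>Basis. \<Sum>e'\<in>Basis.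
      (nor i j p \<bullet> e) * (nor i j p \<bullet> e') * ric j (stpos i j p) e e')" if "p \<in> track_dom i j" for p
    by (rule bilinear_expand[OF bilinear_ric[OF track_domD(5)[OF that]]])
  ultimately have ric: "continuous_on (track_dom i j) (\<lambda>p. ric j (stpos i j p) (nor i j p) (nor i j p))"
    by (simp cong: continuous_on_cong)
  have "continuous_on (track_dom i j) (\<lambda>p. \<Sum>e\<in>Basis. (nor i j p \<bullet> e) * dscal j (stpos i j p) (e, 0))"
    by (intro continuous_on_sum continuous_on_mult nor ds)
  moreover have "dscal j (stpos i j p) (nor i j p, 0)
      = (\<Sum>e\<in>Basis. (nor i j p \<bullet> e) * dscal j (stpos i j p) (e, 0))" if "p \<in> track_dom i j" for p
  proof -
    have "linear (\<lambda>u. dscal j (stpos i j p) (u, 0))"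
      using linear_compose[OF _ linear_dscal[OF track_domD(5)[OF that]], of "\<lambda>u. (u, 0)"]
      by (simp add: o_def linear_iff)
    from linear_expand[OF this, of "nor i j p"] show ?thesis by simp
  qed
  ultimately have dn: "continuous_on (track_dom i j) (\<lambda>p. dscal j (stpos i j p) (nor i j p, 0))"
    by (simp cong: continuous_on_cong)
  note cont[OF smooth_lmean] along[OF cont[OF smooth_scal]] ric
    cont[OF smooth_on_deriv[OF smooth_lmean]] dn ds
  then show ?thesis
    unfolding local_bound_def error_bound_def
    by (intro continuous_on_add continuous_on_mult continuous_on_rabs continuous_on_power
        continuous_on_const continuous_on_divide) auto
qed

lemma local_bound_chart_independent:
  assumes "x \<in> cdom A i" "F \<tau> x \<in> cdom B j" "x \<in> cdom A i'" "F \<tau> x \<in> cdom B j'" and \<tau>: "\<tau> \<in> {0<..T}"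
  shows "local_bound i j (cmap A i x, \<tau>) = local_bound i' j' (cmap A i' x, \<tau>)"
proof -
  have "dlmean i j (cmap A i x, \<tau>) (0, 1) = dlmean i' j' (cmap A i' x, \<tau>) (0, 1)"
    using has_real_derivative_time_unique[OF \<tau> mean_time_derivative mean_time_derivative] assms by blast
  moreover have "linear (transition B j j' (F \<tau> x))"
    using has_derivative_bounded_linear[OF B.has_derivative_transition] assms bounded_linear.linear by blast
  \<comment> \<open>Used for the time derivative of the scalar curvature: the direction
    \<open>(0, 1)\<close> has spatial part 0 in every chart.\<close>
  then have "transition B j j' (F \<tau> x) 0 = 0" by (rule linear_0)
  ultimately show ?thesis
    unfolding local_bound_def at_chart[OF assms(1)] at_chart[OF assms(3)] snd_conv
      nor_transition[OF assms(2,4) \<tau>]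
    by (simp add: scal_transition[OF assms(2,4) \<tau>] ric_transition[OF assms(2,4) \<tau>]
        dscal_transition[OF assms(2,4) \<tau>])
qed

lemma soliton_error_bounded:
  assumes N: "1 \<le> N" "\<And>j p. p \<in> slab j \<Longrightarrow> \<bar>scal j p\<bar> \<le> N / 2"
    and \<tau>: "\<tau> \<in> {0<..T}"
  shows "N * \<bar>soliton_error T A B g F \<nu> N (x, \<tau>)\<bar>
    \<le> local_bound (chart_at A x) (chart_at B (F \<tau> x)) (cmap A (chart_at A x) x, \<tau>)"
proof -
  interpret flow_point A B T g F \<nu> N "chart_at A x" "chart_at B (F \<tau> x)" x \<tau>
  proof unfold_locales
    show "0 < N + scal j p" if "p \<in> slab j" for j p using N(1) N(2)[OF that] by linarith
  qed (use \<tau> A.chart_at_in B.chart_at_in in auto)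
  have "N / 2 \<le> L" using N(2)[OF st] lapse_eq by linarith
  then show ?thesis
    unfolding soliton_error_eq[OF refl refl] local_bound_def lmean_pt snd_conv
    by (intro error_bound N(1) speed_ge_1[OF \<tau>]) (simp_all add: tilt_def)
qed

end

theorem theorem3p4:
  fixes A :: "('i, 'm::{t2_space, second_countable_topology}, 'e::euclidean_space) atlas"
    and B :: "('j, 'o::{t2_space, second_countable_topology}, 'f::euclidean_space) atlas"
    and g :: "real \<Rightarrow> ('j, 'f) metric"
    and F :: "real \<Rightarrow> 'm \<Rightarrow> 'o"
    and \<nu> :: "real \<Rightarrow> 'm \<Rightarrow> 'j \<Rightarrow> 'f"
    and T :: real
  assumes "T > 0"
    and "smooth_atlas A" and "smooth_atlas B" and "DIM('f) = DIM('e) + 1"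
    and "smooth_metric_family T B g"
    and "smooth_immersion_family T A B F"
    and "smooth_unit_normal_family T A B g F \<nu>"
    and "mean_curvature_flow T A B g F \<nu>"
    and "backwards_ricci_flow T B g"
    and "\<exists>C. \<forall>\<tau>\<in>{0<..T}. curvature_bounded_by C B (g \<tau>)"
    and "\<exists>C. \<forall>\<tau>\<in>{0<..T}. sff_bounded_by C A B (g \<tau>) (F \<tau>) (\<nu> \<tau>)"
  shows "\<exists>N\<^sub>0>0.
    (\<forall>N\<ge>N\<^sub>0. riemannian_metric (prod_atlas T B) (spacetime_metric B g N)) \<and>
    (\<forall>K. compact K \<and> K \<subseteq> UNIV \<times> {0<..T} \<longrightarrow>
      (\<exists>C. \<forall>N\<ge>N\<^sub>0. \<forall>p\<in>K. N * \<bar>soliton_error T A B g F \<nu> N p\<bar> \<le> C))"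
proof -
  interpret flow_track A B T g F \<nu> using assms by unfold_locales auto
  obtain C where C: "\<And>j p. p \<in> slab j \<Longrightarrow> \<bar>scal j p\<bar> \<le> C"
    using scal_bounded assms(10) by blast
  \<comment> \<open>The factor 2 gives \<open>\<bar>scal j p\<bar> \<le> N / 2\<close> and the
    summand 1 gives \<open>1 \<le> N\<close>. The absolute value keeps the threshold positive
    without first showing \<open>0 \<le> C\<close>.\<close>
  let ?N = "2 * \<bar>C\<bar> + 1"
  have N: "1 \<le> N" "\<And>j p. p \<in> slab j \<Longrightarrow> \<bar>scal j p\<bar> \<le> N / 2" if "N \<ge> ?N" for N
  proof -
    show "1 \<le> N" using that by linarith
    show "\<bar>scal j p\<bar> \<le> N / 2" if "p \<in> slab j" for j p using C[OF that] \<open>N \<ge> ?N\<close> by linarith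
  qed
  show ?thesis
  proof (rule exI[of _ ?N], intro conjI allI impI)
    show "?N > 0" by linarith
    fix N assume "N \<ge> ?N"
    note N = N[OF this]
    show "riemannian_metric (prod_atlas T B) (spacetime_metric B g N)"
    proof (rule riemannian_stmet)
      show "0 < N + scal j p" if "p \<in> slab j" for j p using N(1) N(2)[OF that] by linarith
    qed
  next
    fix K :: "('m \<times> real) set"
    assume K: "compact K \<and> K \<subseteq> UNIV \<times> {0<..T}"
    let ?f = "\<lambda>\<tau> x. local_bound (chart_at A x) (chart_at B (F \<tau> x)) (cmap A (chart_at A x) x, \<tau>)"
    have "\<exists>C. \<forall>(x, \<tau>)\<in>K. ?f \<tau> x \<le> C"
      using K by (intro bounded_on_compact[OF continuous_on_local_bound] local_bound_chart_independent
          A.chart_at_in B.chart_at_in) auto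
    \<comment> \<open>\<open>C'\<close> depends on \<open>K\<close> but is fixed before N is chosen,
      since \<open>local_bound\<close> does not contain N.\<close>
    then obtain C' where C': "\<forall>(x, \<tau>)\<in>K. ?f \<tau> x \<le> C'" ..
    have "N * \<bar>soliton_error T A B g F \<nu> N p\<bar> \<le> C'" if NN: "N \<ge> ?N" and p: "p \<in> K" for N p
    proof -
      obtain x \<tau> where x: "p = (x, \<tau>)" by (cases p)
      have \<tau>: "\<tau> \<in> {0<..T}" using K p x by auto
      have "?f \<tau> x \<le> C'" using C' p x by auto
      then show ?thesis
        using soliton_error_bounded[OF N[OF NN] \<tau>, of x] unfolding x by linarith
    qed
    then show "\<exists>C. \<forall>N\<ge>?N. \<forall>p\<in>K. N * \<bar>soliton_error T A B g F \<nu> N p\<bar> \<le> C" by blast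
  qed
qed

end
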